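(* There exist universal constants $c_4\ge 0$ and $C''\ge 0$ such that the following holds. Let $X(\le k)$ be a pure simplicial complex with $X(1)=[n]$, equipped with a probability measure $\Pi_k$ on $X(k)$ and the induced measures $\Pi_i$, and let $\mathbf Y=\{\mathbf Y_1,\dots,\mathbf Y_n\}$ be an $L$-local PSD ensemble with $|\mathrm{supp}(\mathbf Y_j)|\le q$ for all $j$. Suppose $L\ge C''\cdot q^{4k}k^7 r/\varepsilon^5$ and $X$ is $(\tau,r)$-splittable for $\tau=c_4\cdot(\varepsilon/(4k\cdot q^k))^2$. Let $\mathbf Y'$ be the conditioned ensemble produced by the Propagation Rounding procedure on input $\mathbf Y$ with $\ell=k$ and $\Pi=\Pi_k$. Then \[ \mathbb E_{\mathfrak a\sim\Pi_k}\left[\left\|\{\mathbf Y'_{\mathfrak a}\}-\{\mathbf Y'_{a_1}\}\cdots\{\mathbf Y'_{a_k}\}\right\|_1\right]\le\varepsilon, \] with the expectation also taken over the randomness of the procedure.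
   Context: Simplicial complexes: downward-closed families of subsets of $[n]$, $X(i)$ the faces of size $i$; pure means every face lies in a top face. Given $\Pi_k$ on $X(k)$, $\Pi_i$ is the law of a uniformly random $i$-subset of a $\Pi_k$-random top face. Swap graph $G_{\ell_1,\ell_2}$ (for $\ell_1+\ell_2\le k$): weighted graph with vertex set $X(\ell_1)\sqcup X(\ell_2)$ (the two copies identified if $\ell_1=\ell_2$), with an edge between $\mathfrak s\in X(\ell_1)$ and $\mathfrak t\in X(\ell_2)$ iff $\mathfrak s\cap\mathfrak t=\emptyset$ and $\mathfrak s\cup\mathfrak t\in X(\ell_1+\ell_2)$, of weight $\Pi_{\ell_1+\ell_2}(\mathfrak s\cup\mathfrak t)/\binom{\ell_1+\ell_2}{\ell_1}$. The threshold rank $\mathrm{rank}_{\ge\tau}(G)$ of a weighted graph is the number of eigenvalues $\ge\tau$ of its normalized random-walk matrix. A $k$-splitting tree $\mathcal T$ is a binary tree (each internal node has two children) with $k$ leaves, each node labeled by the number of leaves below it; each internal node whose children have labels $a,b$ represents the swap graph $G_{a,b}$. $X$ is $(\tau,r)$-splittable if there is a $k$-splitting tree $\mathcal T$ such that every swap graph represented in $\mathcal T$ has threshold rank $\mathrm{rank}_{\ge\tau}\le r$. A $t$-local ensemble of $[q]$-valued variables $\mathbf Y_1,\dots,\mathbf Y_n$ consists of consistent distributions $\{\mathbf Y_S\}=\mu_S$ on $[q]^S$ for all $|S|\le t$; conditioning on $\mathbf Y_T=\beta$ ($|T|\le t-2$) gives the ensemble with $\{\mathbf Y'_S\}=\mu_{S\cup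 T}\mid\mathbf Y_T=\beta$. It is a $t$-local PSD ensemble if after every such conditioning the covariance matrix of the indicators $\mathbf 1[\mathbf Y'_S=\alpha]$ over $|S|\le(t-|T|)/2$ is positive semidefinite (as for Sum-of-Squares solutions). $\|\cdot\|_1$ is the $\ell_1$ distance of distributions. Propagation Rounding procedure (input $\mathbf Y$, $\ell$, $\Pi$ on $X(\ell)$): choose $m\in\{1,\dots,L/\ell\}$ uniformly; sample $\mathfrak s_1,\dots,\mathfrak s_m\sim\Pi$ independently; $S=\bigcup\mathfrak s_j$; sample $\eta_S\sim\{\mathbf Y_S\}$; let $\mathbf Y'$ be $\mathbf Y$ conditioned on $\mathbf Y_S=\eta_S$; then sample each $\eta_j\sim\{\mathbf Y'_j\}$ independently. *)

theory Defs
  imports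
    "HOL-Probability.Product_PMF"
    "HOL-Analysis.Infinite_Sum"
    "HOL-Library.Tree"
    "Jordan_Normal_Form.Char_Poly"
begin

section \<open>Weighted graphs and threshold rank\<close>

text \<open>
  A weighted graph on a finite vertex set \<open>V\<close> is given by its symmetric weight function \<open>w\<close>
  (weight 0 off the edges); a list \<open>vs\<close> enumerates \<open>V\<close>. The row of a vertex of weighted degree 0
  is zero, since \<open>x / 0 = 0\<close>.
\<close>

definition walk_matrix :: "'a list \<Rightarrow> ('a \<Rightarrow> 'a \<Rightarrow> real) \<Rightarrow> real mat" where
  "walk_matrix vs w = mat (length vs) (length vs)
     (\<lambda>(i, j). w (vs ! i) (vs ! j) / (\<Sum>v\<in>set vs. w (vs ! i) v))"

text \<open>
  Eigenvalues are counted with multiplicity. For symmetric nonnegative weights the walk matrix is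
  similar to a symmetric one, so all its eigenvalues are real, algebraic and geometric
  multiplicities agree, and the result does not depend on the enumeration chosen.
\<close>

definition threshold_rank :: "real \<Rightarrow> 'a set \<Rightarrow> ('a \<Rightarrow> 'a \<Rightarrow> real) \<Rightarrow> nat" where
  "threshold_rank \<tau> V w =
     (let M = walk_matrix (SOME vs. distinct vs \<and> set vs = V) w
      in \<Sum>e | eigenvalue M e \<and> e \<ge> \<tau>. order e (char_poly M))"

section \<open>Simplicial complexes, swap graphs, splittability\<close>

definition simplicial_complex :: "nat \<Rightarrow> nat set set \<Rightarrow> bool" where
  "simplicial_complex n X \<longleftrightarrow> (\<forall>A\<in>X. A \<subseteq> {1..n}) \<and> (\<forall>A\<in>X. \<forall>B. B \<subseteq> A \<longrightarrow> B \<in> X)"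

definition faces :: "nat set set \<Rightarrow> nat \<Rightarrow> nat set set" where
  "faces X i = {A \<in> X. card A = i}"

definition pure_complex :: "nat \<Rightarrow> nat set set \<Rightarrow> bool" where
  "pure_complex k X \<longleftrightarrow> (\<forall>A\<in>X. \<exists>B\<in>faces X k. A \<subseteq> B)"

definition face_pmf :: "nat set pmf \<Rightarrow> nat \<Rightarrow> nat set pmf" where
  "face_pmf \<mu> i = bind_pmf \<mu> (\<lambda>A. pmf_of_set {B. B \<subseteq> A \<and> card B = i})"

text \<open>
  Faces of different sizes are different sets, so the plain union is the disjoint union
  for \<open>a \<noteq> b\<close> and identifies the two copies for \<open>a = b\<close>.
\<close>

definition swap_vertices :: "nat set set \<Rightarrow> nat \<Rightarrow> nat \<Rightarrow> nat set set" where
  "swap_vertices X a b = faces X a \<union> faces X b"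

definition swap_edge :: "nat set set \<Rightarrow> nat \<Rightarrow> nat \<Rightarrow> nat set \<Rightarrow> nat set \<Rightarrow> bool" where
  "swap_edge X a b s t \<longleftrightarrow>
     s \<in> faces X a \<and> t \<in> faces X b \<and> s \<inter> t = {} \<and> s \<union> t \<in> faces X (a + b)"

definition swap_weight ::
  "nat set set \<Rightarrow> nat set pmf \<Rightarrow> nat \<Rightarrow> nat \<Rightarrow> nat set \<Rightarrow> nat set \<Rightarrow> real" where
  "swap_weight X \<mu> a b s t =
     (if swap_edge X a b s t \<or> swap_edge X a b t s
      then pmf (face_pmf \<mu> (a + b)) (s \<union> t) / real ((a + b) choose a) else 0)"

text \<open>
  A splitting tree is a binary tree whose node labels are determined by its shape: the label of
  a subtree is its number of leaves \<open>size1\<close>.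
\<close>

definition splittable ::
  "nat \<Rightarrow> nat set set \<Rightarrow> nat set pmf \<Rightarrow> real \<Rightarrow> nat \<Rightarrow> bool" where
  "splittable k X \<mu> \<tau> r \<longleftrightarrow>
     (\<exists>T :: unit tree. size1 T = k \<and>
        (\<forall>T1 T2. Node T1 () T2 \<in> subtrees T \<longrightarrow>
           threshold_rank \<tau> (swap_vertices X (size1 T1) (size1 T2))
             (swap_weight X \<mu> (size1 T1) (size1 T2)) \<le> r))"

section \<open>Local PSD ensembles\<close>

text \<open>
  An ensemble maps a set \<open>S\<close> of variables to the law of \<open>Y\<^sub>S\<close>, a distribution on \<open>[d]\<^sup>S\<close> (functions
  with value \<open>undefined\<close> off \<open>S\<close>). In a \<open>t\<close>-local ensemble the laws for \<open>card S > t\<close> are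
  arbitrary.
\<close>

type_synonym ensemble = "nat set \<Rightarrow> (nat \<Rightarrow> nat) pmf"

definition local_ensemble :: "nat \<Rightarrow> nat \<Rightarrow> nat \<Rightarrow> ensemble \<Rightarrow> bool" where
  "local_ensemble n d t Y \<longleftrightarrow>
     (\<forall>S. S \<subseteq> {1..n} \<and> card S \<le> t \<longrightarrow>
        set_pmf (Y S) \<subseteq> (S \<rightarrow>\<^sub>E {1..d}) \<and>
        (\<forall>S'. S' \<subseteq> S \<longrightarrow> map_pmf (\<lambda>f. restrict f S') (Y S) = Y S'))"

definition condition :: "ensemble \<Rightarrow> nat set \<Rightarrow> (nat \<Rightarrow> nat) \<Rightarrow> ensemble" where
  "condition Y T \<beta> = (\<lambda>S. map_pmf (\<lambda>f. restrict f S)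
     (cond_pmf (Y (S \<union> T)) {f. restrict f T = \<beta>}))"

definition indicator_cov ::
  "ensemble \<Rightarrow> nat set \<times> (nat \<Rightarrow> nat) \<Rightarrow> nat set \<times> (nat \<Rightarrow> nat) \<Rightarrow> real" where
  "indicator_cov Y = (\<lambda>(S, \<alpha>) (S', \<alpha>').
     measure_pmf.prob (Y (S \<union> S')) {f. restrict f S = \<alpha> \<and> restrict f S' = \<alpha>'}
     - pmf (Y S) \<alpha> * pmf (Y S') \<alpha>')"

definition psd_on :: "'a set \<Rightarrow> ('a \<Rightarrow> 'a \<Rightarrow> real) \<Rightarrow> bool" where
  "psd_on I M \<longleftrightarrow> (\<forall>i\<in>I. \<forall>j\<in>I. M i j = M j i) \<and>
     (\<forall>c. 0 \<le> (\<Sum>i\<in>I. \<Sum>j\<in>I. c i * M i j * c j))"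

definition local_PSD_ensemble :: "nat \<Rightarrow> nat \<Rightarrow> nat \<Rightarrow> ensemble \<Rightarrow> bool" where
  "local_PSD_ensemble n d t Y \<longleftrightarrow> local_ensemble n d t Y \<and>
     (\<forall>T \<beta>. T \<subseteq> {1..n} \<and> card T + 2 \<le> t \<and> \<beta> \<in> set_pmf (Y T) \<longrightarrow>
        psd_on {(S, \<alpha>). S \<subseteq> {1..n} \<and> 2 * card S \<le> t - card T \<and> \<alpha> \<in> S \<rightarrow>\<^sub>E {1..d}}
          (indicator_cov (condition Y T \<beta>)))"

definition marginal :: "ensemble \<Rightarrow> nat \<Rightarrow> nat pmf" where
  "marginal Y j = map_pmf (\<lambda>f. f j) (Y {j})"

definition product_law :: "ensemble \<Rightarrow> nat set \<Rightarrow> (nat \<Rightarrow> nat) pmf" where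
  "product_law Y A = Pi_pmf A undefined (marginal Y)"

definition l1_dist :: "'a pmf \<Rightarrow> 'a pmf \<Rightarrow> real" where
  "l1_dist p p' = (\<Sum>\<^sub>\<infinity>x. \<bar>pmf p x - pmf p' x\<bar>)"

section \<open>Propagation rounding\<close>

text \<open>
  The result is the pair of the conditioned ensemble and the sampled assignment. The number of
  rounds is at most \<open>L div l\<close>, the integer part of \<open>L / l\<close>. If \<open>S\<close> is so large that
  \<open>card (S \<union> A) > L\<close>, the conditioned law of the variables in \<open>A\<close> is not prescribed by the
  \<open>L\<close>-local ensemble; here it is then some arbitrary distribution.
\<close>

definition propagation_rounding ::
  "nat \<Rightarrow> nat \<Rightarrow> ensemble \<Rightarrow> nat \<Rightarrow> nat set pmf \<Rightarrow> (ensemble \<times> (nat \<Rightarrow> nat)) pmf" where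
  "propagation_rounding n L Y l \<mu> = do {
     m \<leftarrow> pmf_of_set {1..L div l};
     ss \<leftarrow> replicate_pmf m \<mu>;
     let S = \<Union>(set ss);
     \<beta> \<leftarrow> Y S;
     let Y' = condition Y S \<beta>;
     \<eta> \<leftarrow> product_law Y' {1..n};
     return_pmf (Y', \<eta>)
   }"

end

theory Submission
  imports Defs "HOL-Computational_Algebra.Fundamental_Theorem_Algebra"
begin

text \<open>
  Idea (after Barak, Raghavendra and Steurer). For an ensemble \<open>Z\<close> let \<open>C(s, t)\<close> be the sum of the
  squared covariances of the indicators of \<open>Z\<^sub>s\<close> and \<open>Z\<^sub>t\<close>. Down the splitting tree the error is at
  most the sum, over the internal nodes, of the \<open>\<ell>\<^sub>1\<close>-distance between the joint law of \<open>(Z\<^sub>s, Z\<^sub>t)\<close>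
  and the product of the laws of \<open>Z\<^sub>s\<close> and \<open>Z\<^sub>t\<close> for a random edge \<open>(s, t)\<close> of the swap graph, and each of these is controlled by the average of \<open>C\<close> over
  the edges. By the Schur product theorem \<open>C\<close> is a positive semidefinite kernel, so a spectral
  decomposition of the swap walk bounds its edge average by \<open>\<tau>\<close> plus \<open>\<surd>r\<close> times the \<open>L\<^sup>2\<close>-norm of
  \<open>C\<close> over independent pairs of vertices. Finally, \<open>C(s, t)\<close> is at most the drop of the conditional
  variance of \<open>Z\<^sub>s\<close> when \<open>Z\<^sub>t\<close> is revealed; these drops telescope over the rounds, so for a
  uniformly random number of rounds the average of \<open>C\<close> over independent pairs is \<open>O(k\<^sup>2 / (L / k))\<close>.
  All square roots are replaced by \<open>\<bar>x\<bar> \<le> \<delta>/2 + x\<^sup>2/(2\<delta>)\<close>, which commutes with averaging. In the last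
  two rounds the locality \<open>L\<close> may be exhausted and the trivial bound 2 is used.
\<close>

section \<open>Spectral theorem for real symmetric matrices\<close>

text \<open>The kernel is quadratic in the covariances for two reasons: entrywise squares are what
  the Schur product keeps positive semidefinite, and they are also what a variance drop controls.
  Three mismatches shape the rest. The spectral step ends in averages of \<open>C\<^sup>2\<close>,
  while telescoping controls averages of C; since C is at most 2, \<open>C\<^sup>2\<close> is at
  most 2C. A node of the tree compares faces of any sizes, while a round reveals a whole top face;
  revealing more never lowers the potential, so a random face t may be enlarged to the random top
  face containing it. And for r = 0 the bound on L would be empty, so r at least 1 has to be read
  off from the splitting tree, which needs an internal node; k = 1 is treated apart. Two parameters
  remain free: \<delta> for the passage from l1 to squares, which meets at most \<open>q^k\<close>
  atoms and is of order \<open>\<epsilon> / (k q^k)\<close>, and K for the top eigenvectors, of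
  order \<open>k\<^sup>2 q^k r / \<epsilon>\<^sup>2\<close>.\<close>

lemma symmetric_real_eigenvector:
  fixes A :: "real mat"
  assumes A: "A \<in> carrier_mat n n" and sym: "A\<^sup>T = A" and n: "n > 0"
  obtains e v where "v \<in> carrier_vec n" "scalar_prod v v = 1" "A *\<^sub>v v = e \<cdot>\<^sub>v v"
proof -
  define B where "B = map_mat complex_of_real A"
  have B: "B \<in> carrier_mat n n" using A by (simp add: B_def)
  have "degree (char_poly B) = n" using degree_monic_char_poly[OF B] by simp
  hence "\<not> constant (poly (char_poly B))" using n by (simp add: constant_degree)
  then obtain z where "poly (char_poly B) z = 0" using fundamental_theorem_of_algebra by blast
  hence "eigenvalue B z" using eigenvalue_root_char_poly[OF B] by simp
  then obtain v where v: "v \<in> carrier_vec n" "v \<noteq> 0\<^sub>v n" "B *\<^sub>v v = z \<cdot>\<^sub>v v"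
    using B by (auto simp: eigenvalue_def eigenvector_def)
  define x where "x i = Re (v $ i)" for i
  define y where "y i = Im (v $ i)" for i
  have row: "(\<Sum>j<n. complex_of_real (A $$ (i,j)) * v $ j) = z * v $ i" if i: "i < n" for i
  proof -
    have "(B *\<^sub>v v) $ i = (\<Sum>j<n. complex_of_real (A $$ (i,j)) * v $ j)"
      using i A v(1) by (simp add: B_def scalar_prod_def atLeast0LessThan)
    thus ?thesis using i v(1) by (simp add: v(3))
  qed
  have rx: "(\<Sum>j<n. A $$ (i,j) * x j) = Re z * x i - Im z * y i" if "i < n" for i
    using arg_cong[OF row[OF that], of Re] by (simp add: x_def y_def)
  have ry: "(\<Sum>j<n. A $$ (i,j) * y j) = Re z * y i + Im z * x i" if "i < n" for i
    using arg_cong[OF row[OF that], of Im] by (simp add: x_def y_def)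
  have Asym: "A $$ (i,j) = A $$ (j,i)" if "i < n" "j < n" for i j
    using sym A that by (metis carrier_matD index_transpose_mat(1))
  \<comment> \<open>With v = x + iy, symmetry gives y.Ax = x.Ay. Evaluating both sides by the real
    and imaginary parts of the eigenvalue equation leaves Im z times the squared norm of v.\<close>
  have "(\<Sum>i<n. y i * (Re z * x i - Im z * y i)) = (\<Sum>i<n. \<Sum>j<n. y i * (A $$ (i,j) * x j))"
    by (simp add: rx[symmetric] sum_distrib_left)
  also have "\<dots> = (\<Sum>j<n. \<Sum>i<n. y i * (A $$ (i,j) * x j))" by (rule sum.swap)
  also have "\<dots> = (\<Sum>j<n. x j * (\<Sum>i<n. A $$ (j,i) * y i))"
    unfolding sum_distrib_left by (intro sum.cong refl) (simp add: Asym)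
  also have "\<dots> = (\<Sum>j<n. x j * (Re z * y j + Im z * x j))"
    by (intro sum.cong refl) (simp add: ry)
  finally have "Im z * (\<Sum>i<n. (x i)\<^sup>2 + (y i)\<^sup>2) = 0"
    by (simp add: algebra_simps power2_eq_square sum.distrib sum_subtractf sum_distrib_left)
  moreover have "(\<Sum>i<n. (x i)\<^sup>2 + (y i)\<^sup>2) > 0"
  proof -
    obtain i where "i < n" "v $ i \<noteq> 0" using v by (metis carrier_vecD eq_vecI index_zero_vec)
    moreover from this have "(x i)\<^sup>2 + (y i)\<^sup>2 > 0"
      by (simp add: x_def y_def complex_eq_iff sum_power2_gt_zero_iff)
    ultimately show ?thesis by (intro sum_pos2[of _ i]) auto
  qed
  ultimately have Im0: "Im z = 0" by auto
  \<comment> \<open>Once Im z = 0, the real and imaginary parts of v both solve the real eigenvalue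
    equation, and they do not both vanish.\<close>
  have "\<exists>u. (\<Sum>i<n. (u i)\<^sup>2) > 0 \<and> (\<forall>i<n. (\<Sum>j<n. A $$ (i,j) * u j) = Re z * u i)"
  proof (cases "(\<Sum>i<n. (x i)\<^sup>2) > 0")
    case True thus ?thesis using rx Im0 by auto
  next
    case False
    hence "(\<Sum>i<n. (y i)\<^sup>2) > 0" using \<open>(\<Sum>i<n. (x i)\<^sup>2 + (y i)\<^sup>2) > 0\<close> by (simp add: sum.distrib)
    thus ?thesis using ry Im0 by auto
  qed
  then obtain u where u: "(\<Sum>i<n. (u i)\<^sup>2) > 0"
    "\<And>i. i < n \<Longrightarrow> (\<Sum>j<n. A $$ (i,j) * u j) = Re z * u i" by blast
  define c where "c = sqrt (\<Sum>i<n. (u i)\<^sup>2)"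
  have c: "c > 0" "c\<^sup>2 = (\<Sum>i<n. (u i)\<^sup>2)" using u(1) by (auto simp: c_def)
  define w where "w = vec n (\<lambda>i. u i / c)"
  have "scalar_prod w w = (\<Sum>i<n. (u i)\<^sup>2) / c\<^sup>2"
    by (simp add: w_def scalar_prod_def atLeast0LessThan power2_eq_square sum_divide_distrib)
  hence "scalar_prod w w = 1" using c u(1) by simp
  moreover have "A *\<^sub>v w = Re z \<cdot>\<^sub>v w"
  proof (rule eq_vecI)
    fix i assume "i < dim_vec (Re z \<cdot>\<^sub>v w)"
    hence i: "i < n" by (simp add: w_def)
    have "(A *\<^sub>v w) $ i = (\<Sum>j<n. A $$ (i,j) * u j) / c"
      using i A by (simp add: w_def scalar_prod_def atLeast0LessThan sum_divide_distrib)
    thus "(A *\<^sub>v w) $ i = (Re z \<cdot>\<^sub>v w) $ i" using i u(2) by (simp add: w_def)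
  qed (use A in \<open>simp add: w_def\<close>)
  ultimately show ?thesis using that[of w "Re z"] by (simp add: w_def)
qed

text \<open>The reflection that exchanges v and the first unit vector e_0, along u = v - e_0; it
  completes v to an orthonormal basis without Gram-Schmidt. It degenerates for u = 0, hence the case
  split.\<close>

lemma householder:
  fixes v :: "real vec"
  assumes v: "v \<in> carrier_vec n" "scalar_prod v v = 1" and n: "n > 0"
  obtains H where "H \<in> carrier_mat n n" "H\<^sup>T = H" "H * H = 1\<^sub>m n" "col H 0 = v"
proof (cases "v = unit_vec n 0")
  case True
  show ?thesis by (rule that[of "1\<^sub>m n"]) (use True n in auto)
next
  case False
  define u where "u i = v $ i - (if i = 0 then 1 else 0)" for i
  define \<rho> where "\<rho> = (\<Sum>i<n. (u i)\<^sup>2)"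
  have vv: "(\<Sum>i<n. (v $ i)\<^sup>2) = 1"
    using v by (simp add: scalar_prod_def atLeast0LessThan power2_eq_square)
  have "\<exists>i<n. u i \<noteq> 0"
  proof (rule ccontr)
    assume "\<not> (\<exists>i<n. u i \<noteq> 0)"
    hence "v = unit_vec n 0" using v(1) by (intro eq_vecI) (auto simp: u_def)
    thus False using False by simp
  qed
  then obtain i where "i < n" "u i \<noteq> 0" by blast
  hence \<rho>0: "\<rho> > 0" unfolding \<rho>_def by (intro sum_pos2[of _ i]) auto
  have "\<rho> = (\<Sum>i<n. (v $ i)\<^sup>2 + (if i = 0 then 1 - 2 * v $ 0 else 0))"
    unfolding \<rho>_def by (intro sum.cong refl) (simp add: u_def power2_eq_square algebra_simps)
  \<comment> \<open>Thus 2 u_0 / \<rho> = -1, which is why the first column of \<open>H\<close> is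
    e_0 + u = v.\<close>
  hence \<rho>: "\<rho> = 2 - 2 * v $ 0" using n by (simp add: sum.distrib vv)
  define H where "H = mat n n (\<lambda>(i,j). (if i = j then 1 else 0) - 2 * u i * u j / \<rho>)"
  have H: "H \<in> carrier_mat n n" by (simp add: H_def)
  have "H\<^sup>T = H" by (rule eq_matI) (auto simp: H_def)
  moreover have "H * H = 1\<^sub>m n"
  proof (rule eq_matI)
    fix i j assume "i < dim_row (1\<^sub>m n)" "j < dim_col (1\<^sub>m n)"
    hence ij: "i < n" "j < n" by auto
    have "(H * H) $$ (i,j) = (\<Sum>k<n. ((if i = k then 1 else 0) - 2 * u i * u k / \<rho>) * ((if k = j then 1 else 0) - 2 * u k * u j / \<rho>))"
      using ij by (simp add: H_def scalar_prod_def atLeast0LessThan)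
    also have "\<dots> = (\<Sum>k<n. (if k = i then (if i = j then 1 else 0) - 2 * u i * u j / \<rho> else 0)
        + (if k = j then - (2 * u i * u j / \<rho>) else 0) + 4 * u i * u j / \<rho>\<^sup>2 * (u k)\<^sup>2)"
      by (intro sum.cong refl) (auto simp: algebra_simps power2_eq_square)
    also have "\<dots> = (if i = j then 1 else 0) - 4 * u i * u j / \<rho> + 4 * u i * u j / \<rho>\<^sup>2 * \<rho>"
      using ij by (simp only: sum.distrib sum_distrib_left[symmetric] sum.delta' finite_lessThan) (simp add: \<rho>_def)
    also have "\<dots> = (if i = j then 1 else 0)" using \<rho>0 by (simp add: power2_eq_square)
    finally show "(H * H) $$ (i,j) = 1\<^sub>m n $$ (i,j)" using ij by simp
  qed (auto simp: H_def)
  moreover have "col H 0 = v"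
  proof (rule eq_vecI)
    fix i assume "i < dim_vec v"
    hence i: "i < n" using v by simp
    have "2 * u 0 / \<rho> = -1" using \<rho>0 \<rho> by (simp add: u_def[of 0] field_simps)
    hence "u i * (2 * u 0 / \<rho>) = - u i" by simp
    moreover have "col H 0 $ i = (if i = 0 then 1 else 0) - u i * (2 * u 0 / \<rho>)"
      using i n by (simp add: H_def)
    ultimately have "col H 0 $ i = (if i = 0 then 1 else 0) + u i" by simp
    thus "col H 0 $ i = v $ i" by (simp add: u_def)
  qed (use v in \<open>simp add: H_def\<close>)
  ultimately show ?thesis using that H by blast
qed

text \<open>Deflation: conjugation by a reflection whose first column is an eigenvector clears the
  first column, symmetry clears the first row with it, and the remaining block is symmetric of size
  one less.\<close>

theorem symmetric_mat_diagonalizable: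
  fixes A :: "real mat"
  assumes "A \<in> carrier_mat n n" "A\<^sup>T = A"
  shows "\<exists>U. U \<in> carrier_mat n n \<and> U\<^sup>T * U = 1\<^sub>m n \<and> diagonal_mat (U\<^sup>T * A * U)"
  using assms
proof (induction n arbitrary: A)
  case 0
  thus ?case by (intro exI[of _ "1\<^sub>m 0"]) (auto simp: diagonal_mat_def)
next
  case (Suc m)
  let ?n = "Suc m"
  obtain e v where v: "v \<in> carrier_vec ?n" "scalar_prod v v = 1" "A *\<^sub>v v = e \<cdot>\<^sub>v v"
    using symmetric_real_eigenvector[OF Suc.prems] by blast
  obtain H where H: "H \<in> carrier_mat ?n ?n" "H\<^sup>T = H" "H * H = 1\<^sub>m ?n" "col H 0 = v"
    using householder[OF v(1,2)] by blast
  define B where "B = H * A * H"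
  have B: "B \<in> carrier_mat ?n ?n" using H(1) Suc.prems(1) by (simp add: B_def)
  have BT: "B\<^sup>T = B"
    using H(1,2) Suc.prems unfolding B_def by (simp add: transpose_mult[of _ ?n ?n _ ?n])
  have Bs: "B $$ (i,j) = B $$ (j,i)" if "i < ?n" "j < ?n" for i j
    using BT B that by (metis carrier_matD index_transpose_mat(1))
  have colB: "col B 0 = e \<cdot>\<^sub>v unit_vec ?n 0"
  proof -
    have "col (A * H) 0 = A *\<^sub>v col H 0" by (rule col_mult2[OF Suc.prems(1) H(1)]) simp
    moreover have "col (H * (A * H)) 0 = H *\<^sub>v col (A * H) 0"
      by (rule col_mult2[OF H(1) mult_carrier_mat[OF Suc.prems(1) H(1)]]) simp
    moreover have "B = H * (A * H)"
      unfolding B_def by (rule assoc_mult_mat[OF H(1) Suc.prems(1) H(1)])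
    ultimately have "col B 0 = H *\<^sub>v (A *\<^sub>v col H 0)" by simp
    also have "\<dots> = e \<cdot>\<^sub>v (H *\<^sub>v v)" using H(1,4) v by (simp add: mult_mat_vec)
    also have "H *\<^sub>v v = col (H * H) 0"
      using H(1,4) col_mult2[OF H(1) H(1), of 0] by simp
    also have "\<dots> = unit_vec ?n 0" using H(3) by simp
    finally show ?thesis .
  qed
  define B' where "B' = mat m m (\<lambda>(i,j). B $$ (Suc i, Suc j))"
  have B': "B' \<in> carrier_mat m m" by (simp add: B'_def)
  have "B'\<^sup>T = B'" by (rule eq_matI) (auto simp: B'_def Bs)
  from Suc.IH[OF B' this] obtain U' where U': "U' \<in> carrier_mat m m" "U'\<^sup>T * U' = 1\<^sub>m m"
    "diagonal_mat (U'\<^sup>T * B' * U')" by blast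
  have B0: "B $$ (i, 0) = (if i = 0 then e else 0)" if "i < ?n" for i
    using arg_cong[OF colB, of "\<lambda>x. x $ i"] that B by simp
  define E where "E = mat 1 1 (\<lambda>_. e)"
  have E: "E \<in> carrier_mat 1 1" by (simp add: E_def)
  have Bblock: "B = four_block_mat E (0\<^sub>m 1 m) (0\<^sub>m m 1) B'"
    by (rule eq_matI) (use B B0 Bs[of 0] in \<open>auto simp: E_def B'_def\<close>)
  define V where "V = four_block_mat (1\<^sub>m 1) (0\<^sub>m 1 m) (0\<^sub>m m 1) U'"
  have V: "V \<in> carrier_mat ?n ?n" 
    using four_block_carrier_mat[OF one_carrier_mat U'(1), of 1] by (simp add: V_def)
  have VT: "V\<^sup>T = four_block_mat (1\<^sub>m 1) (0\<^sub>m 1 m) (0\<^sub>m m 1) (U'\<^sup>T)"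
    unfolding V_def by (subst transpose_four_block_mat[of _ 1 1 _ m _ m]) (use U'(1) in auto)
  have VV: "V\<^sup>T * V = 1\<^sub>m ?n"
    unfolding VT unfolding V_def
    by (subst mult_four_block_mat[of _ 1 1 _ m _ m _ _ 1 _ m]) (use U' in auto)
  have VB: "V\<^sup>T * B * V = four_block_mat E (0\<^sub>m 1 m) (0\<^sub>m m 1) (U'\<^sup>T * B' * U')"
    unfolding VT Bblock unfolding V_def
    by (subst mult_four_block_mat[of _ 1 1 _ m _ m _ _ 1 _ m];
        (subst mult_four_block_mat[of _ 1 1 _ m _ m _ _ 1 _ m])?) (use U' B' E in auto)
  define U where "U = H * V"
  have U: "U \<in> carrier_mat ?n ?n" using H(1) V by (simp add: U_def)
  have UT: "U\<^sup>T = V\<^sup>T * H" using H V by (simp add: U_def transpose_mult[of _ ?n ?n _ ?n])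
  have VTc: "V\<^sup>T \<in> carrier_mat ?n ?n" using V by simp
  have "U\<^sup>T * U = V\<^sup>T * (H * H) * V"
    unfolding UT unfolding U_def using H(1) V VTc by (simp add: assoc_mult_mat[of _ ?n ?n _ ?n _ ?n])
  hence UU: "U\<^sup>T * U = 1\<^sub>m ?n" using H(3) VV VTc by simp
  have "U\<^sup>T * A * U = V\<^sup>T * B * V"
    unfolding UT unfolding U_def B_def using H(1) V VTc Suc.prems(1)
    by (simp add: assoc_mult_mat[of _ ?n ?n _ ?n _ ?n])
  moreover have "diagonal_mat (V\<^sup>T * B * V)"
    unfolding VB diagonal_mat_def
  proof (intro allI impI)
    fix i j assume a: "i < dim_row (four_block_mat E (0\<^sub>m 1 m) (0\<^sub>m m 1) (U'\<^sup>T * B' * U'))"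
      "j < dim_col (four_block_mat E (0\<^sub>m 1 m) (0\<^sub>m m 1) (U'\<^sup>T * B' * U'))" "i \<noteq> j"
    have d: "(U'\<^sup>T * B' * U') $$ (i', j') = 0" if "i' < m" "j' < m" "i' \<noteq> j'" for i' j'
      using U'(3) that U'(1) B' by (simp add: diagonal_mat_def)
    have dims: "dim_row (U'\<^sup>T * B' * U') = m" "dim_col (U'\<^sup>T * B' * U') = m" using U'(1) by auto
    from a show "four_block_mat E (0\<^sub>m 1 m) (0\<^sub>m m 1) (U'\<^sup>T * B' * U') $$ (i, j) = 0"
      using d[of "i - 1" "j - 1"] dims E by (auto simp del: index_mult_mat)
  qed
  ultimately show ?case using U UU by auto
qed

lemma sum_rotate3:
  "(\<Sum>i\<in>A. \<Sum>j\<in>B. \<Sum>k\<in>C. F i j k) = (\<Sum>k\<in>C. \<Sum>i\<in>A. \<Sum>j\<in>B. F i j k)"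
proof -
  have "(\<Sum>i\<in>A. \<Sum>j\<in>B. \<Sum>k\<in>C. F i j k) = (\<Sum>i\<in>A. \<Sum>k\<in>C. \<Sum>j\<in>B. F i j k)"
    by (intro sum.cong refl sum.swap)
  also have "\<dots> = (\<Sum>k\<in>C. \<Sum>i\<in>A. \<Sum>j\<in>B. F i j k)" by (rule sum.swap)
  finally show ?thesis .
qed

lemma sum_rotate4:
  "(\<Sum>i\<in>A. \<Sum>j\<in>B. \<Sum>k\<in>C. \<Sum>m\<in>D. F i j k m) = (\<Sum>k\<in>C. \<Sum>m\<in>D. \<Sum>i\<in>A. \<Sum>j\<in>B. F i j k m)"
  by (subst sum_rotate3) (intro sum.cong refl sum_rotate3)

text \<open>Turns the algebraic multiplicities in \<open>threshold_rank\<close> into a count of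
  indices once the characteristic polynomial is split.\<close>

lemma order_prod_linear:
  fixes l :: "nat \<Rightarrow> real"
  assumes "finite K"
  shows "order e (\<Prod>k\<in>K. [:- l k, 1:]) = card {k\<in>K. l k = e}"
  using assms
proof (induction K rule: finite_induct)
  case (insert k K)
  have nz: "(\<Prod>k\<in>insert k K. [:- l k, 1:]) \<noteq> 0" using insert.hyps(1) by simp
  have eq: "(\<Prod>k\<in>insert k K. [:- l k, 1:]) = [:- l k, 1:] * (\<Prod>k\<in>K. [:- l k, 1:])"
    using insert.hyps by (rule prod.insert)
  have "order e (\<Prod>k\<in>insert k K. [:- l k, 1:]) = order e [:- l k, 1:] + card {k\<in>K. l k = e}"
    unfolding eq insert.IH[symmetric] using nz unfolding eq by (rule order_mult)
  moreover have "order e [:- l k, 1:] = (if l k = e then 1 else 0)"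
    by (simp add: order_linear')
  moreover have "{j\<in>insert k K. l j = e} = (if l k = e then insert k {k\<in>K. l k = e} else {k\<in>K. l k = e})"
    by auto
  ultimately show ?case using insert.hyps by simp
qed auto

text \<open>The spectral theorem in coordinates, with \<open>u i k\<close> the entry i of
  eigenvector k. The two orthogonality relations are those of the columns and of the rows; the
  characteristic polynomial is recorded because \<open>threshold_rank\<close> counts eigenvalues
  with algebraic multiplicity.\<close>

lemma symmetric_kernel_spectral:
  fixes a :: "nat \<Rightarrow> nat \<Rightarrow> real"
  assumes sym: "\<And>i j. i < n \<Longrightarrow> j < n \<Longrightarrow> a i j = a j i"
  obtains u l where
    "\<And>j k. j < n \<Longrightarrow> k < n \<Longrightarrow> (\<Sum>i<n. u i j * u i k) = (if j = k then 1 else 0)"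
    "\<And>i j. i < n \<Longrightarrow> j < n \<Longrightarrow> (\<Sum>k<n. u i k * u j k) = (if i = j then 1 else 0)"
    "\<And>i j. i < n \<Longrightarrow> j < n \<Longrightarrow> a i j = (\<Sum>k<n. l k * u i k * u j k)"
    "char_poly (mat n n (\<lambda>(i, j). a i j)) = (\<Prod>k<n. [:- l k, 1:])"
proof -
  define A where "A = mat n n (\<lambda>(i, j). a i j)"
  have A: "A \<in> carrier_mat n n" by (simp add: A_def)
  have "A\<^sup>T = A" by (rule eq_matI) (auto simp: A_def sym)
  from symmetric_mat_diagonalizable[OF A this] obtain U where U: "U \<in> carrier_mat n n"
    "U\<^sup>T * U = 1\<^sub>m n" "diagonal_mat (U\<^sup>T * A * U)" by blast
  have UT: "U\<^sup>T \<in> carrier_mat n n" using U by simp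
  have UU: "U * U\<^sup>T = 1\<^sub>m n" using mat_mult_left_right_inverse[OF UT U(1,2)] .
  define D where "D = U\<^sup>T * A * U"
  have D: "D \<in> carrier_mat n n" using U A by (simp add: D_def)
  have dD: "D $$ (i,j) = 0" if "i < n" "j < n" "i \<noteq> j" for i j
    using U(3) that D by (auto simp: diagonal_mat_def D_def[symmetric])
  have "U * D * U\<^sup>T = (U * U\<^sup>T) * A * (U * U\<^sup>T)"
    unfolding D_def using U(1) UT A by (simp add: assoc_mult_mat[of _ n n _ n _ n])
  hence AU: "A = U * D * U\<^sup>T" using A by (simp add: UU)
  define u where "u i j = U $$ (i,j)" for i j
  define l where "l k = D $$ (k,k)" for k
  have "(\<Sum>i<n. u i j * u i k) = (if j = k then 1 else 0)" if "j < n" "k < n" for j k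
  proof -
    have "(U\<^sup>T * U) $$ (j,k) = (\<Sum>i<n. u i j * u i k)"
      using U(1) that by (simp add: scalar_prod_def u_def atLeast0LessThan)
    thus ?thesis using that by (simp add: U(2))
  qed
  moreover have "(\<Sum>k<n. u i k * u j k) = (if i = j then 1 else 0)" if "i < n" "j < n" for i j
  proof -
    have "(U * U\<^sup>T) $$ (i,j) = (\<Sum>k<n. u i k * u j k)"
      using U(1) that by (simp add: scalar_prod_def u_def atLeast0LessThan)
    thus ?thesis using that by (simp add: UU)
  qed
  moreover have "a i j = (\<Sum>k<n. l k * u i k * u j k)" if ij: "i < n" "j < n" for i j
  proof -
    have UD: "(U * D) $$ (i,k) = l k * u i k" if "k < n" for k
    proof -
      have "(U * D) $$ (i,k) = (\<Sum>m<n. u i m * D $$ (m,k))"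
        using U(1) D that ij by (simp add: scalar_prod_def u_def atLeast0LessThan)
      also have "\<dots> = (\<Sum>m<n. if m = k then u i k * l k else 0)"
        using that by (intro sum.cong) (auto simp: dD l_def)
      finally show ?thesis using that by simp
    qed
    have "(W * U\<^sup>T) $$ (i,j) = (\<Sum>k<n. W $$ (i,k) * u j k)" if "W \<in> carrier_mat n n" for W
      using U(1) ij that by (simp add: scalar_prod_def u_def atLeast0LessThan)
    from this[of "U * D"] have "A $$ (i,j) = (\<Sum>k<n. (U * D) $$ (i,k) * u j k)"
      using AU U(1) D by simp
    also have "\<dots> = (\<Sum>k<n. l k * u i k * u j k)" by (intro sum.cong) (auto simp: UD)
    finally show ?thesis using ij by (simp add: A_def)
  qed
  moreover have "char_poly A = (\<Prod>k<n. [:- l k, 1:])"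
  proof -
    have "similar_mat A D"
      unfolding similar_mat_def similar_mat_wit_def Let_def
      by (rule exI[of _ U], rule exI[of _ "U\<^sup>T"]) (use U(1,2) UT UU AU A D in auto)
    hence "char_poly A = char_poly D" by (rule char_poly_similar)
    also have "upper_triangular D" using D dD by (auto simp: upper_triangular_def)
    hence "char_poly D = (\<Prod>a\<leftarrow>diag_mat D. [:- a, 1:])" by (rule char_poly_upper_triangular[OF D])
    also have "\<dots> = (\<Prod>k<n. [:- l k, 1:])"
      using D by (simp add: diag_mat_def l_def[abs_def] prod.list_conv_set_nth atLeast0LessThan)
    finally show ?thesis .
  qed
  ultimately show ?thesis using that[of u l] by (simp add: A_def)
qed

section \<open>Positive semidefinite kernels and threshold rank\<close>

text \<open>An eigenvalue is the value of the quadratic form at its unit eigenvector, hence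
  nonnegative; scaling each eigenvector by the root of its eigenvalue gives the Gram
  vectors.\<close>

lemma psd_on_gram:
  assumes I: "finite I" and psd: "psd_on I M"
  obtains n :: nat and g where "\<And>i j. i \<in> I \<Longrightarrow> j \<in> I \<Longrightarrow> M i j = (\<Sum>k<n. g k i * g k j)"
proof -
  obtain f n where f: "bij_betw f {..<n::nat} I"
    using ex_bij_betw_nat_finite[OF I] by (auto simp: atLeast0LessThan)
  have fI: "f i \<in> I" if "i < n" for i using f that by (auto simp: bij_betw_def)
  have sym: "M (f i) (f j) = M (f j) (f i)" if "i < n" "j < n" for i j
    using psd fI that by (auto simp: psd_on_def)
  obtain u l where u:
    "\<And>j k. j < n \<Longrightarrow> k < n \<Longrightarrow> (\<Sum>i<n. u i j * u i k) = (if j = k then 1 else 0)"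
    "\<And>i j. i < n \<Longrightarrow> j < n \<Longrightarrow> M (f i) (f j) = (\<Sum>k<n. l k * u i k * u j k)"
    by (rule symmetric_kernel_spectral[of n "\<lambda>i j. M (f i) (f j)", OF sym]) (assumption, assumption, rule that)
  define h where "h = the_inv_into {..<n} f"
  have h: "h (f i) = i" if "i < n" for i
    using f that by (auto simp: h_def bij_betw_def the_inv_into_f_f)
  have l: "l m \<ge> 0" if m: "m < n" for m
  proof -
    have "0 \<le> (\<Sum>i\<in>I. \<Sum>j\<in>I. u (h i) m * M i j * u (h j) m)"
      using psd[unfolded psd_on_def] by (auto dest!: spec[of _ "\<lambda>i. u (h i) m"])
    also have "\<dots> = (\<Sum>i<n. \<Sum>j<n. u i m * (\<Sum>k<n. l k * u i k * u j k) * u j m)"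
      by (simp add: sum.reindex_bij_betw[OF f, symmetric] h u(2))
    also have "\<dots> = (\<Sum>i<n. \<Sum>j<n. \<Sum>k<n. l k * (u i m * u i k) * (u j m * u j k))"
      unfolding sum_distrib_left sum_distrib_right by (intro sum.cong refl) (simp only: mult_ac)
    also have "\<dots> = (\<Sum>k<n. \<Sum>i<n. \<Sum>j<n. l k * (u i m * u i k) * (u j m * u j k))"
      by (rule sum_rotate3)
    also have "\<dots> = (\<Sum>k<n. l k * (\<Sum>i<n. u i m * u i k) * (\<Sum>j<n. u j m * u j k))"
      by (intro sum.cong refl) (simp only: mult.assoc[of _ "sum _ _"] sum_product, simp only: sum_distrib_left mult.assoc)
    also have "\<dots> = (\<Sum>k<n. if k = m then l m else 0)"
      using m by (intro sum.cong) (auto simp: u(1))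
    also have "\<dots> = l m" using m by simp
    finally show ?thesis .
  qed
  show ?thesis
  proof (rule that[where n = n and g = "\<lambda>k i. sqrt (l k) * u (h i) k"])
    fix i j assume "i \<in> I" "j \<in> I"
    then obtain i' j' where ij: "i' < n" "j' < n" "i = f i'" "j = f j'"
      using f by (auto simp: bij_betw_def)
    show "M i j = (\<Sum>k<n. sqrt (l k) * u (h i) k * (sqrt (l k) * u (h j) k))"
      unfolding ij u(2)[OF ij(1,2)] h[OF ij(1)] h[OF ij(2)]
    proof (intro sum.cong refl)
      fix k assume "k \<in> {..<n}"
      hence "sqrt (l k) * sqrt (l k) = l k" using l by simp
      thus "l k * u i' k * u j' k = sqrt (l k) * u i' k * (sqrt (l k) * u j' k)"
        by (metis mult.assoc mult.left_commute)
    qed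
  qed
qed

text \<open>Schur's product theorem: if \<open>M\<close> is the Gram matrix of vectors g, its
  entrywise square is the Gram matrix of their tensor squares, indexed by pairs (k, m). Summing over
  blocks amounts to testing with coefficients that are constant on each block.\<close>

lemma psd_on_block_squares:
  assumes V: "finite V" "\<And>s. s \<in> V \<Longrightarrow> finite (R s)" and psd: "psd_on (Sigma V R) M"
  shows "psd_on V (\<lambda>s t. \<Sum>\<alpha>\<in>R s. \<Sum>\<beta>\<in>R t. (M (s, \<alpha>) (t, \<beta>))\<^sup>2)"
proof -
  let ?I = "Sigma V R"
  have I: "finite ?I" using V by auto
  obtain n :: nat and g where g: "\<And>i j. i \<in> ?I \<Longrightarrow> j \<in> ?I \<Longrightarrow> M i j = (\<Sum>k<n. g k i * g k j)"
    by (rule psd_on_gram[OF I psd]) (rule that)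
  have sym: "M i j = M j i" if "i \<in> ?I" "j \<in> ?I" for i j using psd that by (auto simp: psd_on_def)
  show ?thesis unfolding psd_on_def
  proof (intro conjI ballI allI)
    fix s t assume "s \<in> V" "t \<in> V"
    thus "(\<Sum>\<alpha>\<in>R s. \<Sum>\<beta>\<in>R t. (M (s, \<alpha>) (t, \<beta>))\<^sup>2) = (\<Sum>\<alpha>\<in>R t. \<Sum>\<beta>\<in>R s. (M (t, \<alpha>) (s, \<beta>))\<^sup>2)"
      by (subst sum.swap) (intro sum.cong refl arg_cong[where f = "\<lambda>x. x\<^sup>2"] sym, auto)
  next
    fix c :: "'a \<Rightarrow> real"
    let ?d = "\<lambda>i. c (fst i)"
    have S: "(\<Sum>s\<in>V. \<Sum>\<alpha>\<in>R s. F (s, \<alpha>)) = (\<Sum>i\<in>?I. F i)" for F :: "_ \<Rightarrow> real"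
      using V by (simp add: sum.Sigma case_prod_beta)
    have "(\<Sum>s\<in>V. \<Sum>t\<in>V. c s * (\<Sum>\<alpha>\<in>R s. \<Sum>\<beta>\<in>R t. (M (s, \<alpha>) (t, \<beta>))\<^sup>2) * c t) =
        (\<Sum>s\<in>V. \<Sum>t\<in>V. \<Sum>\<alpha>\<in>R s. \<Sum>\<beta>\<in>R t. c s * (M (s, \<alpha>) (t, \<beta>))\<^sup>2 * c t)"
      by (simp add: sum_distrib_left sum_distrib_right)
    also have "\<dots> = (\<Sum>s\<in>V. \<Sum>\<alpha>\<in>R s. \<Sum>t\<in>V. \<Sum>\<beta>\<in>R t. c s * (M (s, \<alpha>) (t, \<beta>))\<^sup>2 * c t)"
      by (intro sum.cong refl sum.swap)
    also have "\<dots> = (\<Sum>i\<in>?I. \<Sum>j\<in>?I. ?d i * (M i j)\<^sup>2 * ?d j)"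
      unfolding S[symmetric] by simp
    also have "\<dots> = (\<Sum>i\<in>?I. \<Sum>j\<in>?I. \<Sum>k<n. \<Sum>m<n. (?d i * g k i * g m i) * (?d j * g k j * g m j))"
    proof (intro sum.cong refl)
      fix i j assume ij: "i \<in> ?I" "j \<in> ?I"
      have "(M i j)\<^sup>2 = (\<Sum>k<n. \<Sum>m<n. (g k i * g k j) * (g m i * g m j))"
        unfolding g[OF ij] power2_eq_square by (rule sum_product)
      thus "?d i * (M i j)\<^sup>2 * ?d j = (\<Sum>k<n. \<Sum>m<n. (?d i * g k i * g m i) * (?d j * g k j * g m j))"
        by (simp only: sum_distrib_left sum_distrib_right) (intro sum.cong refl, simp only: mult_ac)
    qed
    also have "\<dots> = (\<Sum>k<n. \<Sum>m<n. \<Sum>i\<in>?I. \<Sum>j\<in>?I. (?d i * g k i * g m i) * (?d j * g k j * g m j))"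
      by (rule sum_rotate4)
    also have "\<dots> = (\<Sum>k<n. \<Sum>m<n. (\<Sum>i\<in>?I. ?d i * g k i * g m i)\<^sup>2)"
      by (simp add: power2_eq_square sum_product)
    also have "\<dots> \<ge> 0" by (intro sum_nonneg) auto
    finally show "0 \<le> (\<Sum>s\<in>V. \<Sum>t\<in>V. c s * (\<Sum>\<alpha>\<in>R s. \<Sum>\<beta>\<in>R t. (M (s, \<alpha>) (t, \<beta>))\<^sup>2) * c t)" .
  qed
qed

text \<open>\<open>vs\<close> is the very enumeration picked inside \<open>threshold_rank\<close>,
  so independence of the enumeration never has to be shown.\<close>

lemma threshold_rank_eq_card:
  fixes w :: "'a \<Rightarrow> 'a \<Rightarrow> real"
  assumes vs: "vs = (SOME vs. distinct vs \<and> set vs = V)"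
    and cp: "char_poly (walk_matrix vs w) = (\<Prod>k<length vs. [:- l k, 1:])"
  shows "threshold_rank \<tau> V w = card {k. k < length vs \<and> l k \<ge> \<tau>}"
proof -
  define n where "n = length vs"
  define M where "M = walk_matrix vs w"
  have M: "M \<in> carrier_mat n n" by (simp add: M_def walk_matrix_def n_def)
  have ev: "eigenvalue M e \<longleftrightarrow> (\<exists>k<n. l k = e)" for e
    unfolding eigenvalue_root_char_poly[OF M] using cp
    by (auto simp: M_def n_def poly_prod)
  have "threshold_rank \<tau> V w = (\<Sum>e | (\<exists>k<n. l k = e) \<and> e \<ge> \<tau>. card {k\<in>{..<n}. l k = e})"
    unfolding threshold_rank_def vs[symmetric] Let_def M_def[symmetric] ev
    using cp order_prod_linear[of "{..<n}" _ l] by (simp add: M_def n_def)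
  also have "\<dots> = card (\<Union>e\<in>{e. (\<exists>k<n. l k = e) \<and> e \<ge> \<tau>}. {k\<in>{..<n}. l k = e})"
    by (rule card_UN_disjoint[symmetric]) (auto intro: finite_subset[of _ "l ` {..<n}"])
  also have "(\<Union>e\<in>{e. (\<exists>k<n. l k = e) \<and> e \<ge> \<tau>}. {k\<in>{..<n}. l k = e}) = {k. k < n \<and> l k \<ge> \<tau>}"
    by auto
  finally show ?thesis by (simp add: n_def)
qed

text \<open>\<open>N\<close> is the symmetric normalization of the walk matrix; the top eigenvectors of \<open>N\<close>, at most
  \<open>r\<close> of them, are handled by Bessel's inequality. \<open>K\<close> is a free parameter that linearizes
  Cauchy-Schwarz.\<close>

lemma threshold_rank_bound:
  fixes w C :: "'a \<Rightarrow> 'a \<Rightarrow> real"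
  assumes V: "finite V" and psd: "psd_on V C" and \<tau>: "\<tau> \<ge> 0" and K: "K > 0"
    and w0: "\<And>s t. s \<in> V \<Longrightarrow> t \<in> V \<Longrightarrow> w s t \<ge> 0"
    and wsym: "\<And>s t. s \<in> V \<Longrightarrow> t \<in> V \<Longrightarrow> w s t = w t s"
    and rank: "threshold_rank \<tau> V w \<le> r"
  defines "deg \<equiv> \<lambda>s. \<Sum>v\<in>V. w s v"
  shows "(\<Sum>s\<in>V. \<Sum>t\<in>V. w s t * C s t) \<le>
    \<tau> * (\<Sum>s\<in>V. deg s * C s s) + r / (2 * K) + K / 2 * (\<Sum>s\<in>V. \<Sum>t\<in>V. deg s * deg t * (C s t)\<^sup>2)"
proof -
  have amgm: "a * b \<le> (a\<^sup>2 + b\<^sup>2) / 2" for a b :: real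
    using sum_squares_bound[of a b] by simp
  define vs where "vs = (SOME vs. distinct vs \<and> set vs = V)"
  have vs: "distinct vs" "set vs = V"
    using someI_ex[OF finite_distinct_list[OF V, unfolded conj_commute[of "set _ = _"]]]
    by (auto simp: vs_def)
  define n where "n = length vs"
  define f where "f i = vs ! i" for i
  have f: "bij_betw f {..<n} V"
    using bij_betw_nth[OF vs(1) refl] vs(2) by (simp add: f_def[abs_def] n_def)
  have fV: "f i \<in> V" if "i < n" for i using f that by (auto simp: bij_betw_def)
  define d where "d i = deg (f i)" for i
  have d: "d i = (\<Sum>j<n. w (f i) (f j))" for i
    by (simp add: d_def deg_def sum.reindex_bij_betw[OF f, symmetric])
  have d0: "d i \<ge> 0" if "i < n" for i unfolding d using w0 fV that by (intro sum_nonneg) auto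
  \<comment> \<open>Isolated vertices: a vanishing sum of nonnegative weights kills the row and, by
    symmetry, the column. So the factorization through the roots of the degrees holds even where
    \<open>N\<close> divides by 0.\<close>
  have wz: "w (f i) (f j) = 0" if "i < n" "j < n" "d i = 0" for i j
  proof -
    have "\<forall>j\<in>{..<n}. w (f i) (f j) = 0"
      using that(3) unfolding d by (subst (asm) sum_nonneg_eq_0_iff) (use w0 fV that in auto)
    thus ?thesis using that by simp
  qed
  have wz': "w (f j) (f i) = 0" if "i < n" "j < n" "d i = 0" for i j
    using wz[OF that] wsym[OF fV fV] that by simp
  define N where "N i j = w (f i) (f j) / (sqrt (d i) * sqrt (d j))" for i j
  have Nw: "w (f i) (f j) = sqrt (d i) * N i j * sqrt (d j)" if "i < n" "j < n" for i j
    using wz[of i j] wz'[of j i] that by (cases "d i = 0 \<or> d j = 0") (auto simp: N_def)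
  have Nsym: "N i j = N j i" if "i < n" "j < n" for i j
    using wsym[OF fV fV] that by (simp add: N_def mult.commute)
  obtain u l where
    u1: "\<And>j k. j < n \<Longrightarrow> k < n \<Longrightarrow> (\<Sum>i<n. u i j * u i k) = (if j = k then 1 else 0)" and
    u2: "\<And>i j. i < n \<Longrightarrow> j < n \<Longrightarrow> (\<Sum>k<n. u i k * u j k) = (if i = j then 1 else 0)" and
    Nu: "\<And>i j. i < n \<Longrightarrow> j < n \<Longrightarrow> N i j = (\<Sum>k<n. l k * u i k * u j k)" and
    cp: "char_poly (mat n n (\<lambda>(i, j). N i j)) = (\<Prod>k<n. [:- l k, 1:])"
    by (rule symmetric_kernel_spectral[of n N, OF Nsym]) (assumption, assumption, rule that)
  have "similar_mat (walk_matrix vs w) (mat n n (\<lambda>(i, j). N i j))"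
  proof -
    \<comment> \<open>The value 1 at isolated vertices keeps the diagonal change of basis
      invertible.\<close>
    define b where "b i = (if d i = 0 then 1 else sqrt (d i))" for i
    have b: "b i \<noteq> 0" if "i < n" for i using d0[OF that] by (auto simp: b_def)
    let ?P = "mat n n (\<lambda>(i, j). if i = j then 1 / b i else 0)"
    let ?Q = "mat n n (\<lambda>(i, j). if i = j then b i else 0)"
    let ?N = "mat n n (\<lambda>(i, j). N i j)"
    have PQ: "?P * ?Q = 1\<^sub>m n" "?Q * ?P = 1\<^sub>m n"
      by (rule eq_matI; use b in \<open>auto simp: scalar_prod_def if_distrib[of "\<lambda>x. x * _"] cong: if_cong\<close>)+
    have PN: "?P * ?N = mat n n (\<lambda>(i, j). N i j / b i)"
      by (rule eq_matI)
         (auto simp: scalar_prod_def if_distrib[of "\<lambda>x. x * _"] cong: if_cong)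
    have "walk_matrix vs w = ?P * ?N * ?Q"
    proof (rule eq_matI)
      fix i j assume "i < dim_row (?P * ?N * ?Q)" "j < dim_col (?P * ?N * ?Q)"
      hence ij: "i < n" "j < n" by auto
      have "(?P * ?N * ?Q) $$ (i,j) = N i j / b i * b j"
        unfolding PN using ij
        by (auto simp: scalar_prod_def if_distrib[of "\<lambda>x. _ * x"] cong: if_cong)
      also have "\<dots> = w (f i) (f j) / d i"
        using wz[of i j] wz'[of j i] ij d0[of i] d0[of j]
        by (cases "d i = 0 \<or> d j = 0") (auto simp: N_def b_def)
      finally show "walk_matrix vs w $$ (i,j) = (?P * ?N * ?Q) $$ (i,j)"
        using ij by (simp add: walk_matrix_def n_def[symmetric] f_def[symmetric] vs(2) d_def deg_def)
    qed (auto simp: walk_matrix_def n_def)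
    note wPNQ = this
    have wc: "walk_matrix vs w \<in> carrier_mat n n" by (simp add: walk_matrix_def n_def)
    show ?thesis
      unfolding similar_mat_def similar_mat_wit_def Let_def
      by (rule exI[of _ ?P], rule exI[of _ ?Q]) (use PQ wc wPNQ in auto)
  qed
  hence "char_poly (walk_matrix vs w) = (\<Prod>k<n. [:- l k, 1:])" by (simp add: char_poly_similar cp)
  from threshold_rank_eq_card[OF vs_def this[unfolded n_def], of \<tau>] rank
  have card: "card {k. k < n \<and> l k \<ge> \<tau>} \<le> r" by (simp add: n_def)
  \<comment> \<open>Rayleigh quotient of \<open>N\<close> at a unit eigenvector: the product across
    an edge is at most the mean of the two squares, and the degrees cancel.\<close>
  have l1: "l k \<le> 1" if k: "k < n" for k
  proof -
    let ?x = "\<lambda>i. u i k / sqrt (d i)"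
    have half: "(\<Sum>i<n. \<Sum>j<n. w (f i) (f j) * (?x i)\<^sup>2) \<le> 1"
    proof -
      have "(\<Sum>j<n. w (f i) (f j) * (?x i)\<^sup>2) \<le> u i k * u i k" if "i < n" for i
        using d0[OF that] unfolding sum_distrib_right[symmetric] d[symmetric]
        by (cases "d i = 0") (auto simp: power_divide power2_eq_square)
      hence "(\<Sum>i<n. \<Sum>j<n. w (f i) (f j) * (?x i)\<^sup>2) \<le> (\<Sum>i<n. u i k * u i k)" by (intro sum_mono) auto
      thus ?thesis using u1[OF k k] by simp
    qed
    have "l k = (\<Sum>m<n. if m = k then l k else 0)" using k by simp
    also have "\<dots> = (\<Sum>m<n. l m * (\<Sum>i<n. u i m * u i k) * (\<Sum>j<n. u j m * u j k))"
      using k by (intro sum.cong) (auto simp: u1)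
    also have "\<dots> = (\<Sum>m<n. \<Sum>i<n. \<Sum>j<n. u i k * (l m * u i m * u j m) * u j k)"
      by (simp add: sum_distrib_left sum_distrib_right mult_ac)
    also have "\<dots> = (\<Sum>i<n. \<Sum>j<n. \<Sum>m<n. u i k * (l m * u i m * u j m) * u j k)"
      by (rule sum_rotate3[symmetric])
    also have "\<dots> = (\<Sum>i<n. \<Sum>j<n. u i k * N i j * u j k)"
      by (intro sum.cong refl) (simp add: Nu sum_distrib_left sum_distrib_right)
    also have "\<dots> \<le> (\<Sum>i<n. \<Sum>j<n. (w (f i) (f j) * (?x i)\<^sup>2 + w (f j) (f i) * (?x j)\<^sup>2) / 2)"
    proof (intro sum_mono)
      fix i j assume ij: "i \<in> {..<n}" "j \<in> {..<n}"
      have "u i k * N i j * u j k = w (f i) (f j) * (?x i * ?x j)" by (simp add: N_def)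
      also have "\<dots> \<le> w (f i) (f j) * (((?x i)\<^sup>2 + (?x j)\<^sup>2) / 2)"
        by (intro mult_left_mono amgm) (use w0[OF fV fV, of i j] ij in auto)
      also have "\<dots> = (w (f i) (f j) * (?x i)\<^sup>2 + w (f j) (f i) * (?x j)\<^sup>2) / 2"
        using wsym[OF fV fV, of i j] ij by (simp add: distrib_left)
      finally show "u i k * N i j * u j k \<le> (w (f i) (f j) * (?x i)\<^sup>2 + w (f j) (f i) * (?x j)\<^sup>2) / 2" .
    qed
    also have "\<dots> = ((\<Sum>i<n. \<Sum>j<n. w (f i) (f j) * (?x i)\<^sup>2) + (\<Sum>i<n. \<Sum>j<n. w (f j) (f i) * (?x j)\<^sup>2)) / 2"
      by (simp only: sum_divide_distrib[symmetric] sum.distrib)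
    also have "(\<Sum>i<n. \<Sum>j<n. w (f j) (f i) * (?x j)\<^sup>2) = (\<Sum>i<n. \<Sum>j<n. w (f i) (f j) * (?x i)\<^sup>2)"
      by (rule sum.swap)
    also have "(\<dots> + \<dots>) / 2 \<le> 1" using half by simp
    finally show ?thesis .
  qed
  \<comment> \<open>\<open>B\<close> is \<open>C\<close> in the same normalization as
    \<open>N\<close>, and \<open>Q k\<close> is its quadratic form at eigenvector k. The edge sum is
    the trace of the product of \<open>N\<close> and \<open>B\<close>, that is, the sum of
    \<open>l k * Q k\<close>.\<close>
  define B where "B i j = sqrt (d i) * sqrt (d j) * C (f i) (f j)" for i j
  define y where "y i k = (\<Sum>j<n. B i j * u j k)" for i k
  define Q where "Q k = (\<Sum>i<n. u i k * y i k)" for k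
  define h where "h = the_inv_into {..<n} f"
  have h: "h (f i) = i" if "i < n" for i
    using f that by (auto simp: h_def bij_betw_def the_inv_into_f_f)
  have Q0: "Q k \<ge> 0" for k
  proof -
    let ?c = "\<lambda>s. u (h s) k * sqrt (d (h s))"
    have "0 \<le> (\<Sum>s\<in>V. \<Sum>t\<in>V. ?c s * C s t * ?c t)" using psd by (auto simp: psd_on_def)
    also have "\<dots> = (\<Sum>i<n. \<Sum>j<n. (u i k * sqrt (d i)) * C (f i) (f j) * (u j k * sqrt (d j)))"
      by (simp add: sum.reindex_bij_betw[OF f, symmetric] h)
    also have "\<dots> = Q k"
      by (simp add: Q_def y_def B_def sum_distrib_left mult_ac)
    finally show ?thesis .
  qed
  have "(\<Sum>s\<in>V. \<Sum>t\<in>V. w s t * C s t) = (\<Sum>i<n. \<Sum>j<n. w (f i) (f j) * C (f i) (f j))"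
    by (simp add: sum.reindex_bij_betw[OF f, symmetric])
  also have "\<dots> = (\<Sum>i<n. \<Sum>j<n. \<Sum>k<n. l k * u i k * u j k * B i j)"
    by (intro sum.cong refl) (simp add: Nw Nu B_def sum_distrib_left sum_distrib_right mult_ac)
  also have "\<dots> = (\<Sum>k<n. \<Sum>i<n. \<Sum>j<n. l k * u i k * u j k * B i j)"
    by (rule sum_rotate3)
  also have "\<dots> = (\<Sum>k<n. l k * Q k)"
    unfolding Q_def y_def sum_distrib_left by (intro sum.cong refl) (simp only: mult_ac)
  \<comment> \<open>Below the threshold \<open>l k\<close> is at most \<tau>; above it only
    \<open>l k \<le> 1\<close> is used. The term \<open>\<tau> * Q k\<close> is granted to every k
    so that the first sum is a full trace.\<close>
  also have "\<dots> \<le> (\<Sum>k<n. \<tau> * Q k + (if l k \<ge> \<tau> then Q k else 0))"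
  proof (intro sum_mono)
    fix k assume "k \<in> {..<n}"
    hence "l k * Q k \<le> 1 * Q k" using l1 Q0[of k] by (intro mult_right_mono) auto
    moreover have "l k * Q k \<le> \<tau> * Q k" if "l k < \<tau>" using that Q0[of k] by (simp add: mult_right_mono)
    moreover have "\<tau> * Q k \<ge> 0" using \<tau> Q0 by simp
    ultimately show "l k * Q k \<le> \<tau> * Q k + (if l k \<ge> \<tau> then Q k else 0)"
      by (cases "l k \<ge> \<tau>") (auto simp: not_le)
  qed
  also have "\<dots> = \<tau> * (\<Sum>k<n. Q k) + (\<Sum>k | k < n \<and> l k \<ge> \<tau>. Q k)"
    by (simp add: sum.distrib sum_distrib_left sum.inter_filter[symmetric] lessThan_def[symmetric] cong: conj_cong)
  \<comment> \<open>The trace of \<open>B\<close> may be computed in any orthonormal basis.\<close>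
  also have "(\<Sum>k<n. Q k) = (\<Sum>s\<in>V. deg s * C s s)"
  proof -
    have "(\<Sum>k<n. Q k) = (\<Sum>i<n. \<Sum>j<n. B i j * (\<Sum>k<n. u i k * u j k))"
    proof -
      have "(\<Sum>k<n. Q k) = (\<Sum>k<n. \<Sum>i<n. \<Sum>j<n. B i j * (u i k * u j k))"
        unfolding Q_def y_def sum_distrib_left by (intro sum.cong refl) simp
      also have "\<dots> = (\<Sum>i<n. \<Sum>j<n. \<Sum>k<n. B i j * (u i k * u j k))"
        by (rule sum_rotate3[symmetric])
      finally show ?thesis by (simp only: sum_distrib_left)
    qed
    also have "\<dots> = (\<Sum>i<n. \<Sum>j<n. if i = j then B i i else 0)"
      by (intro sum.cong refl) (auto simp: u2)
    also have "\<dots> = (\<Sum>i<n. d i * C (f i) (f i))"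
      using d0 by (intro sum.cong refl) (simp add: B_def)
    finally show ?thesis by (simp add: d_def sum.reindex_bij_betw[OF f, of "\<lambda>s. deg s * C s s"])
  qed
  \<comment> \<open>\<open>Q k\<close> is the inner product of a unit eigenvector with its image
    under \<open>B\<close>; Young's inequality with weight \<open>K\<close> splits it. The constant
    part is paid once per top eigenvector, at most \<open>r\<close> times.\<close>
  also have "(\<Sum>k | k < n \<and> l k \<ge> \<tau>. Q k) \<le>
      (\<Sum>k | k < n \<and> l k \<ge> \<tau>. 1 / (2 * K) + K / 2 * (\<Sum>i<n. (y i k)\<^sup>2))"
  proof (intro sum_mono)
    fix k assume "k \<in> {k. k < n \<and> l k \<ge> \<tau>}"
    hence k: "k < n" by simp
    have "Q k \<le> (\<Sum>i<n. u i k * u i k / (2 * K) + K / 2 * (y i k)\<^sup>2)"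
      unfolding Q_def
    proof (intro sum_mono)
      fix i
      have "2 * (u i k * (K * y i k)) \<le> (u i k)\<^sup>2 + (K * y i k)\<^sup>2"
        using sum_squares_bound[of "u i k" "K * y i k"] by (simp add: mult_ac)
      thus "u i k * y i k \<le> u i k * u i k / (2 * K) + K / 2 * (y i k)\<^sup>2"
        using K by (simp add: field_simps power2_eq_square)
    qed
    also have "\<dots> = 1 / (2 * K) + K / 2 * (\<Sum>i<n. (y i k)\<^sup>2)"
      using u1[OF k k] by (simp add: sum.distrib sum_distrib_left[symmetric] sum_divide_distrib[symmetric])
    finally show "Q k \<le> 1 / (2 * K) + K / 2 * (\<Sum>i<n. (y i k)\<^sup>2)" .
  qed
  also have "\<dots> = real (card {k. k < n \<and> l k \<ge> \<tau>}) / (2 * K)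
      + K / 2 * (\<Sum>k | k < n \<and> l k \<ge> \<tau>. \<Sum>i<n. (y i k)\<^sup>2)"
    by (simp add: sum.distrib sum_distrib_left)
  also have "\<dots> \<le> r / (2 * K) + K / 2 * (\<Sum>k<n. \<Sum>i<n. (y i k)\<^sup>2)"
    using K card by (intro add_mono mult_left_mono divide_right_mono sum_mono2 sum_nonneg) auto
  \<comment> \<open>The squared Frobenius norm of \<open>B\<close>, again independent of the
    orthonormal basis.\<close>
  also have "(\<Sum>k<n. \<Sum>i<n. (y i k)\<^sup>2) = (\<Sum>s\<in>V. \<Sum>t\<in>V. deg s * deg t * (C s t)\<^sup>2)"
  proof -
    have "(\<Sum>k<n. \<Sum>i<n. (y i k)\<^sup>2) = (\<Sum>i<n. \<Sum>k<n. \<Sum>j<n. \<Sum>m<n. B i j * u j k * (B i m * u m k))"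
      by (subst sum.swap) (simp add: y_def power2_eq_square sum_product)
    also have "\<dots> = (\<Sum>i<n. \<Sum>j<n. \<Sum>m<n. \<Sum>k<n. B i j * u j k * (B i m * u m k))"
      by (intro sum.cong refl sum_rotate3[symmetric])
    also have "\<dots> = (\<Sum>i<n. \<Sum>j<n. \<Sum>m<n. B i j * B i m * (\<Sum>k<n. u j k * u m k))"
      by (simp add: sum_distrib_left mult_ac)
    also have "\<dots> = (\<Sum>i<n. \<Sum>j<n. \<Sum>m<n. if j = m then (B i j)\<^sup>2 else 0)"
      by (intro sum.cong refl) (auto simp: u2 power2_eq_square)
    also have "\<dots> = (\<Sum>i<n. \<Sum>j<n. d i * d j * (C (f i) (f j))\<^sup>2)"
      using d0 by (intro sum.cong refl) (simp add: B_def power_mult_distrib)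
    finally show ?thesis by (simp add: d_def sum.reindex_bij_betw[OF f, symmetric])
  qed
  finally show ?thesis by simp
qed

section \<open>Distances and expectations of probability mass functions\<close>

text \<open>Asks for boundedness instead of finite support: in the last rounds the revealed set may
  exceed the locality, and the laws there are arbitrary.\<close>

lemma expectation_bind_pmf:
  fixes f :: "'b \<Rightarrow> real"
  assumes B: "\<And>y. \<bar>f y\<bar> \<le> B"
  shows "measure_pmf.expectation (bind_pmf p g) f = measure_pmf.expectation p (\<lambda>x. measure_pmf.expectation (g x) f)"
  unfolding measure_pmf_bind
  by (rule integral_bind[where K = "count_space UNIV" and B' = 1 and B = B])
     (use B measurable_measure_pmf[of g] in \<open>auto simp: measure_pmf.emeasure_space_1\<close>)

lemma expectation_mono_bounded:
  fixes f g :: "'b \<Rightarrow> real"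
  assumes "\<And>x. x \<in> set_pmf p \<Longrightarrow> f x \<le> g x" "\<And>x. \<bar>f x\<bar> \<le> B" "\<And>x. \<bar>g x\<bar> \<le> B"
  shows "measure_pmf.expectation p f \<le> measure_pmf.expectation p g"
  using assms
  by (intro integral_mono_AE measure_pmf.integrable_const_bound[where B = B])
     (auto simp: AE_measure_pmf_iff)

lemma expectation_finite:
  fixes f :: "'b \<Rightarrow> real"
  assumes "finite A" "set_pmf p \<subseteq> A"
  shows "measure_pmf.expectation p f = (\<Sum>x\<in>A. pmf p x * f x)"
  using assms by (subst integral_measure_pmf[of A]) auto

lemma l1_dist_finite:
  assumes "finite A" "set_pmf p \<subseteq> A" "set_pmf p' \<subseteq> A"
  shows "l1_dist p p' = (\<Sum>x\<in>A. \<bar>pmf p x - pmf p' x\<bar>)"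
proof -
  have "(\<Sum>\<^sub>\<infinity>x\<in>UNIV. \<bar>pmf p x - pmf p' x\<bar>) = (\<Sum>\<^sub>\<infinity>x\<in>A. \<bar>pmf p x - pmf p' x\<bar>)"
  proof (rule infsum_cong_neutral)
    fix x assume "x \<in> UNIV - A"
    hence "x \<notin> set_pmf p" "x \<notin> set_pmf p'" using assms by auto
    thus "\<bar>pmf p x - pmf p' x\<bar> = 0" by (simp add: set_pmf_iff)
  qed auto
  thus ?thesis using assms(1) by (simp add: l1_dist_def)
qed

lemma l1_dist_nonneg: "l1_dist p p' \<ge> 0"
  by (simp add: l1_dist_def infsum_nonneg)

text \<open>Free of finiteness assumptions, for the same arbitrary laws past the locality. Where the
  series is not summable \<open>infsum\<close> is 0, so summability need not be established.\<close>

lemma l1_dist_le_2: "l1_dist p p' \<le> 2"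
proof (cases "(\<lambda>x. \<bar>pmf p x - pmf p' x\<bar>) summable_on UNIV")
  case True
  show ?thesis unfolding l1_dist_def
  proof (rule infsum_le_finite_sums[OF True])
    fix F :: "'a set" assume F: "finite F"
    have "(\<Sum>x\<in>F. \<bar>pmf p x - pmf p' x\<bar>) \<le> (\<Sum>x\<in>F. pmf p x + pmf p' x)"
      by (intro sum_mono) (simp add: abs_if)
    also have "\<dots> \<le> 1 + 1"
      unfolding sum.distrib using F
      by (intro add_mono) (simp_all add: measure_measure_pmf_finite[symmetric])
    finally show "(\<Sum>x\<in>F. \<bar>pmf p x - pmf p' x\<bar>) \<le> 2" by simp
  qed
next
  case False
  thus ?thesis by (simp add: l1_dist_def infsum_not_exists)
qed

lemma l1_dist_refl [simp]: "l1_dist p p = 0"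
  by (simp add: l1_dist_def)

lemma l1_dist_triangle:
  assumes "finite (set_pmf p)" "finite (set_pmf p')" "finite (set_pmf p'')"
  shows "l1_dist p p'' \<le> l1_dist p p' + l1_dist p' p''"
proof -
  let ?A = "set_pmf p \<union> set_pmf p' \<union> set_pmf p''"
  have "finite ?A" using assms by simp
  thus ?thesis
    by (subst (1 2 3) l1_dist_finite[of ?A]) (auto simp: sum.distrib[symmetric] intro!: sum_mono)
qed

text \<open>Data processing: the two masses of a fibre of \<open>h\<close> differ by at most the sum
  of the differences inside the fibre.\<close>

lemma l1_dist_map_le:
  assumes "finite (set_pmf p)" "finite (set_pmf p')"
  shows "l1_dist (map_pmf h p) (map_pmf h p') \<le> l1_dist p p'"
proof -
  let ?A = "set_pmf p \<union> set_pmf p'"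
  have A: "finite ?A" using assms by simp
  have m: "pmf (map_pmf h q) y = (\<Sum>x\<in>{x\<in>?A. h x = y}. pmf q x)" if "set_pmf q \<subseteq> ?A" for q y
  proof -
    have "pmf (map_pmf h q) y = measure q ({x\<in>?A. h x = y})"
      unfolding pmf_map by (rule measure_prob_cong_0) (use that in \<open>auto simp: set_pmf_iff\<close>)
    thus ?thesis using A by (simp add: measure_measure_pmf_finite)
  qed
  have "l1_dist (map_pmf h p) (map_pmf h p') =
      (\<Sum>y\<in>h ` ?A. \<bar>pmf (map_pmf h p) y - pmf (map_pmf h p') y\<bar>)"
    by (rule l1_dist_finite) (use A in auto)
  also have "\<dots> \<le> (\<Sum>y\<in>h ` ?A. \<Sum>x\<in>{x\<in>?A. h x = y}. \<bar>pmf p x - pmf p' x\<bar>)"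
    by (intro sum_mono) (simp only: m Un_upper1 Un_upper2 sum_subtractf[symmetric] sum_abs)
  also have "\<dots> = (\<Sum>x\<in>?A. \<bar>pmf p x - pmf p' x\<bar>)"
    by (rule sum.image_gen[OF A, symmetric])
  also have "\<dots> = l1_dist p p'" by (rule l1_dist_finite[symmetric]) (use A in auto)
  finally show ?thesis .
qed

lemma l1_dist_pair_left:
  assumes "finite (set_pmf p)" "finite (set_pmf p')" "finite (set_pmf r)"
  shows "l1_dist (pair_pmf p r) (pair_pmf p' r) = l1_dist p p'"
proof -
  let ?A = "set_pmf p \<union> set_pmf p'"
  have A: "finite ?A" using assms by simp
  have "l1_dist (pair_pmf p r) (pair_pmf p' r) =
      (\<Sum>x\<in>?A \<times> set_pmf r. \<bar>pmf (pair_pmf p r) x - pmf (pair_pmf p' r) x\<bar>)"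
    by (rule l1_dist_finite) (use A assms in auto)
  also have "\<dots> = (\<Sum>x\<in>?A. \<Sum>y\<in>set_pmf r. \<bar>pmf p x - pmf p' x\<bar> * pmf r y)"
    unfolding sum.cartesian_product
    by (intro sum.cong refl) (auto simp: pmf_pair left_diff_distrib[symmetric] abs_mult)
  also have "\<dots> = (\<Sum>x\<in>?A. \<bar>pmf p x - pmf p' x\<bar>)"
    using assms(3) by (simp add: sum_distrib_left[symmetric] sum_pmf_eq_1)
  also have "\<dots> = l1_dist p p'" by (rule l1_dist_finite[symmetric]) (use A in auto)
  finally show ?thesis .
qed

lemma l1_dist_pair_right:
  assumes "finite (set_pmf p)" "finite (set_pmf p')" "finite (set_pmf r)"
  shows "l1_dist (pair_pmf r p) (pair_pmf r p') = l1_dist p p'"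
proof -
  let ?A = "set_pmf p \<union> set_pmf p'"
  have A: "finite ?A" using assms by simp
  have "l1_dist (pair_pmf r p) (pair_pmf r p') =
      (\<Sum>x\<in>set_pmf r \<times> ?A. \<bar>pmf (pair_pmf r p) x - pmf (pair_pmf r p') x\<bar>)"
    by (rule l1_dist_finite) (use A assms in auto)
  also have "\<dots> = (\<Sum>y\<in>set_pmf r. \<Sum>x\<in>?A. pmf r y * \<bar>pmf p x - pmf p' x\<bar>)"
    unfolding sum.cartesian_product
    by (intro sum.cong refl) (auto simp: pmf_pair right_diff_distrib[symmetric] abs_mult)
  also have "\<dots> = (\<Sum>x\<in>?A. \<bar>pmf p x - pmf p' x\<bar>)"
    using assms(3) by (simp add: sum_product[symmetric] sum_pmf_eq_1)
  also have "\<dots> = l1_dist p p'" by (rule l1_dist_finite[symmetric]) (use A in auto)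
  finally show ?thesis .
qed

text \<open>\<open>\<bar>x\<bar> \<le> \<delta>/2 + x\<^sup>2/(2\<delta>)\<close> keeps the bound linear in the squares, so that it survives averaging.\<close>

lemma l1_dist_le_squares:
  assumes S: "finite S" "set_pmf p \<subseteq> S" "set_pmf p' \<subseteq> S" "real (card S) \<le> N"
    and G: "finite G" "S \<subseteq> G" and \<delta>: "\<delta> > 0"
  shows "l1_dist p p' \<le> N * \<delta> / 2 + (\<Sum>x\<in>G. (pmf p x - pmf p' x)\<^sup>2) / (2 * \<delta>)"
proof -
  have "l1_dist p p' = (\<Sum>x\<in>S. \<bar>pmf p x - pmf p' x\<bar>)" using S by (intro l1_dist_finite) auto
  also have "\<dots> \<le> (\<Sum>x\<in>S. \<delta> / 2 + (pmf p x - pmf p' x)\<^sup>2 / (2 * \<delta>))"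
  proof (intro sum_mono)
    fix x
    have "2 * \<bar>pmf p x - pmf p' x\<bar> * \<delta> \<le> \<bar>pmf p x - pmf p' x\<bar>\<^sup>2 + \<delta>\<^sup>2"
      by (rule sum_squares_bound)
    thus "\<bar>pmf p x - pmf p' x\<bar> \<le> \<delta> / 2 + (pmf p x - pmf p' x)\<^sup>2 / (2 * \<delta>)"
      using \<delta> by (simp add: field_simps power2_eq_square)
  qed
  also have "\<dots> = real (card S) * \<delta> / 2 + (\<Sum>x\<in>S. (pmf p x - pmf p' x)\<^sup>2) / (2 * \<delta>)"
    by (simp add: sum.distrib sum_divide_distrib)
  \<comment> \<open>The linear term counts only the atoms in \<open>S\<close>, which a power of q
    will bound; the squares are summed over the larger \<open>G\<close>, as in
    \<open>pair_corr\<close>, which ranges over all assignments.\<close>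
  also have "\<dots> \<le> N * \<delta> / 2 + (\<Sum>x\<in>G. (pmf p x - pmf p' x)\<^sup>2) / (2 * \<delta>)"
    using S(4) G \<delta> by (intro add_mono divide_right_mono mult_right_mono sum_mono2) auto
  finally show ?thesis .
qed

lemma sum_sq_pmf_diff_le:
  assumes G: "finite G"
  shows "(\<Sum>x\<in>G. (pmf p x - pmf p' x)\<^sup>2) \<le> 2"
proof -
  have "(\<Sum>x\<in>G. (pmf p x - pmf p' x)\<^sup>2) \<le> (\<Sum>x\<in>G. pmf p x + pmf p' x)"
  proof (intro sum_mono)
    fix x
    have "\<bar>pmf p x - pmf p' x\<bar> \<le> 1" "\<bar>pmf p x - pmf p' x\<bar> \<le> pmf p x + pmf p' x"
      using pmf_le_1[of p x] pmf_le_1[of p' x] pmf_nonneg[of p x] pmf_nonneg[of p' x] by linarith+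
    hence "\<bar>pmf p x - pmf p' x\<bar> * \<bar>pmf p x - pmf p' x\<bar> \<le> 1 * (pmf p x + pmf p' x)"
      by (intro mult_mono) auto
    thus "(pmf p x - pmf p' x)\<^sup>2 \<le> pmf p x + pmf p' x" by (simp add: power2_eq_square)
  qed
  also have "\<dots> \<le> 1 + 1"
    unfolding sum.distrib using G
    by (intro add_mono) (simp_all add: measure_measure_pmf_finite[symmetric])
  finally show ?thesis by simp
qed

section \<open>Variance drop under conditioning\<close>

text \<open>Think of \<open>z\<close> as the law of a variable c and of \<open>x c\<close> as the
  joint mass of c with an event, of total mass X. The weighted deviations
  \<open>(x c - X * z c)\<^sup>2 / z c\<close> sum to the variance of the conditional probability of
  the event given c, and dropping the division by \<open>z c\<close>, at most 1, only makes them
  smaller.\<close>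

lemma variance_drop_core:
  fixes x z :: "'c \<Rightarrow> real"
  assumes z: "\<And>c. c \<in> C \<Longrightarrow> 0 \<le> z c" "\<And>c. c \<in> C \<Longrightarrow> z c \<le> 1" "(\<Sum>c\<in>C. z c) = 1"
    and xz: "\<And>c. c \<in> C \<Longrightarrow> z c = 0 \<Longrightarrow> x c = 0"
  shows "(\<Sum>c\<in>C. (x c - (\<Sum>c\<in>C. x c) * z c)\<^sup>2) + (\<Sum>c\<in>C. x c)\<^sup>2 \<le> (\<Sum>c\<in>C. (x c)\<^sup>2 / z c)"
proof -
  define X where "X = (\<Sum>c\<in>C. x c)"
  have "(\<Sum>c\<in>C. (x c - X * z c)\<^sup>2) \<le> (\<Sum>c\<in>C. (x c)\<^sup>2 / z c - 2 * X * x c + X\<^sup>2 * z c)"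
  proof (intro sum_mono)
    fix c assume c: "c \<in> C"
    show "(x c - X * z c)\<^sup>2 \<le> (x c)\<^sup>2 / z c - 2 * X * x c + X\<^sup>2 * z c"
    proof (cases "z c = 0")
      case True thus ?thesis using xz[OF c] by simp
    next
      case False
      hence zp: "z c > 0" using z(1)[OF c] by simp
      have "(x c - X * z c)\<^sup>2 \<le> (x c - X * z c)\<^sup>2 / z c"
        using zp z(2)[OF c] by (simp add: le_divide_eq mult_left_le)
      also have "\<dots> = (x c)\<^sup>2 / z c - 2 * X * x c + X\<^sup>2 * z c"
        using zp by (simp add: field_simps power2_eq_square)
      finally show ?thesis .
    qed
  qed
  also have "\<dots> = (\<Sum>c\<in>C. (x c)\<^sup>2 / z c) - 2 * X * (\<Sum>c\<in>C. x c) + X\<^sup>2 * (\<Sum>c\<in>C. z c)"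
    by (simp only: sum.distrib sum_subtractf sum_distrib_left)
  also have "\<dots> = (\<Sum>c\<in>C. (x c)\<^sup>2 / z c) - X\<^sup>2"
    unfolding X_def[symmetric] z(3) by (simp add: power2_eq_square)
  finally show ?thesis by (simp add: X_def)
qed

text \<open>\<open>variance_drop_core\<close> inside each conditional law given b, weighted by the
  mass of b: b is already known, c is newly revealed, a is watched. The sums other than the
  deviations are mean squared conditional probabilities before and after c is revealed. A value b of
  mass 0 contributes 0 on the left, as division by 0 gives 0.\<close>

lemma variance_drop:
  fixes P :: "'b \<Rightarrow> 'c \<Rightarrow> 'a \<Rightarrow> real"
  assumes fin: "finite C" "finite A"
    and P0: "\<And>b c a. b \<in> B \<Longrightarrow> c \<in> C \<Longrightarrow> a \<in> A \<Longrightarrow> P b c a \<ge> 0"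
    and Pbc: "\<And>b c. b \<in> B \<Longrightarrow> c \<in> C \<Longrightarrow> Pbc b c = (\<Sum>a\<in>A. P b c a)"
    and Pba: "\<And>b a. b \<in> B \<Longrightarrow> a \<in> A \<Longrightarrow> Pba b a = (\<Sum>c\<in>C. P b c a)"
    and Pb: "\<And>b. b \<in> B \<Longrightarrow> Pb b = (\<Sum>c\<in>C. Pbc b c)"
  shows "(\<Sum>b\<in>B. Pb b * (\<Sum>a\<in>A. \<Sum>c\<in>C. (P b c a / Pb b - Pba b a / Pb b * (Pbc b c / Pb b))\<^sup>2))
      + (\<Sum>b\<in>B. \<Sum>a\<in>A. (Pba b a)\<^sup>2 / Pb b) \<le> (\<Sum>b\<in>B. \<Sum>c\<in>C. \<Sum>a\<in>A. (P b c a)\<^sup>2 / Pbc b c)"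
  unfolding sum.distrib[symmetric]
proof (intro sum_mono)
  fix b assume b: "b \<in> B"
  have bc0: "Pbc b c \<ge> 0" if "c \<in> C" for c
    unfolding Pbc[OF b that] using P0 b that by (intro sum_nonneg) auto
  show "Pb b * (\<Sum>a\<in>A. \<Sum>c\<in>C. (P b c a / Pb b - Pba b a / Pb b * (Pbc b c / Pb b))\<^sup>2)
      + (\<Sum>a\<in>A. (Pba b a)\<^sup>2 / Pb b) \<le> (\<Sum>c\<in>C. \<Sum>a\<in>A. (P b c a)\<^sup>2 / Pbc b c)"
  proof (cases "Pb b = 0")
    case True
    thus ?thesis using bc0 by (auto intro!: sum_nonneg)
  next
    case False
    hence Pbp: "Pb b > 0" using bc0 unfolding Pb[OF b]
      by (metis less_eq_real_def sum_nonneg)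
    have bcb: "Pbc b c \<le> Pb b" if "c \<in> C" for c
      unfolding Pb[OF b] using that fin bc0 by (intro member_le_sum) auto
    have z0: "P b c a = 0" if "c \<in> C" "a \<in> A" "Pbc b c = 0" for c a
      using that(3) unfolding Pbc[OF b that(1)]
      by (subst (asm) sum_nonneg_eq_0_iff) (use that fin P0 b in auto)
    have core: "(\<Sum>c\<in>C. (P b c a / Pb b - Pba b a / Pb b * (Pbc b c / Pb b))\<^sup>2) + (Pba b a / Pb b)\<^sup>2
        \<le> (\<Sum>c\<in>C. (P b c a / Pb b)\<^sup>2 / (Pbc b c / Pb b))" if a: "a \<in> A" for a
    proof -
      have e: "Pba b a / Pb b = (\<Sum>c\<in>C. P b c a / Pb b)"
        by (simp add: Pba[OF b a] sum_divide_distrib)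
      show ?thesis unfolding e
      proof (rule variance_drop_core)
        show "(\<Sum>c\<in>C. Pbc b c / Pb b) = 1"
          using False by (simp add: sum_divide_distrib[symmetric] Pb[OF b, symmetric])
      qed (use Pbp bc0 bcb z0 a in auto)
    qed
    have "Pb b * (\<Sum>a\<in>A. \<Sum>c\<in>C. (P b c a / Pb b - Pba b a / Pb b * (Pbc b c / Pb b))\<^sup>2)
        + (\<Sum>a\<in>A. (Pba b a)\<^sup>2 / Pb b)
      = Pb b * (\<Sum>a\<in>A. (\<Sum>c\<in>C. (P b c a / Pb b - Pba b a / Pb b * (Pbc b c / Pb b))\<^sup>2) + (Pba b a / Pb b)\<^sup>2)"
      unfolding sum.distrib distrib_left sum_distrib_left[of "Pb b" "\<lambda>a. (Pba b a / Pb b)\<^sup>2"]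
      using False by (simp add: power2_eq_square)
    also have "\<dots> \<le> Pb b * (\<Sum>a\<in>A. \<Sum>c\<in>C. (P b c a / Pb b)\<^sup>2 / (Pbc b c / Pb b))"
      using Pbp core by (intro mult_left_mono sum_mono) auto
    also have "\<dots> = (\<Sum>a\<in>A. \<Sum>c\<in>C. (P b c a)\<^sup>2 / Pbc b c)"
      unfolding sum_distrib_left using False
      by (intro sum.cong refl) (simp add: power2_eq_square)
    also have "\<dots> = (\<Sum>c\<in>C. \<Sum>a\<in>A. (P b c a)\<^sup>2 / Pbc b c)" by (rule sum.swap)
    finally show ?thesis .
  qed
qed

section \<open>Marginal and conditional probabilities in a local ensemble\<close>

lemma prob_split:
  assumes "finite G" "\<And>f. f \<in> set_pmf W \<Longrightarrow> h f \<in> G"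
  shows "measure_pmf.prob W {f. Q f} = (\<Sum>g\<in>G. measure_pmf.prob W {f. Q f \<and> h f = g})"
proof -
  have "measure_pmf.prob W {f. Q f} = measure_pmf.prob W (\<Union>g\<in>G. {f. Q f \<and> h f = g})"
    by (rule measure_prob_cong_0) (use assms(2) in \<open>auto simp: set_pmf_iff\<close>)
  also have "\<dots> = (\<Sum>g\<in>G. measure_pmf.prob W {f. Q f \<and> h f = g})"
    using assms(1) by (intro measure_pmf.finite_measure_finite_Union) (auto simp: disjoint_family_on_def)
  finally show ?thesis .
qed

lemma measure_cond_pmf:
  assumes "set_pmf p \<inter> s \<noteq> {}"
  shows "measure_pmf.prob (cond_pmf p s) Q = measure_pmf.prob p (s \<inter> Q) / measure_pmf.prob p s"
  using assms measure_measure_pmf_not_zero[OF assms]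
  by (simp add: cond_pmf.rep_eq measure_uniform_measure measure_pmf.emeasure_eq_measure)

lemma finite_assignments: "finite S \<Longrightarrow> finite (S \<rightarrow>\<^sub>E {1..d::nat})"
  by (intro finite_PiE) auto

context
  fixes n d L :: nat and Y :: ensemble
  assumes loc: "local_ensemble n d L Y"
begin

lemma local_support:
  assumes "T \<subseteq> {1..n}" "card T \<le> L" "f \<in> set_pmf (Y T)"
  shows "f \<in> T \<rightarrow>\<^sub>E {1..d}"
  using loc assms by (auto simp: local_ensemble_def)

lemma local_restrict:
  assumes "T \<subseteq> {1..n}" "card T \<le> L" "R \<subseteq> T"
  shows "map_pmf (\<lambda>f. restrict f R) (Y T) = Y R"
  using loc assms by (auto simp: local_ensemble_def)

lemma local_prob:
  assumes "T \<subseteq> {1..n}" "card T \<le> L" "R \<subseteq> T"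
  shows "measure_pmf.prob (Y R) Q = measure_pmf.prob (Y T) {f. restrict f R \<in> Q}"
  unfolding local_restrict[OF assms, symmetric] measure_map_pmf by (simp add: vimage_def)

lemma local_pmf:
  assumes "T \<subseteq> {1..n}" "card T \<le> L" "R \<subseteq> T"
  shows "pmf (Y R) \<alpha> = measure_pmf.prob (Y T) {f. restrict f R = \<alpha>}"
  using local_prob[OF assms, of "{\<alpha>}"] by (simp add: measure_pmf_single)

lemma condition_nonempty:
  assumes "S \<union> R \<subseteq> {1..n}" "card (S \<union> R) \<le> L" "\<beta> \<in> set_pmf (Y S)"
  shows "set_pmf (Y (R \<union> S)) \<inter> {f. restrict f S = \<beta>} \<noteq> {}"
proof -
  have "map_pmf (\<lambda>f. restrict f S) (Y (R \<union> S)) = Y S"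
    by (rule local_restrict) (use assms in \<open>auto simp: Un_commute\<close>)
  hence "\<beta> \<in> (\<lambda>f. restrict f S) ` set_pmf (Y (R \<union> S))"
    using assms(3) by (metis set_map_pmf)
  thus ?thesis by blast
qed

lemma condition_prob:
  assumes "S \<union> R \<subseteq> {1..n}" "card (S \<union> R) \<le> L" "\<beta> \<in> set_pmf (Y S)"
  shows "measure_pmf.prob (condition Y S \<beta> R) Q =
    measure_pmf.prob (Y (S \<union> R)) {f. restrict f S = \<beta> \<and> restrict f R \<in> Q} / pmf (Y S) \<beta>"
proof -
  have "pmf (Y S) \<beta> = measure_pmf.prob (Y (S \<union> R)) {f. restrict f S = \<beta>}"
    by (rule local_pmf) (use assms in auto)
  moreover have "{f. restrict f S = \<beta>} \<inter> (\<lambda>f. restrict f R) -` Q = {f. restrict f S = \<beta> \<and> restrict f R \<in> Q}"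
    by auto
  ultimately show ?thesis
    using condition_nonempty[OF assms]
    by (simp add: condition_def measure_cond_pmf Un_commute)
qed

end

text \<open>The kernel C. The ranges run over all assignments with values in 1, ..., d, whatever the
  conditioning, so that C is indexed in the same way for every ensemble.\<close>

definition pair_corr :: "nat \<Rightarrow> ensemble \<Rightarrow> nat set \<Rightarrow> nat set \<Rightarrow> real" where
  "pair_corr d Z s t = (\<Sum>\<alpha>\<in>s \<rightarrow>\<^sub>E {1..d}. \<Sum>\<beta>\<in>t \<rightarrow>\<^sub>E {1..d}. (indicator_cov Z (s, \<alpha>) (t, \<beta>))\<^sup>2)"

lemma pair_corr_nonneg: "pair_corr d Z s t \<ge> 0"
  unfolding pair_corr_def by (intro sum_nonneg) auto

text \<open>One minus the average conditional variance of the indicators of \<open>Y\<^sub>s\<close> given \<open>Y\<^sub>S\<close>.\<close>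

definition potential :: "nat \<Rightarrow> ensemble \<Rightarrow> nat set \<Rightarrow> nat set \<Rightarrow> real" where
  "potential d Y S s = (\<Sum>\<beta>\<in>S \<rightarrow>\<^sub>E {1..d}. \<Sum>\<alpha>\<in>s \<rightarrow>\<^sub>E {1..d}.
     (measure_pmf.prob (Y (S \<union> s)) {f. restrict f S = \<beta> \<and> restrict f s = \<alpha>})\<^sup>2 / pmf (Y S) \<beta>)"

lemma potential_nonneg: "potential d Y S s \<ge> 0"
  unfolding potential_def by (intro sum_nonneg divide_nonneg_nonneg) auto

context
  fixes n d L :: nat and Y :: ensemble
  assumes loc: "local_ensemble n d L Y"
begin

text \<open>A joint probability is at most the probability of its conditioning event, so each
  summand is at most the joint probability itself, and these sum to 1.\<close>

lemma potential_le_1: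
  assumes T: "S \<union> s \<subseteq> {1..n}" "card (S \<union> s) \<le> L"
  shows "potential d Y S s \<le> 1"
proof -
  let ?W = "Y (S \<union> s)"
  have finn: "finite S" "finite s" using T finite_subset[of _ "{1..n}"] by auto
  have supp: "restrict f R \<in> R \<rightarrow>\<^sub>E {1..d}" if "f \<in> set_pmf ?W" "R \<subseteq> S \<union> s" for f R
    using local_support[OF loc T that(1)] that(2) by auto
  have "potential d Y S s \<le> (\<Sum>\<beta>\<in>S \<rightarrow>\<^sub>E {1..d}. \<Sum>\<alpha>\<in>s \<rightarrow>\<^sub>E {1..d}.
     measure_pmf.prob ?W {f. restrict f S = \<beta> \<and> restrict f s = \<alpha>})"
    unfolding potential_def
  proof (intro sum_mono)
    fix \<beta> \<alpha>
    let ?J = "measure_pmf.prob ?W {f. restrict f S = \<beta> \<and> restrict f s = \<alpha>}"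
    have "?J \<le> pmf (Y S) \<beta>"
      unfolding local_pmf[OF loc T Un_upper1] by (intro measure_pmf.finite_measure_mono) auto
    hence "?J * ?J \<le> ?J * pmf (Y S) \<beta>" by (intro mult_left_mono) auto
    thus "?J\<^sup>2 / pmf (Y S) \<beta> \<le> ?J"
      by (cases "pmf (Y S) \<beta> = 0") (auto simp: power2_eq_square pos_divide_le_eq pmf_nonneg less_le)
  qed
  also have "\<dots> = (\<Sum>\<beta>\<in>S \<rightarrow>\<^sub>E {1..d}. measure_pmf.prob ?W {f. restrict f S = \<beta>})"
    by (intro sum.cong refl prob_split[symmetric]) (use finite_assignments finn supp in auto)
  also have "\<dots> = measure_pmf.prob ?W {f. True}"
    using prob_split[of "S \<rightarrow>\<^sub>E {1..d}" ?W "\<lambda>f. restrict f S" "\<lambda>_. True"] finite_assignments finn supp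
    by auto
  finally show ?thesis by simp
qed

text \<open>All quantities are marginals of one law, that of \<open>S \<union> t \<union> s\<close>,
  which is why this set must fit into the locality. Then \<open>variance_drop\<close> applies with
  \<open>S\<close> already revealed, \<open>t\<close> newly revealed and \<open>s\<close>
  watched.\<close>

lemma potential_drop:
  assumes T: "S \<union> t \<union> s \<subseteq> {1..n}" "card (S \<union> t \<union> s) \<le> L"
  shows "measure_pmf.expectation (Y S) (\<lambda>\<beta>. pair_corr d (condition Y S \<beta>) s t) + potential d Y S s
    \<le> potential d Y (S \<union> t) s"
proof -
  define W where "W = Y (S \<union> t \<union> s)"
  have finn: "finite S" "finite s" "finite t" using T finite_subset[of _ "{1..n}"] by auto
  have finT: "finite (S \<union> t \<union> s)" using finn by auto
  have sub: "R \<subseteq> {1..n} \<and> card R \<le> L" if "R \<subseteq> S \<union> t \<union> s" for R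
    using T that card_mono[OF finT that] by auto
  have supp: "restrict f R \<in> R \<rightarrow>\<^sub>E {1..d}" if "f \<in> set_pmf W" "R \<subseteq> S \<union> t \<union> s" for f R
    using local_support[OF loc T] that unfolding W_def by auto
  note fa = finite_assignments
  define B C A where "B = S \<rightarrow>\<^sub>E {1..d}" and "C = t \<rightarrow>\<^sub>E {1..d}" and "A = s \<rightarrow>\<^sub>E {1..d}"
  have fins: "finite B" "finite C" "finite A" unfolding B_def C_def A_def using fa finn by blast+
  define P where "P b c a = measure_pmf.prob W {f. (restrict f S = b \<and> restrict f t = c) \<and> restrict f s = a}" for b c a
  define Pbc where "Pbc b c = measure_pmf.prob W {f. restrict f S = b \<and> restrict f t = c}" for b c
  define Pba where "Pba b a = measure_pmf.prob W {f. restrict f S = b \<and> restrict f s = a}" for b a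
  define Pb where "Pb b = measure_pmf.prob W {f. restrict f S = b}" for b
  have Pbc_sum: "Pbc b c = (\<Sum>a\<in>A. P b c a)" for b c
    unfolding Pbc_def P_def by (rule prob_split) (use fins supp in \<open>auto simp: A_def\<close>)
  have Pba_sum: "Pba b a = (\<Sum>c\<in>C. P b c a)" for b a
  proof -
    have "Pba b a = (\<Sum>c\<in>C. measure_pmf.prob W {f. (restrict f S = b \<and> restrict f s = a) \<and> restrict f t = c})"
      unfolding Pba_def by (rule prob_split) (use fins supp in \<open>auto simp: C_def\<close>)
    also have "\<dots> = (\<Sum>c\<in>C. P b c a)"
      unfolding P_def by (intro sum.cong arg_cong[of _ _ "measure_pmf.prob W"]) auto
    finally show ?thesis .
  qed
  have Pb_sum: "Pb b = (\<Sum>c\<in>C. Pbc b c)" for b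
    unfolding Pb_def Pbc_def by (rule prob_split) (use fins supp in \<open>auto simp: C_def\<close>)
  have pmfS: "pmf (Y S) b = Pb b" for b
    unfolding Pb_def W_def by (rule local_pmf[OF loc T]) auto
  have pot_S: "potential d Y S s = (\<Sum>b\<in>B. \<Sum>a\<in>A. (Pba b a)\<^sup>2 / Pb b)"
    unfolding potential_def B_def[symmetric] A_def[symmetric] pmfS
  proof (intro sum.cong refl)
    fix b a
    have "measure_pmf.prob (Y (S \<union> s)) {f. restrict f S = b \<and> restrict f s = a} = Pba b a"
      unfolding Pba_def W_def by (subst local_prob[OF loc T]) (auto simp: Int_absorb1 Int_absorb2)
    thus "(measure_pmf.prob (Y (S \<union> s)) {f. restrict f S = b \<and> restrict f s = a})\<^sup>2 / Pb b = (Pba b a)\<^sup>2 / Pb b"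
      by simp
  qed
  \<comment> \<open>Off the support of \<open>Y S\<close> the conditioned ensemble is meaningless,
    but there both sides carry the factor 0.\<close>
  have corr: "pmf (Y S) b * pair_corr d (condition Y S b) s t =
      Pb b * (\<Sum>a\<in>A. \<Sum>c\<in>C. (P b c a / Pb b - Pba b a / Pb b * (Pbc b c / Pb b))\<^sup>2)" for b
  proof (cases "b \<in> set_pmf (Y S)")
    case True
    let ?Z = "condition Y S b"
    have 1: "pmf (?Z s) a = Pba b a / Pb b" for a
    proof -
      have "pmf (?Z s) a = measure_pmf.prob (?Z s) {a}" by (simp add: measure_pmf_single)
      also have "\<dots> = measure_pmf.prob (Y (S \<union> s)) {f. restrict f S = b \<and> restrict f s \<in> {a}} / Pb b"
        unfolding pmfS[symmetric] by (rule condition_prob[OF loc _ _ True]) (use sub[of "S \<union> s"] in auto)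
      also have "measure_pmf.prob (Y (S \<union> s)) {f. restrict f S = b \<and> restrict f s \<in> {a}} = Pba b a"
        unfolding Pba_def W_def by (subst local_prob[OF loc T]) (auto simp: Int_absorb1 Int_absorb2)
      finally show ?thesis .
    qed
    have 2: "pmf (?Z t) c = Pbc b c / Pb b" for c
    proof -
      have "pmf (?Z t) c = measure_pmf.prob (?Z t) {c}" by (simp add: measure_pmf_single)
      also have "\<dots> = measure_pmf.prob (Y (S \<union> t)) {f. restrict f S = b \<and> restrict f t \<in> {c}} / Pb b"
        unfolding pmfS[symmetric] by (rule condition_prob[OF loc _ _ True]) (use sub[of "S \<union> t"] in auto)
      also have "measure_pmf.prob (Y (S \<union> t)) {f. restrict f S = b \<and> restrict f t \<in> {c}} = Pbc b c"
        unfolding Pbc_def W_def by (subst local_prob[OF loc T]) (auto simp: Int_absorb1 Int_absorb2)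
      finally show ?thesis .
    qed
    have 3: "measure_pmf.prob (?Z (s \<union> t)) {f. restrict f s = a \<and> restrict f t = c} = P b c a / Pb b" for a c
    proof -
      have "measure_pmf.prob (?Z (s \<union> t)) {f. restrict f s = a \<and> restrict f t = c} =
        measure_pmf.prob (Y (S \<union> (s \<union> t))) {f. restrict f S = b \<and>
          restrict f (s \<union> t) \<in> {f. restrict f s = a \<and> restrict f t = c}} / Pb b"
        unfolding pmfS[symmetric]
        by (rule condition_prob[OF loc _ _ True]) (use sub[of "S \<union> (s \<union> t)"] in auto)
      also have "S \<union> (s \<union> t) = S \<union> t \<union> s" by auto
      also have "measure_pmf.prob (Y (S \<union> t \<union> s)) {f. restrict f S = b \<and>
          restrict f (s \<union> t) \<in> {f. restrict f s = a \<and> restrict f t = c}} = P b c a"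
        unfolding P_def W_def by (intro arg_cong[of _ _ "measure_pmf.prob _"]) (auto simp: Int_absorb1 Int_absorb2)
      finally show ?thesis .
    qed
    show ?thesis
      unfolding pair_corr_def indicator_cov_def pmfS by (simp add: 1 2 3 A_def C_def)
  next
    case False
    hence "Pb b = 0" by (simp add: pmfS[symmetric] set_pmf_iff)
    thus ?thesis by (simp add: pmfS)
  qed
  have E: "measure_pmf.expectation (Y S) (\<lambda>\<beta>. pair_corr d (condition Y S \<beta>) s t) =
      (\<Sum>b\<in>B. Pb b * (\<Sum>a\<in>A. \<Sum>c\<in>C. (P b c a / Pb b - Pba b a / Pb b * (Pbc b c / Pb b))\<^sup>2))"
    unfolding corr[symmetric]
    by (rule expectation_finite) (use fins sub[of S] local_support[OF loc, of S] in \<open>auto simp: B_def\<close>)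
  \<comment> \<open>\<open>S\<close> and \<open>t\<close> may overlap, so an assignment of
    \<open>S \<union> t\<close> is a pair (b, c) that agrees on the overlap; the pairs that disagree
    carry no mass and may be added to the sum.\<close>
  have pot_St: "potential d Y (S \<union> t) s = (\<Sum>b\<in>B. \<Sum>c\<in>C. \<Sum>a\<in>A. (P b c a)\<^sup>2 / Pbc b c)"
  proof -
    let ?D = "(S \<union> t) \<rightarrow>\<^sub>E {1..d}"
    define h where "h \<delta> = (restrict \<delta> S, restrict \<delta> t)" for \<delta> :: "nat \<Rightarrow> nat"
    define F where "F = (\<lambda>(b, c). \<Sum>a\<in>A. (P b c a)\<^sup>2 / Pbc b c)"
    have ext: "restrict f (S \<union> t) = \<delta> \<longleftrightarrow> restrict f S = restrict \<delta> S \<and> restrict f t = restrict \<delta> t"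
      if "\<delta> \<in> ?D" for f \<delta>
    proof
      assume r: "restrict f S = restrict \<delta> S \<and> restrict f t = restrict \<delta> t"
      show "restrict f (S \<union> t) = \<delta>"
      proof
        fix x
        show "restrict f (S \<union> t) x = \<delta> x"
          using r[THEN conjunct1, THEN fun_cong, of x] r[THEN conjunct2, THEN fun_cong, of x] that
          by (auto simp: restrict_def PiE_def extensional_def split: if_splits)
      qed
    qed (auto simp: Int_absorb1 Int_absorb2)
    have inj: "inj_on h ?D"
    proof (rule inj_onI)
      fix \<delta> \<delta>' assume a: "\<delta> \<in> ?D" "\<delta>' \<in> ?D" "h \<delta> = h \<delta>'"
      hence "restrict \<delta>' (S \<union> t) = \<delta>" by (subst ext) (auto simp: h_def)
      thus "\<delta> = \<delta>'" using a(2) by (simp add: PiE_restrict)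
    qed
    have zero: "F x = 0" if "x \<in> B \<times> C - h ` ?D" for x
    proof -
      obtain b c where x: "x = (b, c)" by (cases x)
      have "set_pmf W \<inter> {f. restrict f S = b \<and> restrict f t = c} = {}"
      proof (rule ccontr)
        assume "\<not> ?thesis"
        then obtain f where f: "f \<in> set_pmf W" "restrict f S = b" "restrict f t = c" by auto
        have "restrict f (S \<union> t) \<in> ?D" by (rule supp[OF f(1)]) auto
        moreover have "h (restrict f (S \<union> t)) = (b, c)"
          using f by (auto simp: h_def Int_absorb1 Int_absorb2)
        ultimately have "(b, c) \<in> h ` ?D" by (metis image_eqI)
        thus False using that x by auto
      qed
      hence "Pbc b c = 0" unfolding Pbc_def by (simp add: measure_pmf_zero_iff)
      thus ?thesis by (simp add: F_def x)
    qed
    have "potential d Y (S \<union> t) s = (\<Sum>\<delta>\<in>?D. F (h \<delta>))"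
      unfolding potential_def
    proof (intro sum.cong refl)
      fix \<delta> assume \<delta>: "\<delta> \<in> ?D"
      have "pmf (Y (S \<union> t)) \<delta> = Pbc (restrict \<delta> S) (restrict \<delta> t)"
        unfolding Pbc_def W_def by (subst local_pmf[OF loc T]) (auto simp: ext[OF \<delta>])
      moreover have "measure_pmf.prob (Y (S \<union> t \<union> s)) {f. restrict f (S \<union> t) = \<delta> \<and> restrict f s = a}
          = P (restrict \<delta> S) (restrict \<delta> t) a" for a
        unfolding P_def W_def ext[OF \<delta>] ..
      ultimately show "(\<Sum>\<alpha>\<in>s \<rightarrow>\<^sub>E {1..d}. (measure_pmf.prob (Y (S \<union> t \<union> s))
          {f. restrict f (S \<union> t) = \<delta> \<and> restrict f s = \<alpha>})\<^sup>2 / pmf (Y (S \<union> t)) \<delta>) = F (h \<delta>)"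
        by (simp add: F_def h_def A_def)
    qed
    also have "\<dots> = (\<Sum>x\<in>h ` ?D. F x)" by (simp only: sum.reindex[OF inj] o_def)
    also have "\<dots> = (\<Sum>x\<in>B \<times> C. F x)"
    proof (rule sum.mono_neutral_left)
      show "h ` ?D \<subseteq> B \<times> C" by (auto simp: h_def B_def C_def)
    qed (use fins zero in auto)
    also have "\<dots> = (\<Sum>b\<in>B. \<Sum>c\<in>C. \<Sum>a\<in>A. (P b c a)\<^sup>2 / Pbc b c)"
      unfolding F_def by (rule sum.cartesian_product[symmetric])
    finally show ?thesis .
  qed
  show ?thesis unfolding E pot_S pot_St
    by (rule variance_drop) (rule fins Pbc_sum Pba_sum Pb_sum | simp add: P_def)+
qed

lemma potential_mono:
  assumes T: "S \<union> t \<union> s \<subseteq> {1..n}" "card (S \<union> t \<union> s) \<le> L"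
  shows "potential d Y S s \<le> potential d Y (S \<union> t) s"
proof -
  have "measure_pmf.expectation (Y S) (\<lambda>\<beta>. pair_corr d (condition Y S \<beta>) s t) \<ge> 0"
    by (intro Bochner_Integration.integral_nonneg) (simp add: pair_corr_nonneg)
  thus ?thesis using potential_drop[OF T] by linarith
qed

end

section \<open>Conditioned ensembles\<close>

lemma product_law_singleton:
  assumes "set_pmf (Z {j}) \<subseteq> extensional {j}"
  shows "product_law Z {j} = Z {j}"
proof -
  have "product_law Z {j} = map_pmf (\<lambda>f b. if b = j then f j else undefined) (Z {j})"
    by (simp add: product_law_def Pi_pmf_singleton marginal_def map_pmf_comp)
  also have "\<dots> = map_pmf id (Z {j})"
  proof (rule map_pmf_cong[OF refl])
    fix f assume "f \<in> set_pmf (Z {j})"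
    hence "f \<in> extensional {j}" using assms by auto
    thus "(\<lambda>b. if b = j then f j else undefined) = id f"
      by (auto simp: extensional_def fun_eq_iff)
  qed
  finally show ?thesis by (simp add: pmf.map_id)
qed

lemma condition_extensional: "set_pmf (condition Y S \<beta> R) \<subseteq> extensional R"
  by (auto simp: condition_def)

text \<open>A law of pairs, on the same space as the independent coupling
  \<open>pair_pmf (Z s) (Z t)\<close>. It makes sense for overlapping \<open>s\<close> and
  \<open>t\<close>, as needed for the diagonal and the non-edges of the kernel.\<close>

definition joint_pmf :: "ensemble \<Rightarrow> nat set \<Rightarrow> nat set \<Rightarrow> ((nat \<Rightarrow> nat) \<times> (nat \<Rightarrow> nat)) pmf" where
  "joint_pmf Z s t = map_pmf (\<lambda>f. (restrict f s, restrict f t)) (Z (s \<union> t))"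

lemma pair_corr_eq_squares:
  "pair_corr d Z s t = (\<Sum>x\<in>(s \<rightarrow>\<^sub>E {1..d}) \<times> (t \<rightarrow>\<^sub>E {1..d}).
     (pmf (joint_pmf Z s t) x - pmf (pair_pmf (Z s) (Z t)) x)\<^sup>2)"
proof -
  have "pmf (joint_pmf Z s t) (\<alpha>, \<beta>) =
      measure_pmf.prob (Z (s \<union> t)) {f. restrict f s = \<alpha> \<and> restrict f t = \<beta>}" for \<alpha> \<beta>
    unfolding joint_pmf_def pmf_map by (intro arg_cong[of _ _ "measure_pmf.prob _"]) auto
  thus ?thesis
    unfolding pair_corr_def indicator_cov_def sum.cartesian_product
    by (intro sum.cong refl) (auto simp: pmf_pair)
qed

lemma pair_corr_le_2:
  assumes "finite s" "finite t"
  shows "pair_corr d Z s t \<le> 2"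
  unfolding pair_corr_eq_squares using assms by (intro sum_sq_pmf_diff_le finite_cartesian_product finite_assignments)

context
  fixes n d L q :: nat and Z :: ensemble
  assumes loc: "local_ensemble n d L Z"
    and supp: "\<And>j. j \<in> {1..n} \<Longrightarrow> finite (set_pmf (marginal Z j)) \<and> card (set_pmf (marginal Z j)) \<le> q"
begin

lemma finite_set_local:
  assumes "R \<subseteq> {1..n}" "card R \<le> L"
  shows "finite (set_pmf (Z R))"
proof (rule finite_subset)
  show "set_pmf (Z R) \<subseteq> R \<rightarrow>\<^sub>E {1..d}" using local_support[OF loc assms] by blast
  show "finite (R \<rightarrow>\<^sub>E {1..d})" using assms(1) finite_subset by (intro finite_assignments) blast
qed

text \<open>The support lies in the product of the supports of the marginals. It is this count, in
  \<open>q\<close> rather than \<open>d\<close>, that enters the final constants.\<close>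

lemma card_set_local:
  assumes R: "R \<subseteq> {1..n}" "card R \<le> L"
  shows "card (set_pmf (Z R)) \<le> q ^ card R"
proof -
  have fR: "finite R" using R finite_subset by blast
  let ?P = "PiE R (\<lambda>j. set_pmf (marginal Z j))"
  have fm: "finite (set_pmf (marginal Z j))" if "j \<in> R" for j using supp that R by auto
  have "set_pmf (Z R) \<subseteq> ?P"
  proof
    fix f assume f: "f \<in> set_pmf (Z R)"
    have "f j \<in> set_pmf (marginal Z j)" if "j \<in> R" for j
    proof -
      have "Z {j} = map_pmf (\<lambda>f. restrict f {j}) (Z R)"
        by (rule local_restrict[OF loc R, symmetric]) (use that in auto)
      hence "marginal Z j = map_pmf (\<lambda>f. f j) (Z R)" by (simp add: marginal_def map_pmf_comp)
      thus ?thesis using f by simp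
    qed
    moreover have "f \<in> extensional R" using local_support[OF loc R f] by (auto simp: PiE_def)
    ultimately show "f \<in> ?P" by (auto simp: PiE_def)
  qed
  moreover have "finite ?P" using fR fm by (intro finite_PiE)
  ultimately have "card (set_pmf (Z R)) \<le> card ?P" by (rule card_mono[rotated])
  also have "\<dots> = (\<Prod>j\<in>R. card (set_pmf (marginal Z j)))" by (rule card_PiE[OF fR])
  also have "\<dots> \<le> (\<Prod>j\<in>R. q)" using supp R by (intro prod_mono) auto
  finally show ?thesis by simp
qed

lemma finite_set_product_law:
  assumes "R \<subseteq> {1..n}"
  shows "finite (set_pmf (product_law Z R))"
proof -
  have "finite R" using assms finite_subset by blast
  thus ?thesis
    unfolding product_law_def using supp assms
    by (intro finite_subset[OF set_Pi_pmf_subset'] finite_PiE_dflt) auto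
qed

text \<open>One node of the splitting tree: the joint law is first decoupled along \<open>s \<union> t\<close>, then each
  half is replaced by the product of its marginals.\<close>

lemma l1_dist_product_law_split:
  assumes st: "s \<inter> t = {}" "s \<union> t \<subseteq> {1..n}" "card (s \<union> t) \<le> L" and \<delta>: "\<delta> > 0"
  shows "l1_dist (Z (s \<union> t)) (product_law Z (s \<union> t)) \<le>
    (real q ^ card (s \<union> t) * \<delta> / 2 + pair_corr d Z s t / (2 * \<delta>))
    + (l1_dist (Z s) (product_law Z s) + l1_dist (Z t) (product_law Z t))"
proof -
  have fin: "finite s" "finite t" using st(2) finite_subset[of _ "{1..n}"] by auto
  have sub: "s \<subseteq> {1..n}" "t \<subseteq> {1..n}" using st by auto
  have c: "card s \<le> L" "card t \<le> L"
    using st(3) fin by (meson card_mono finite_UnI le_trans sup_ge1 sup_ge2)+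
  define glue where "glue = (\<lambda>(f :: nat \<Rightarrow> nat, g) x. if x \<in> s then f x else g x)"
  let ?J = "joint_pmf Z s t"
  have "map_pmf glue ?J = map_pmf id (Z (s \<union> t))"
    unfolding joint_pmf_def map_pmf_comp
  proof (rule map_pmf_cong[OF refl])
    fix f assume "f \<in> set_pmf (Z (s \<union> t))"
    hence "f \<in> extensional (s \<union> t)" using local_support[OF loc st(2,3)] by (auto simp: PiE_def)
    thus "glue (restrict f s, restrict f t) = id f"
      by (auto simp: glue_def extensional_def fun_eq_iff)
  qed
  hence Zst: "Z (s \<union> t) = map_pmf glue ?J" by (simp add: pmf.map_id)
  have prod: "product_law Z (s \<union> t) = map_pmf glue (pair_pmf (product_law Z s) (product_law Z t))"
    unfolding product_law_def glue_def by (rule Pi_pmf_union) (use fin st in auto)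
  have fZ: "finite (set_pmf (Z s))" "finite (set_pmf (Z t))" "finite (set_pmf (Z (s \<union> t)))"
    using finite_set_local sub c st by auto
  have fP: "finite (set_pmf (product_law Z s))" "finite (set_pmf (product_law Z t))"
    using finite_set_product_law sub by auto
  have fJ: "finite (set_pmf ?J)" using fZ(3) by (simp add: joint_pmf_def)
  \<comment> \<open>Hybrid argument: from the joint law to the independent coupling, then to the
    product laws; each step after the first changes a single factor.\<close>
  let ?ZZ = "pair_pmf (Z s) (Z t)" and ?PZ = "pair_pmf (product_law Z s) (Z t)"
    and ?PP = "pair_pmf (product_law Z s) (product_law Z t)"
  have "l1_dist (Z (s \<union> t)) (product_law Z (s \<union> t)) \<le> l1_dist ?J ?PP"
    unfolding Zst prod using fJ fP by (intro l1_dist_map_le) auto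
  also have "\<dots> \<le> l1_dist ?J ?ZZ + l1_dist ?ZZ ?PP"
    using fJ fP fZ by (intro l1_dist_triangle) auto
  also have "l1_dist ?ZZ ?PP \<le> l1_dist ?ZZ ?PZ + l1_dist ?PZ ?PP"
    using fP fZ by (intro l1_dist_triangle) auto
  also have "l1_dist ?ZZ ?PZ = l1_dist (Z s) (product_law Z s)"
    using fP fZ by (intro l1_dist_pair_left) auto
  also have "l1_dist ?PZ ?PP = l1_dist (Z t) (product_law Z t)"
    using fP fZ by (intro l1_dist_pair_right) auto
  also have "l1_dist ?J ?ZZ \<le> real q ^ card (s \<union> t) * \<delta> / 2 + pair_corr d Z s t / (2 * \<delta>)"
    unfolding pair_corr_eq_squares
  proof (rule l1_dist_le_squares)
    show "finite (set_pmf ?ZZ)" using fZ by simp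
    have r: "map_pmf (\<lambda>f. restrict f s) (Z (s \<union> t)) = Z s" "map_pmf (\<lambda>f. restrict f t) (Z (s \<union> t)) = Z t"
      using local_restrict[OF loc st(2,3)] by auto
    \<comment> \<open>Values of positive joint probability have positive marginal probabilities, so
      the product of the two supports serves both laws.\<close>
    show "set_pmf ?J \<subseteq> set_pmf ?ZZ"
      unfolding joint_pmf_def using r by (auto simp flip: r)
    have "card (set_pmf ?ZZ) = card (set_pmf (Z s)) * card (set_pmf (Z t))"
      by (simp add: card_cartesian_product)
    also have "\<dots> \<le> q ^ card s * q ^ card t"
      using sub c by (intro mult_mono card_set_local) auto
    also have "\<dots> = q ^ card (s \<union> t)"
      using fin st(1) by (simp add: card_Un_disjoint power_add)
    finally show "real (card (set_pmf ?ZZ)) \<le> real q ^ card (s \<union> t)"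
      by (metis of_nat_le_iff of_nat_power)
    show "set_pmf ?ZZ \<subseteq> (s \<rightarrow>\<^sub>E {1..d}) \<times> (t \<rightarrow>\<^sub>E {1..d})"
      using local_support[OF loc sub(1) c(1)] local_support[OF loc sub(2) c(2)] by auto
  qed (use \<delta> finite_assignments fin in \<open>blast | simp\<close>)+
  finally show ?thesis by simp
qed

end

text \<open>The conditioning event depends only on the coordinates in \<open>S\<close>, which every
  set is enlarged to contain; hence restriction and conditioning commute. The enlargement costs
  \<open>card S\<close> of the locality.\<close>

lemma condition_local:
  assumes loc: "local_ensemble n d L Y" and S: "S \<subseteq> {1..n}" "\<beta> \<in> set_pmf (Y S)" "card S \<le> L"
  shows "local_ensemble n d (L - card S) (condition Y S \<beta>)"
  unfolding local_ensemble_def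
proof (intro allI impI conjI)
  fix R assume R: "R \<subseteq> {1..n} \<and> card R \<le> L - card S"
  have fin: "finite R" "finite S" using R S finite_subset[of _ "{1..n}"] by auto
  have RS: "R \<union> S \<subseteq> {1..n}" "card (R \<union> S) \<le> L"
    using R S card_Un_le[of R S] by auto
  let ?C = "{f. restrict f S = \<beta>}"
  have ne: "set_pmf (Y (R \<union> S)) \<inter> ?C \<noteq> {}"
    using condition_nonempty[OF loc, of S R \<beta>] RS S by (simp add: Un_commute)
  show "set_pmf (condition Y S \<beta> R) \<subseteq> R \<rightarrow>\<^sub>E {1..d}"
  proof
    fix g assume "g \<in> set_pmf (condition Y S \<beta> R)"
    then obtain f where f: "f \<in> set_pmf (Y (R \<union> S))" "g = restrict f R"
      using ne by (auto simp: condition_def)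
    show "g \<in> R \<rightarrow>\<^sub>E {1..d}" using local_support[OF loc RS f(1)] unfolding f(2) by (auto simp: PiE_iff)
  qed
  fix R' assume R': "R' \<subseteq> R"
  have "Y (R' \<union> S) = map_pmf (\<lambda>f. restrict f (R' \<union> S)) (Y (R \<union> S))"
    by (rule local_restrict[OF loc RS, symmetric]) (use R' in auto)
  hence "cond_pmf (Y (R' \<union> S)) ?C =
      map_pmf (\<lambda>f. restrict f (R' \<union> S)) (cond_pmf (Y (R \<union> S)) ((\<lambda>f. restrict f (R' \<union> S)) -` ?C))"
    using ne by (simp only:, intro cond_map_pmf) (auto simp: Int_absorb1 Int_absorb2)
  also have "(\<lambda>f. restrict f (R' \<union> S)) -` ?C = ?C" by (auto simp: Int_absorb1 Int_absorb2)
  finally have eq: "cond_pmf (Y (R' \<union> S)) ?C =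
      map_pmf (\<lambda>f. restrict f (R' \<union> S)) (cond_pmf (Y (R \<union> S)) ?C)" .
  have "condition Y S \<beta> R' = map_pmf (\<lambda>f. restrict f R') (cond_pmf (Y (R \<union> S)) ?C)"
    unfolding condition_def eq map_pmf_comp
    by (intro map_pmf_cong refl) (simp add: Int_absorb1)
  moreover have "R \<inter> R' = R'" using R' by auto
  ultimately show "map_pmf (\<lambda>f. restrict f R') (condition Y S \<beta> R) = condition Y S \<beta> R'"
    by (simp add: condition_def map_pmf_comp)
qed

text \<open>Conditioning creates no new values, so the bound q on the supports carries over to the
  conditioned ensemble.\<close>

lemma condition_marginal_subset:
  assumes loc: "local_ensemble n d L Y" and S: "S \<subseteq> {1..n}" "\<beta> \<in> set_pmf (Y S)" "card S < L"
    and j: "j \<in> {1..n}"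
  shows "set_pmf (marginal (condition Y S \<beta>) j) \<subseteq> set_pmf (marginal Y j)"
proof -
  have jS: "{j} \<union> S \<subseteq> {1..n}" "card ({j} \<union> S) \<le> L"
    using S j card_Un_le[of "{j}" S] by auto
  have ne: "set_pmf (Y ({j} \<union> S)) \<inter> {f. restrict f S = \<beta>} \<noteq> {}"
    using condition_nonempty[OF loc, of S "{j}" \<beta>] jS S by (simp add: Un_commute)
  have "marginal Y j = map_pmf (\<lambda>f. f j) (map_pmf (\<lambda>f. restrict f {j}) (Y ({j} \<union> S)))"
    unfolding marginal_def by (subst local_restrict[OF loc jS]) auto
  hence "set_pmf (marginal Y j) = (\<lambda>f. f j) ` set_pmf (Y ({j} \<union> S))"
    by (simp add: map_pmf_comp)
  moreover have "set_pmf (marginal (condition Y S \<beta>) j) =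
      (\<lambda>f. f j) ` (set_pmf (Y ({j} \<union> S)) \<inter> {f. restrict f S = \<beta>})"
    using ne by (simp add: marginal_def condition_def map_pmf_comp)
  ultimately show ?thesis by auto
qed

text \<open>The positivity condition covers all pairs of a set, of at most half the remaining
  locality, and an assignment. It is restricted to the sets in \<open>V\<close>, and
  \<open>psd_on_block_squares\<close> squares and sums over the assignments.\<close>

lemma psd_on_pair_corr:
  assumes psd: "local_PSD_ensemble n d L Y" and S: "S \<subseteq> {1..n}" "\<beta> \<in> set_pmf (Y S)" "card S + 2 \<le> L"
    and V: "finite V" "\<And>s. s \<in> V \<Longrightarrow> s \<subseteq> {1..n} \<and> 2 * card s \<le> L - card S"
  shows "psd_on V (pair_corr d (condition Y S \<beta>))"
proof -
  let ?M = "indicator_cov (condition Y S \<beta>)"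
  let ?I = "{(S', \<alpha>). S' \<subseteq> {1..n} \<and> 2 * card S' \<le> L - card S \<and> \<alpha> \<in> S' \<rightarrow>\<^sub>E {1..d}}"
  let ?R = "\<lambda>s. s \<rightarrow>\<^sub>E {1..d}"
  have I: "psd_on ?I ?M" using psd S by (simp add: local_PSD_ensemble_def)
  have fR: "finite (?R s)" if "s \<in> V" for s
    using V(2)[OF that] finite_subset[of s "{1..n}"] by (intro finite_assignments) auto
  have sub: "Sigma V ?R \<subseteq> ?I" using V by auto
  have finI: "finite ?I"
  proof (rule finite_subset)
    show "?I \<subseteq> Sigma (Pow {1..n}) ?R" by auto
    show "finite (Sigma (Pow {1..n}) ?R)"
      using finite_subset[of _ "{1..n}"] by (intro finite_SigmaI finite_assignments) auto
  qed
  have "psd_on (Sigma V ?R) ?M"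
    unfolding psd_on_def
  proof (intro conjI ballI allI)
    fix i j assume "i \<in> Sigma V ?R" "j \<in> Sigma V ?R"
    thus "?M i j = ?M j i" using I sub unfolding psd_on_def by blast
  next
    fix c :: "nat set \<times> (nat \<Rightarrow> nat) \<Rightarrow> real"
    \<comment> \<open>Test vectors on the smaller index set are extended by 0.\<close>
    define c' where "c' i = (if i \<in> Sigma V ?R then c i else 0)" for i
    have "0 \<le> (\<Sum>i\<in>?I. \<Sum>j\<in>?I. c' i * ?M i j * c' j)"
      using I unfolding psd_on_def by blast
    also have "\<dots> = (\<Sum>i\<in>Sigma V ?R. \<Sum>j\<in>?I. c' i * ?M i j * c' j)"
      by (rule sum.mono_neutral_right[OF finI sub]) (simp add: c'_def)
    also have "\<dots> = (\<Sum>i\<in>Sigma V ?R. \<Sum>j\<in>Sigma V ?R. c' i * ?M i j * c' j)"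
      by (intro sum.cong refl sum.mono_neutral_right[OF finI sub]) (simp add: c'_def)
    also have "\<dots> = (\<Sum>i\<in>Sigma V ?R. \<Sum>j\<in>Sigma V ?R. c i * ?M i j * c j)"
      by (intro sum.cong refl) (simp add: c'_def)
    finally show "0 \<le> (\<Sum>i\<in>Sigma V ?R. \<Sum>j\<in>Sigma V ?R. c i * ?M i j * c j)" .
  qed
  from psd_on_block_squares[OF V(1) fR this] show ?thesis
    unfolding pair_corr_def[abs_def] by simp
qed

section \<open>Random faces and swap graphs\<close>

lemma card_subsets_between:
  assumes A: "finite A" "s \<subseteq> A" "card s = i" and ij: "i \<le> j"
  shows "card {B. s \<subseteq> B \<and> B \<subseteq> A \<and> card B = j} = (card A - i) choose (j - i)"
proof -
  have fs: "finite s" using A finite_subset by blast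
  have "bij_betw (\<lambda>C. s \<union> C) {C. C \<subseteq> A - s \<and> card C = j - i} {B. s \<subseteq> B \<and> B \<subseteq> A \<and> card B = j}"
  proof (rule bij_betwI[where g = "\<lambda>B. B - s"])
    show "(\<lambda>C. s \<union> C) \<in> {C. C \<subseteq> A - s \<and> card C = j - i} \<rightarrow> {B. s \<subseteq> B \<and> B \<subseteq> A \<and> card B = j}"
    proof
      fix C assume "C \<in> {C. C \<subseteq> A - s \<and> card C = j - i}"
      hence C: "C \<subseteq> A - s" "card C = j - i" by auto
      have "card (s \<union> C) = i + (j - i)"
        using C A(3) fs finite_subset[OF C(1)] A(1) by (subst card_Un_disjoint) auto
      thus "s \<union> C \<in> {B. s \<subseteq> B \<and> B \<subseteq> A \<and> card B = j}" using C A(2) ij by auto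
    qed
    show "(\<lambda>B. B - s) \<in> {B. s \<subseteq> B \<and> B \<subseteq> A \<and> card B = j} \<rightarrow> {C. C \<subseteq> A - s \<and> card C = j - i}"
      using A fs by (auto simp: card_Diff_subset)
  qed auto
  hence "card {B. s \<subseteq> B \<and> B \<subseteq> A \<and> card B = j} = card {C. C \<subseteq> A - s \<and> card C = j - i}"
    by (simp add: bij_betw_same_card)
  also have "\<dots> = card (A - s) choose (j - i)" using A(1) by (intro n_subsets) auto
  finally show ?thesis using A fs by (simp add: card_Diff_subset)
qed

lemma subsets_nonempty: "finite A \<Longrightarrow> i \<le> card A \<Longrightarrow> {B. B \<subseteq> A \<and> card B = i} \<noteq> {}"
  using obtain_subset_with_card_n[of i A] by auto

lemma pmf_of_subsets:
  assumes "finite A" "i \<le> card A"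
  shows "pmf (pmf_of_set {B. B \<subseteq> A \<and> card B = i}) s =
    (if s \<subseteq> A \<and> card s = i then 1 / real (card A choose i) else 0)"
  using assms subsets_nonempty[OF assms] by (subst pmf_of_set) (auto simp: n_subsets)

text \<open>Each i-subset lies in the same number of j-subsets, and the normalizations match by
  \<open>choose_mult\<close>. This is what makes the measures \<Pi>_i consistent from level to
  level.\<close>

lemma uniform_subset_of_uniform_subset:
  assumes A: "finite A" and ij: "i \<le> j" "j \<le> card A"
  shows "bind_pmf (pmf_of_set {B. B \<subseteq> A \<and> card B = j}) (\<lambda>B. pmf_of_set {C. C \<subseteq> B \<and> card C = i})
    = pmf_of_set {C. C \<subseteq> A \<and> card C = i}"
proof (rule pmf_eqI)
  fix s
  let ?S = "{B. B \<subseteq> A \<and> card B = j}"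
  have S: "finite ?S" "?S \<noteq> {}" using A subsets_nonempty[OF A ij(2)] by auto
  have B: "finite B" "i \<le> card B" if "B \<in> ?S" for B using that A ij finite_subset by auto
  have "pmf (bind_pmf (pmf_of_set ?S) (\<lambda>B. pmf_of_set {C. C \<subseteq> B \<and> card C = i})) s
      = (\<Sum>B\<in>?S. pmf (pmf_of_set {C. C \<subseteq> B \<and> card C = i}) s) / real (card A choose j)"
    unfolding pmf_bind integral_pmf_of_set[OF S(2,1)] n_subsets[OF A] ..
  also have "(\<Sum>B\<in>?S. pmf (pmf_of_set {C. C \<subseteq> B \<and> card C = i}) s)
      = (\<Sum>B\<in>?S. if s \<subseteq> B \<and> card s = i then 1 / real (j choose i) else 0)"
    using B by (intro sum.cong refl) (simp add: pmf_of_subsets)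
  also have "\<dots> = (if s \<subseteq> A \<and> card s = i then real ((card A - i) choose (j - i)) / real (j choose i) else 0)"
  proof (cases "s \<subseteq> A \<and> card s = i")
    case True
    have "(\<Sum>B\<in>?S. if s \<subseteq> B \<and> card s = i then 1 / real (j choose i) else 0)
        = (\<Sum>B\<in>{B\<in>?S. s \<subseteq> B}. 1 / real (j choose i))"
      by (subst sum.inter_filter[OF S(1)]) (use True in simp)
    also have "{B\<in>?S. s \<subseteq> B} = {B. s \<subseteq> B \<and> B \<subseteq> A \<and> card B = j}" by auto
    finally show ?thesis using True card_subsets_between[OF A _ _ ij(1), of s] by simp
  next
    case False
    hence "\<not> (s \<subseteq> B \<and> card s = i)" if "B \<in> ?S" for B using that by auto
    thus ?thesis unfolding if_not_P[OF False] by (intro sum.neutral ballI if_not_P)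
  qed
  also have "\<dots> / real (card A choose j) = pmf (pmf_of_set {C. C \<subseteq> A \<and> card C = i}) s"
  proof -
    have "real (card A choose j) * real (j choose i) = real (card A choose i) * real ((card A - i) choose (j - i))"
      by (simp only: of_nat_mult[symmetric] choose_mult[OF ij])
    moreover have "real (card A choose j) > 0" "real (j choose i) > 0" "real (card A choose i) > 0"
      using ij by auto
    ultimately show ?thesis
      using pmf_of_subsets[OF A, of i s] ij by (auto simp: field_simps)
  qed
  finally show "pmf (bind_pmf (pmf_of_set ?S) (\<lambda>B. pmf_of_set {C. C \<subseteq> B \<and> card C = i})) s
    = pmf (pmf_of_set {C. C \<subseteq> A \<and> card C = i}) s" .
qed

lemma uniform_complement:
  assumes B: "finite B" "card B = a + b"
  shows "map_pmf (\<lambda>s. B - s) (pmf_of_set {s. s \<subseteq> B \<and> card s = a}) = pmf_of_set {t. t \<subseteq> B \<and> card t = b}"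
proof -
  have "inj_on (\<lambda>s. B - s) {s. s \<subseteq> B \<and> card s = a}" by (intro inj_onI) blast
  moreover have "(\<lambda>s. B - s) ` {s. s \<subseteq> B \<and> card s = a} = {t. t \<subseteq> B \<and> card t = b}"
  proof (intro equalityI subsetI)
    fix t assume "t \<in> {t. t \<subseteq> B \<and> card t = b}"
    hence "t = B - (B - t)" "B - t \<in> {s. s \<subseteq> B \<and> card s = a}"
      using B finite_subset[of t B] by (auto simp: card_Diff_subset)
    thus "t \<in> (\<lambda>s. B - s) ` {s. s \<subseteq> B \<and> card s = a}" by (rule image_eqI)
  qed (use B finite_subset[of _ B] in \<open>auto simp: card_Diff_subset\<close>)
  ultimately show ?thesis
    using B subsets_nonempty[of B a] by (subst map_pmf_of_set_inj) auto
qed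

lemma swap_weight_nonneg: "swap_weight X \<mu> a b s t \<ge> 0"
  by (simp add: swap_weight_def)

lemma swap_weight_sym: "swap_weight X \<mu> a b s t = swap_weight X \<mu> a b t s"
  by (auto simp: swap_weight_def Un_commute)

context
  fixes n :: nat and X :: "nat set set"
  assumes X: "simplicial_complex n X"
begin

lemma face_subset: "A \<in> X \<Longrightarrow> A \<subseteq> {1..n}"
  using X by (auto simp: simplicial_complex_def)

lemma face_finite: "A \<in> X \<Longrightarrow> finite A"
  using face_subset finite_subset by blast

lemma finite_faces: "finite (faces X i)"
  by (rule finite_subset[of _ "Pow {1..n}"]) (use face_subset in \<open>auto simp: faces_def\<close>)

lemma finite_swap_vertices: "finite (swap_vertices X a b)"
  by (simp add: swap_vertices_def finite_faces)

lemma face_down: "A \<in> X \<Longrightarrow> B \<subseteq> A \<Longrightarrow> B \<in> X"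
  using X by (auto simp: simplicial_complex_def)

end

context
  fixes n k :: nat and X :: "nat set set" and \<mu> :: "nat set pmf"
  assumes X: "simplicial_complex n X" and \<mu>: "set_pmf \<mu> \<subseteq> faces X k"
begin

lemma set_face_pmf:
  assumes "i \<le> k"
  shows "set_pmf (face_pmf \<mu> i) \<subseteq> faces X i"
proof
  fix s assume "s \<in> set_pmf (face_pmf \<mu> i)"
  then obtain A where A: "A \<in> set_pmf \<mu>" "s \<in> set_pmf (pmf_of_set {B. B \<subseteq> A \<and> card B = i})"
    by (auto simp: face_pmf_def)
  have AX: "A \<in> X" "card A = k" using \<mu> A(1) by (auto simp: faces_def)
  have fA: "finite A" by (rule face_finite[OF X AX(1)])
  have "s \<subseteq> A \<and> card s = i"
    using A(2) subsets_nonempty[OF fA] fA AX(2) assms by (subst (asm) set_pmf_of_set) auto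
  thus "s \<in> faces X i" using face_down[OF X AX(1)] by (auto simp: faces_def)
qed

lemma face_pmf_down:
  assumes "i \<le> j" "j \<le> k"
  shows "face_pmf \<mu> i = bind_pmf (face_pmf \<mu> j) (\<lambda>B. pmf_of_set {C. C \<subseteq> B \<and> card C = i})"
  unfolding face_pmf_def bind_assoc_pmf
proof (rule bind_pmf_cong[OF refl])
  fix A assume "A \<in> set_pmf \<mu>"
  hence "A \<in> X" "card A = k" using \<mu> by (auto simp: faces_def)
  thus "pmf_of_set {B. B \<subseteq> A \<and> card B = i} =
      bind_pmf (pmf_of_set {B. B \<subseteq> A \<and> card B = j}) (\<lambda>B. pmf_of_set {C. C \<subseteq> B \<and> card C = i})"
    using assms by (intro uniform_subset_of_uniform_subset[symmetric] face_finite[OF X]) auto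
qed

lemma face_pmf_top: "face_pmf \<mu> k = \<mu>"
proof -
  have "face_pmf \<mu> k = bind_pmf \<mu> return_pmf"
    unfolding face_pmf_def
  proof (rule bind_pmf_cong[OF refl])
    fix A assume "A \<in> set_pmf \<mu>"
    hence A: "A \<in> X" "card A = k" using \<mu> by (auto simp: faces_def)
    have "B = A" if "B \<subseteq> A" "card B = k" for B
      using card_subset_eq[OF face_finite[OF X A(1)] that(1)] that(2) A(2) by simp
    hence "{B. B \<subseteq> A \<and> card B = k} = {A}" using A(2) by auto
    thus "pmf_of_set {B. B \<subseteq> A \<and> card B = k} = return_pmf A" by (simp add: pmf_of_set_singleton)
  qed
  thus ?thesis by (simp add: bind_return_pmf')
qed

lemma pmf_face_pmf_eq_sum:
  assumes "i \<le> j" "j \<le> k" "card s = i"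
  shows "pmf (face_pmf \<mu> i) s = (\<Sum>B | B \<in> faces X j \<and> s \<subseteq> B. pmf (face_pmf \<mu> j) B / real (j choose i))"
proof -
  have "pmf (face_pmf \<mu> i) s = (\<Sum>B\<in>faces X j. pmf (face_pmf \<mu> j) B * pmf (pmf_of_set {C. C \<subseteq> B \<and> card C = i}) s)"
    unfolding face_pmf_down[OF assms(1,2)] pmf_bind
    by (rule expectation_finite[OF finite_faces[OF X] set_face_pmf[OF assms(2)]])
  also have "\<dots> = (\<Sum>B\<in>faces X j. if s \<subseteq> B then pmf (face_pmf \<mu> j) B / real (j choose i) else 0)"
  proof (intro sum.cong refl)
    fix B assume "B \<in> faces X j"
    hence "finite B" "card B = j" using face_finite[OF X] by (auto simp: faces_def)
    thus "pmf (face_pmf \<mu> j) B * pmf (pmf_of_set {C. C \<subseteq> B \<and> card C = i}) s =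
        (if s \<subseteq> B then pmf (face_pmf \<mu> j) B / real (j choose i) else 0)"
      using assms by (simp add: pmf_of_subsets)
  qed
  also have "\<dots> = (\<Sum>B | B \<in> faces X j \<and> s \<subseteq> B. pmf (face_pmf \<mu> j) B / real (j choose i))"
    by (rule sum.inter_filter[symmetric, OF finite_faces[OF X]])
  finally show ?thesis .
qed

text \<open>Taking the union with \<open>s\<close> sends its neighbours injectively to the
  (a+b)-faces containing \<open>s\<close>, whose weights add up to the probability of
  \<open>s\<close> on its own level. For \<open>s\<close> of size b the symmetry of the binomial
  coefficient matches the normalization.\<close>

lemma swap_degree_le:
  assumes ab: "a + b \<le> k" and s: "s \<in> swap_vertices X a b"
  shows "(\<Sum>t\<in>swap_vertices X a b. swap_weight X \<mu> a b s t) \<le> pmf (face_pmf \<mu> (card s)) s"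
proof -
  let ?V = "swap_vertices X a b"
  let ?T = "{t\<in>?V. swap_edge X a b s t \<or> swap_edge X a b t s}"
  let ?j = "a + b"
  have cs: "card s = a \<or> card s = b" using s by (auto simp: swap_vertices_def faces_def)
  hence ch: "(?j choose a) = (?j choose card s)"
    using binomial_symmetric[of a "a + b"] by auto
  have inj: "inj_on (\<lambda>t. s \<union> t) ?T"
  proof (rule inj_onI)
    fix t t' assume "t \<in> ?T" "t' \<in> ?T" and e: "s \<union> t = s \<union> t'"
    hence "s \<inter> t = {}" "s \<inter> t' = {}" by (auto simp: swap_edge_def)
    thus "t = t'" using e by blast
  qed
  have "(\<Sum>t\<in>?V. swap_weight X \<mu> a b s t) =
      (\<Sum>t\<in>?T. pmf (face_pmf \<mu> ?j) (s \<union> t) / real (?j choose card s))"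
    unfolding swap_weight_def ch[symmetric] by (rule sum.inter_filter[symmetric, OF finite_swap_vertices[OF X]])
  also have "\<dots> = (\<Sum>B\<in>(\<lambda>t. s \<union> t) ` ?T. pmf (face_pmf \<mu> ?j) B / real (?j choose card s))"
    by (simp only: sum.reindex[OF inj] o_def)
  also have "\<dots> \<le> (\<Sum>B | B \<in> faces X ?j \<and> s \<subseteq> B. pmf (face_pmf \<mu> ?j) B / real (?j choose card s))"
    by (rule sum_mono2) (auto simp: finite_faces[OF X] swap_edge_def Un_commute)
  also have "\<dots> = pmf (face_pmf \<mu> (card s)) s"
    using cs ab by (intro pmf_face_pmf_eq_sum[symmetric]) auto
  finally show ?thesis .
qed

text \<open>A random face with a random a-subset is an edge with its a-end first. Only an inequality
  is claimed, since for a \<noteq> b the double sum meets every edge in both orientations.\<close>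

lemma expectation_swap_edge_le:
  assumes ab: "a + b \<le> k" and c: "\<And>s t. c s t \<ge> 0"
  shows "measure_pmf.expectation (face_pmf \<mu> (a + b)) (\<lambda>B. measure_pmf.expectation
      (pmf_of_set {s. s \<subseteq> B \<and> card s = a}) (\<lambda>s. c s (B - s)))
    \<le> (\<Sum>s\<in>swap_vertices X a b. \<Sum>t\<in>swap_vertices X a b. swap_weight X \<mu> a b s t * c s t)"
proof -
  let ?V = "swap_vertices X a b" and ?j = "a + b"
  let ?S = "\<lambda>B. {s. s \<subseteq> B \<and> card s = a}"
  let ?P = "Sigma (faces X ?j) ?S"
  let ?g = "\<lambda>(B, s). pmf (face_pmf \<mu> ?j) B / real (?j choose a) * c s (B - s)"
  let ?h = "\<lambda>(B, s). (s, B - s)"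
  let ?w = "\<lambda>(s, t). swap_weight X \<mu> a b s t * c s t"
  have fS: "finite (?S B)" if "B \<in> faces X ?j" for B
    using that face_finite[OF X] by (auto simp: faces_def)
  have "measure_pmf.expectation (face_pmf \<mu> ?j) (\<lambda>B. measure_pmf.expectation (pmf_of_set (?S B)) (\<lambda>s. c s (B - s)))
    = (\<Sum>B\<in>faces X ?j. pmf (face_pmf \<mu> ?j) B * measure_pmf.expectation (pmf_of_set (?S B)) (\<lambda>s. c s (B - s)))"
    by (rule expectation_finite[OF finite_faces[OF X] set_face_pmf[OF ab]])
  also have "\<dots> = (\<Sum>B\<in>faces X ?j. \<Sum>s\<in>?S B. pmf (face_pmf \<mu> ?j) B / real (?j choose a) * c s (B - s))"
  proof (intro sum.cong refl)
    fix B assume B: "B \<in> faces X ?j"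
    hence fB: "finite B" "card B = ?j" using face_finite[OF X] by (auto simp: faces_def)
    show "pmf (face_pmf \<mu> ?j) B * measure_pmf.expectation (pmf_of_set (?S B)) (\<lambda>s. c s (B - s)) =
        (\<Sum>s\<in>?S B. pmf (face_pmf \<mu> ?j) B / real (?j choose a) * c s (B - s))"
      using fB fS[OF B] subsets_nonempty[OF fB(1), of a]
      by (subst integral_pmf_of_set) (auto simp: n_subsets sum_distrib_left sum_divide_distrib)
  qed
  also have "\<dots> = (\<Sum>x\<in>?P. ?g x)" using fS finite_faces[OF X] by (intro sum.Sigma) auto
  also have "\<dots> = (\<Sum>x\<in>?P. ?w (?h x))"
  proof (intro sum.cong refl)
    fix x assume x: "x \<in> ?P"
    obtain B s where [simp]: "x = (B, s)" by (cases x)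
    have B: "B \<in> X" "card B = ?j" and s: "s \<subseteq> B" "card s = a" using x by (auto simp: faces_def)
    have u: "s \<union> (B - s) = B" using s by auto
    have "swap_edge X a b s (B - s)"
      using B s face_down[OF X B(1)] face_finite[OF X B(1)] u finite_subset[OF s(1)]
      by (auto simp: swap_edge_def faces_def card_Diff_subset)
    thus "?g x = ?w (?h x)" using s(1) by (simp add: swap_weight_def Un_absorb1)
  qed
  also have "\<dots> = (\<Sum>y\<in>?h ` ?P. ?w y)"
  proof -
    have "inj_on ?h ?P" by (intro inj_onI) auto
    from sum.reindex[OF this, of ?w] show ?thesis by (simp add: o_def)
  qed
  also have "\<dots> \<le> (\<Sum>y\<in>?V \<times> ?V. ?w y)"
  proof (rule sum_mono2)
    show "?h ` ?P \<subseteq> ?V \<times> ?V"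
    proof
      fix y assume "y \<in> ?h ` ?P"
      then obtain B s where y: "y = (s, B - s)" and B: "B \<in> X" "card B = ?j" and s: "s \<subseteq> B" "card s = a"
        by (auto simp: faces_def)
      show "y \<in> ?V \<times> ?V"
        using B s face_down[OF X B(1)] face_finite[OF X B(1)] finite_subset[OF s(1)]
        by (auto simp: y swap_vertices_def faces_def card_Diff_subset)
    qed
  qed (use c finite_swap_vertices[OF X] swap_weight_nonneg in auto)
  also have "\<dots> = (\<Sum>s\<in>?V. \<Sum>t\<in>?V. swap_weight X \<mu> a b s t * c s t)"
    by (rule sum.cartesian_product[symmetric])
  finally show ?thesis .
qed

end

section \<open>Error along the splitting tree\<close>

definition edge_pmf :: "nat set pmf \<Rightarrow> nat \<Rightarrow> nat \<Rightarrow> (nat set \<times> nat set) pmf" where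
  "edge_pmf \<mu> a b = bind_pmf (face_pmf \<mu> (a + b))
     (\<lambda>B. map_pmf (\<lambda>s. (s, B - s)) (pmf_of_set {s. s \<subseteq> B \<and> card s = a}))"

definition nonempty_faces :: "nat set set \<Rightarrow> nat \<Rightarrow> nat set set" where
  "nonempty_faces X k = {s \<in> X. 1 \<le> card s \<and> card s \<le> k}"

definition face_prob :: "nat set pmf \<Rightarrow> nat set \<Rightarrow> real" where
  "face_prob \<mu> s = pmf (face_pmf \<mu> (card s)) s"

text \<open>One quantity for all nodes of the tree: every vertex of a swap graph with a, b \<ge> 1
  and a + b \<le> k is a nonempty face of size at most \<open>k\<close>. The weights
  \<open>face_prob\<close> form a probability on each of the k levels, so their total is bounded by
  k rather than 1.\<close>

definition total_corr :: "nat set set \<Rightarrow> nat set pmf \<Rightarrow> nat \<Rightarrow> nat \<Rightarrow> ensemble \<Rightarrow> real" where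
  "total_corr X \<mu> k d Z = (\<Sum>s\<in>nonempty_faces X k. \<Sum>t\<in>nonempty_faces X k.
     face_prob \<mu> s * face_prob \<mu> t * pair_corr d Z s t)"

definition product_error :: "nat set pmf \<Rightarrow> ensemble \<Rightarrow> nat \<Rightarrow> real" where
  "product_error \<mu> Z i = measure_pmf.expectation (face_pmf \<mu> i) (\<lambda>B. l1_dist (Z B) (product_law Z B))"

lemma total_corr_nonneg: "total_corr X \<mu> k d Z \<ge> 0"
  unfolding total_corr_def face_prob_def by (intro sum_nonneg mult_nonneg_nonneg pair_corr_nonneg) auto

context
  fixes n k :: nat and X :: "nat set set" and \<mu> :: "nat set pmf"
  assumes X: "simplicial_complex n X" and \<mu>: "set_pmf \<mu> \<subseteq> faces X k"
begin

lemma set_edge_pmf: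
  assumes "a + b \<le> k" "(s, t) \<in> set_pmf (edge_pmf \<mu> a b)"
  shows "s \<inter> t = {}" "s \<union> t \<in> faces X (a + b)"
proof -
  obtain B where B: "B \<in> set_pmf (face_pmf \<mu> (a + b))"
    and s: "s \<in> set_pmf (pmf_of_set {s. s \<subseteq> B \<and> card s = a})" and t: "t = B - s"
    using assms(2) by (auto simp: edge_pmf_def)
  have BX: "B \<in> faces X (a + b)" using B set_face_pmf[OF X \<mu> assms(1)] by auto
  hence fB: "finite B" "card B = a + b" using face_finite[OF X] by (auto simp: faces_def)
  have "s \<subseteq> B" using s fB subsets_nonempty[OF fB(1), of a] by (subst (asm) set_pmf_of_set) auto
  hence "s \<union> t = B" using t by auto
  thus "s \<union> t \<in> faces X (a + b)" using BX by simp
  show "s \<inter> t = {}" using t by auto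
qed

lemma finite_edge_pmf:
  assumes "a + b \<le> k"
  shows "finite (set_pmf (edge_pmf \<mu> a b))"
proof (rule finite_subset)
  show "set_pmf (edge_pmf \<mu> a b) \<subseteq> Pow {1..n} \<times> Pow {1..n}"
  proof
    fix x assume "x \<in> set_pmf (edge_pmf \<mu> a b)"
    hence "fst x \<union> snd x \<in> X" using set_edge_pmf(2)[OF assms, of "fst x" "snd x"] by (simp add: faces_def)
    from face_subset[OF X this] show "x \<in> Pow {1..n} \<times> Pow {1..n}" by (auto simp: mem_Times_iff)
  qed
qed auto

lemma edge_pmf_union:
  assumes "a + b \<le> k"
  shows "map_pmf (\<lambda>(s, t). s \<union> t) (edge_pmf \<mu> a b) = face_pmf \<mu> (a + b)"
proof -
  have "map_pmf (\<lambda>(s, t). s \<union> t) (edge_pmf \<mu> a b) = bind_pmf (face_pmf \<mu> (a + b)) return_pmf"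
    unfolding edge_pmf_def map_bind_pmf map_pmf_comp
  proof (rule bind_pmf_cong[OF refl])
    fix B assume "B \<in> set_pmf (face_pmf \<mu> (a + b))"
    hence "B \<in> faces X (a + b)" using set_face_pmf[OF X \<mu> assms] by auto
    hence fB: "finite B" "card B = a + b" using face_finite[OF X] by (auto simp: faces_def)
    have "map_pmf (\<lambda>s. case (s, B - s) of (s, t) \<Rightarrow> s \<union> t) (pmf_of_set {s. s \<subseteq> B \<and> card s = a})
        = map_pmf (\<lambda>_. B) (pmf_of_set {s. s \<subseteq> B \<and> card s = a})"
      using fB subsets_nonempty[OF fB(1), of a]
      by (intro map_pmf_cong refl) (subst (asm) set_pmf_of_set, auto)
    thus "map_pmf (\<lambda>s. case (s, B - s) of (s, t) \<Rightarrow> s \<union> t) (pmf_of_set {s. s \<subseteq> B \<and> card s = a})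
        = return_pmf B" by (simp add: map_pmf_const)
  qed
  thus ?thesis by (simp add: bind_return_pmf')
qed

lemma edge_pmf_fst:
  assumes "a + b \<le> k"
  shows "map_pmf fst (edge_pmf \<mu> a b) = face_pmf \<mu> a"
  using assms
  by (simp add: edge_pmf_def map_bind_pmf map_pmf_comp face_pmf_down[OF X \<mu>, of a "a + b"])

lemma edge_pmf_snd:
  assumes "a + b \<le> k"
  shows "map_pmf snd (edge_pmf \<mu> a b) = face_pmf \<mu> b"
proof -
  have "map_pmf snd (edge_pmf \<mu> a b) = bind_pmf (face_pmf \<mu> (a + b)) (\<lambda>B. pmf_of_set {t. t \<subseteq> B \<and> card t = b})"
    unfolding edge_pmf_def map_bind_pmf map_pmf_comp snd_conv
  proof (rule bind_pmf_cong[OF refl])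
    fix B assume "B \<in> set_pmf (face_pmf \<mu> (a + b))"
    hence "B \<in> faces X (a + b)" using set_face_pmf[OF X \<mu> assms] by auto
    hence "finite B" "card B = a + b" using face_finite[OF X] by (auto simp: faces_def)
    thus "map_pmf (\<lambda>s. B - s) (pmf_of_set {s. s \<subseteq> B \<and> card s = a}) = pmf_of_set {t. t \<subseteq> B \<and> card t = b}"
      by (rule uniform_complement)
  qed
  thus ?thesis using assms face_pmf_down[OF X \<mu>, of b "a + b"] by simp
qed

lemma expectation_edge_pmf_le:
  assumes ab: "a + b \<le> k" and c: "\<And>s t. c s t \<ge> 0"
  shows "measure_pmf.expectation (edge_pmf \<mu> a b) (\<lambda>(s, t). c s t)
    \<le> (\<Sum>s\<in>swap_vertices X a b. \<Sum>t\<in>swap_vertices X a b. swap_weight X \<mu> a b s t * c s t)"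
proof -
  have "measure_pmf.expectation (edge_pmf \<mu> a b) (\<lambda>(s, t). c s t) =
    (\<Sum>B\<in>faces X (a + b). pmf (face_pmf \<mu> (a + b)) B * measure_pmf.expectation
      (map_pmf (\<lambda>s. (s, B - s)) (pmf_of_set {s. s \<subseteq> B \<and> card s = a})) (\<lambda>(s, t). c s t))"
    unfolding edge_pmf_def
  proof (subst pmf_expectation_bind[OF finite_faces[OF X] _ set_face_pmf[OF X \<mu> ab]])
    fix B assume "B \<in> faces X (a + b)"
    hence fB: "finite B" "card B = a + b" using face_finite[OF X] by (auto simp: faces_def)
    thus "finite (set_pmf (map_pmf (\<lambda>s. (s, B - s)) (pmf_of_set {s. s \<subseteq> B \<and> card s = a})))"
      using subsets_nonempty[OF fB(1), of a] by (subst set_map_pmf, subst set_pmf_of_set) auto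
  qed simp
  also have "\<dots> = measure_pmf.expectation (face_pmf \<mu> (a + b)) (\<lambda>B. measure_pmf.expectation
      (pmf_of_set {s. s \<subseteq> B \<and> card s = a}) (\<lambda>s. c s (B - s)))"
    by (subst expectation_finite[OF finite_faces[OF X] set_face_pmf[OF X \<mu> ab]]) simp
  also have "\<dots> \<le> (\<Sum>s\<in>swap_vertices X a b. \<Sum>t\<in>swap_vertices X a b. swap_weight X \<mu> a b s t * c s t)"
    by (rule expectation_swap_edge_le[OF X \<mu> ab c])
  finally show ?thesis .
qed

text \<open>Three estimates turn \<open>threshold_rank_bound\<close> into plain averages: degrees
  are at most \<open>face_prob\<close>, \<open>C\<close> is at most 2, and the vertices have total
  mass at most 2, one for each of the two levels. So the trace is at most 4, and
  \<open>C\<^sup>2\<close> is at most twice \<open>C\<close>.\<close>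

lemma swap_threshold_bound:
  assumes ab: "a + b \<le> k" and psd: "psd_on (swap_vertices X a b) C"
    and \<tau>: "\<tau> \<ge> 0" and K: "K > 0"
    and C: "\<And>s t. s \<in> swap_vertices X a b \<Longrightarrow> t \<in> swap_vertices X a b \<Longrightarrow> 0 \<le> C s t \<and> C s t \<le> 2"
    and rank: "threshold_rank \<tau> (swap_vertices X a b) (swap_weight X \<mu> a b) \<le> r"
  shows "(\<Sum>s\<in>swap_vertices X a b. \<Sum>t\<in>swap_vertices X a b. swap_weight X \<mu> a b s t * C s t)
    \<le> 4 * \<tau> + r / (2 * K) + K * (\<Sum>s\<in>swap_vertices X a b. \<Sum>t\<in>swap_vertices X a b.
        face_prob \<mu> s * face_prob \<mu> t * C s t)"
proof -
  let ?V = "swap_vertices X a b" and ?w = "swap_weight X \<mu> a b"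
  define deg where "deg s = (\<Sum>t\<in>?V. ?w s t)" for s
  have deg: "deg s \<le> face_prob \<mu> s" if "s \<in> ?V" for s
    unfolding deg_def face_prob_def by (rule swap_degree_le[OF X \<mu> ab that])
  have deg0: "deg s \<ge> 0" for s unfolding deg_def by (intro sum_nonneg swap_weight_nonneg)
  have fp0: "face_prob \<mu> s \<ge> 0" for s by (simp add: face_prob_def)
  have one: "(\<Sum>s\<in>faces X i. face_prob \<mu> s) \<le> 1" for i
  proof -
    have "(\<Sum>s\<in>faces X i. face_prob \<mu> s) = (\<Sum>s\<in>faces X i. pmf (face_pmf \<mu> i) s)"
      by (intro sum.cong refl) (auto simp: face_prob_def faces_def)
    also have "\<dots> = measure_pmf.prob (face_pmf \<mu> i) (faces X i)"
      by (simp add: measure_measure_pmf_finite finite_faces[OF X])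
    finally show ?thesis by simp
  qed
  have total: "(\<Sum>s\<in>?V. face_prob \<mu> s) \<le> 2"
  proof -
    have "(\<Sum>s\<in>?V. face_prob \<mu> s) + (\<Sum>s\<in>faces X a \<inter> faces X b. face_prob \<mu> s)
        = (\<Sum>s\<in>faces X a. face_prob \<mu> s) + (\<Sum>s\<in>faces X b. face_prob \<mu> s)"
      unfolding swap_vertices_def by (rule sum.union_inter) (auto simp: finite_faces[OF X])
    moreover have "(\<Sum>s\<in>faces X a \<inter> faces X b. face_prob \<mu> s) \<ge> 0" by (intro sum_nonneg fp0)
    ultimately show ?thesis using one[of a] one[of b] by linarith
  qed
  have "(\<Sum>s\<in>?V. \<Sum>t\<in>?V. ?w s t * C s t) \<le> \<tau> * (\<Sum>s\<in>?V. deg s * C s s) + r / (2 * K)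
      + K / 2 * (\<Sum>s\<in>?V. \<Sum>t\<in>?V. deg s * deg t * (C s t)\<^sup>2)"
    unfolding deg_def
    by (rule threshold_rank_bound[OF finite_swap_vertices[OF X] psd \<tau> K _ _ rank])
       (auto simp: swap_weight_nonneg intro: swap_weight_sym)
  also have "\<dots> \<le> \<tau> * 4 + r / (2 * K)
      + K / 2 * (\<Sum>s\<in>?V. \<Sum>t\<in>?V. 2 * (face_prob \<mu> s * face_prob \<mu> t * C s t))"
  proof (intro add_mono mult_left_mono order_refl)
    have "(\<Sum>s\<in>?V. deg s * C s s) \<le> (\<Sum>s\<in>?V. face_prob \<mu> s * 2)"
      using deg deg0 C fp0 by (intro sum_mono mult_mono) auto
    thus "(\<Sum>s\<in>?V. deg s * C s s) \<le> 4" using total by (simp add: sum_distrib_right[symmetric])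
    show "(\<Sum>s\<in>?V. \<Sum>t\<in>?V. deg s * deg t * (C s t)\<^sup>2)
        \<le> (\<Sum>s\<in>?V. \<Sum>t\<in>?V. 2 * (face_prob \<mu> s * face_prob \<mu> t * C s t))"
    proof (intro sum_mono)
      fix s t assume st: "s \<in> ?V" "t \<in> ?V"
      have "deg s * deg t * (C s t)\<^sup>2 \<le> face_prob \<mu> s * face_prob \<mu> t * (2 * C s t)"
        using deg[OF st(1)] deg[OF st(2)] deg0 fp0 C[OF st]
        by (intro mult_mono) (auto simp: power2_eq_square intro: mult_right_mono)
      thus "deg s * deg t * (C s t)\<^sup>2 \<le> 2 * (face_prob \<mu> s * face_prob \<mu> t * C s t)" by simp
    qed
  qed (use \<tau> K in auto)
  also have "\<dots> = 4 * \<tau> + r / (2 * K) + K * (\<Sum>s\<in>?V. \<Sum>t\<in>?V. face_prob \<mu> s * face_prob \<mu> t * C s t)"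
    by (simp add: sum_distrib_left[symmetric])
  finally show ?thesis .
qed

text \<open>The constant kernel \<open>1\<close> witnesses an eigenvalue above \<open>\<tau>\<close>.\<close>

lemma threshold_rank_pos:
  assumes ab: "a + b \<le> k" and \<tau>: "0 \<le> \<tau>" "\<tau> < 1 / 4"
  shows "threshold_rank \<tau> (swap_vertices X a b) (swap_weight X \<mu> a b) \<ge> 1"
proof (rule ccontr)
  assume "\<not> ?thesis"
  hence rank: "threshold_rank \<tau> (swap_vertices X a b) (swap_weight X \<mu> a b) \<le> 0" by simp
  let ?V = "swap_vertices X a b"
  have psd: "psd_on ?V (\<lambda>_ _. 1)"
    unfolding psd_on_def by (auto simp: sum_product[symmetric])
  define W where "W = (\<Sum>s\<in>?V. \<Sum>t\<in>?V. face_prob \<mu> s * face_prob \<mu> t * 1)"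
  \<comment> \<open>For rank 0 the term with \<open>2 * K\<close> in its denominator vanishes, so
    \<open>K\<close> may be taken small enough that 4\<tau> + K W stays below 1, against the total
    edge weight of at least 1.\<close>
  define K where "K = (1 - 4 * \<tau>) / (2 * (W + 1))"
  have W: "W \<ge> 0" unfolding W_def face_prob_def by (intro sum_nonneg) auto
  have K: "K > 0" using \<tau> W by (simp add: K_def)
  have "(1::real) = measure_pmf.expectation (edge_pmf \<mu> a b) (\<lambda>(s, t). 1)"
    by (simp add: case_prod_unfold)
  also have "\<dots> \<le> (\<Sum>s\<in>?V. \<Sum>t\<in>?V. swap_weight X \<mu> a b s t * 1)"
    by (rule expectation_edge_pmf_le[OF ab]) simp
  also have "\<dots> \<le> 4 * \<tau> + real 0 / (2 * K) + K * W"
    unfolding W_def by (rule swap_threshold_bound[OF ab psd \<tau>(1) K _ rank]) simp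
  also have "K * W \<le> (1 - 4 * \<tau>) / 2"
    using W \<tau> by (simp add: K_def field_simps)
  finally show False using \<tau> by (simp add: field_simps)
qed

context
  fixes d L q r :: nat and Z :: ensemble and \<tau> K \<delta> :: real
  assumes loc: "local_ensemble n d L Z" and kL: "k \<le> L" and q: "q \<ge> 1"
    and supp: "\<And>j. j \<in> {1..n} \<Longrightarrow> finite (set_pmf (marginal Z j)) \<and> card (set_pmf (marginal Z j)) \<le> q"
    and psd: "\<And>a b. a + b \<le> k \<Longrightarrow> psd_on (swap_vertices X a b) (pair_corr d Z)"
    and \<tau>: "\<tau> \<ge> 0" and K: "K > 0" and \<delta>: "\<delta> > 0"
begin

text \<open>Averages \<open>l1_dist_product_law_split\<close> over a random edge. Each end of the
  edge has the law of a random face of its size, so the two halves average to the errors at the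
  children.\<close>

lemma product_error_node:
  assumes ab: "a + b \<le> k" "a \<ge> 1" "b \<ge> 1"
    and rank: "threshold_rank \<tau> (swap_vertices X a b) (swap_weight X \<mu> a b) \<le> r"
  shows "product_error \<mu> Z (a + b) \<le> product_error \<mu> Z a + product_error \<mu> Z b +
    (real q ^ k * \<delta> / 2 + (4 * \<tau> + r / (2 * K) + K * total_corr X \<mu> k d Z) / (2 * \<delta>))"
proof -
  let ?E = "edge_pmf \<mu> a b" and ?V = "swap_vertices X a b" and ?U = "nonempty_faces X k"
  let ?l = "\<lambda>B. l1_dist (Z B) (product_law Z B)"
  note int = integrable_measure_pmf_finite[OF finite_edge_pmf[OF ab(1)]]
  have VU: "?V \<subseteq> ?U" using ab by (auto simp: swap_vertices_def nonempty_faces_def faces_def)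
  have finU: "finite ?U"
  proof (rule finite_subset)
    show "?U \<subseteq> Pow {1..n}" using face_subset[OF X] by (auto simp only: nonempty_faces_def)
  qed simp
  have finV: "finite s" if "s \<in> ?V" for s
    using that face_finite[OF X] by (auto simp: swap_vertices_def faces_def)
  have "product_error \<mu> Z (a + b) = measure_pmf.expectation ?E (\<lambda>(s, t). ?l (s \<union> t))"
    unfolding product_error_def edge_pmf_union[OF ab(1), symmetric] by (simp add: case_prod_unfold)
  also have "\<dots> \<le> measure_pmf.expectation ?E (\<lambda>x. real q ^ k * \<delta> / 2
      + (\<lambda>(s, t). pair_corr d Z s t) x / (2 * \<delta>) + (?l (fst x) + ?l (snd x)))"
  proof (rule integral_mono_AE[OF int int], unfold AE_measure_pmf_iff, intro ballI)
    fix x assume x: "x \<in> set_pmf ?E"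
    obtain s t where [simp]: "x = (s, t)" by (cases x)
    have st: "s \<inter> t = {}" "s \<union> t \<in> faces X (a + b)" using set_edge_pmf[OF ab(1)] x by auto
    have c: "s \<union> t \<subseteq> {1..n}" "card (s \<union> t) = a + b"
      using st(2) face_subset[OF X] by (auto simp: faces_def)
    have "?l (s \<union> t) \<le> (real q ^ card (s \<union> t) * \<delta> / 2 + pair_corr d Z s t / (2 * \<delta>)) + (?l s + ?l t)"
      by (rule l1_dist_product_law_split[OF loc supp st(1) c(1) _ \<delta>]) (use c ab kL in auto)
    also have "real q ^ card (s \<union> t) * \<delta> / 2 \<le> real q ^ k * \<delta> / 2"
      using q c ab \<delta> by (intro divide_right_mono mult_right_mono power_increasing) auto
    finally show "(case x of (s, t) \<Rightarrow> ?l (s \<union> t)) \<le> real q ^ k * \<delta> / 2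
      + (\<lambda>(s, t). pair_corr d Z s t) x / (2 * \<delta>) + (?l (fst x) + ?l (snd x))" by simp
  qed
  also have "\<dots> = real q ^ k * \<delta> / 2 + measure_pmf.expectation ?E (\<lambda>(s, t). pair_corr d Z s t) / (2 * \<delta>)
      + (measure_pmf.expectation ?E (\<lambda>x. ?l (fst x)) + measure_pmf.expectation ?E (\<lambda>x. ?l (snd x)))"
    by (simp add: int)
  also have "measure_pmf.expectation ?E (\<lambda>x. ?l (fst x)) = product_error \<mu> Z a"
    unfolding product_error_def edge_pmf_fst[OF ab(1), symmetric] by simp
  also have "measure_pmf.expectation ?E (\<lambda>x. ?l (snd x)) = product_error \<mu> Z b"
    unfolding product_error_def edge_pmf_snd[OF ab(1), symmetric] by simp
  also have "measure_pmf.expectation ?E (\<lambda>(s, t). pair_corr d Z s t)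
      \<le> (\<Sum>s\<in>?V. \<Sum>t\<in>?V. swap_weight X \<mu> a b s t * pair_corr d Z s t)"
    by (rule expectation_edge_pmf_le[OF ab(1) pair_corr_nonneg])
  also have "\<dots> \<le> 4 * \<tau> + r / (2 * K) + K * (\<Sum>s\<in>?V. \<Sum>t\<in>?V. face_prob \<mu> s * face_prob \<mu> t * pair_corr d Z s t)"
    by (rule swap_threshold_bound[OF ab(1) psd[OF ab(1)] \<tau> K _ rank])
       (use finV pair_corr_nonneg pair_corr_le_2 in blast)
  also have "(\<Sum>s\<in>?V. \<Sum>t\<in>?V. face_prob \<mu> s * face_prob \<mu> t * pair_corr d Z s t) \<le> total_corr X \<mu> k d Z"
  proof -
    have nn: "face_prob \<mu> s * face_prob \<mu> t * pair_corr d Z s t \<ge> 0" for s t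
      unfolding face_prob_def by (intro mult_nonneg_nonneg pair_corr_nonneg) auto
    have "(\<Sum>s\<in>?V. \<Sum>t\<in>?V. face_prob \<mu> s * face_prob \<mu> t * pair_corr d Z s t)
        \<le> (\<Sum>s\<in>?V. \<Sum>t\<in>?U. face_prob \<mu> s * face_prob \<mu> t * pair_corr d Z s t)"
      using finU VU nn by (intro sum_mono sum_mono2) auto
    also have "\<dots> \<le> total_corr X \<mu> k d Z"
      unfolding total_corr_def using finU VU nn by (intro sum_mono2 sum_nonneg) auto
    finally show ?thesis .
  qed
  finally show ?thesis
    using \<delta> K by (simp add: divide_right_mono mult_left_mono)
qed

text \<open>There is one internal node fewer than leaves, and each internal node pays the same
  amount, since its bound involves only \<open>k\<close> and \<open>total_corr\<close>. A leaf pays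
  nothing: the law of a single variable is its own product law.\<close>

lemma product_error_tree:
  fixes T :: "unit tree"
  assumes "size1 T \<le> k"
    and "\<And>T1 T2. Node T1 () T2 \<in> subtrees T \<Longrightarrow>
      threshold_rank \<tau> (swap_vertices X (size1 T1) (size1 T2)) (swap_weight X \<mu> (size1 T1) (size1 T2)) \<le> r"
  shows "product_error \<mu> Z (size1 T) \<le> real (size1 T - 1) *
    (real q ^ k * \<delta> / 2 + (4 * \<tau> + r / (2 * K) + K * total_corr X \<mu> k d Z) / (2 * \<delta>))"
  using assms
proof (induction T)
  case Leaf
  have "measure_pmf.expectation (face_pmf \<mu> 1) (\<lambda>B. l1_dist (Z B) (product_law Z B)) = measure_pmf.expectation (face_pmf \<mu> 1) (\<lambda>B. 0)"
  proof (rule integral_cong_AE)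
    show "AE B in face_pmf \<mu> 1. l1_dist (Z B) (product_law Z B) = 0"
      unfolding AE_measure_pmf_iff
    proof
      fix B assume "B \<in> set_pmf (face_pmf \<mu> 1)"
      hence B: "B \<in> X" "card B = 1" using set_face_pmf[OF X \<mu>, of 1] Leaf by (auto simp: faces_def)
      then obtain j where j: "B = {j}" by (auto simp: card_1_singleton_iff)
      have "j \<in> {1..n}" using face_subset[OF X B(1)] j by auto
      hence "set_pmf (Z {j}) \<subseteq> extensional {j}"
        using local_support[OF loc, of "{j}"] kL Leaf by (auto simp: PiE_def)
      thus "l1_dist (Z B) (product_law Z B) = 0" unfolding j by (simp add: product_law_singleton)
    qed
  qed auto
  thus ?case by (simp add: product_error_def)
next
  case (Node T1 u T2)
  let ?c = "real q ^ k * \<delta> / 2 + (4 * \<tau> + r / (2 * K) + K * total_corr X \<mu> k d Z) / (2 * \<delta>)"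
  have s: "size1 T1 \<ge> 1" "size1 T2 \<ge> 1" by (simp_all add: size1_size)
  have 1: "product_error \<mu> Z (size1 T1) \<le> real (size1 T1 - 1) * ?c"
    using Node.prems by (intro Node.IH) auto
  have 2: "product_error \<mu> Z (size1 T2) \<le> real (size1 T2 - 1) * ?c"
    using Node.prems by (intro Node.IH) auto
  have "product_error \<mu> Z (size1 T1 + size1 T2) \<le> product_error \<mu> Z (size1 T1) + product_error \<mu> Z (size1 T2) + ?c"
    by (rule product_error_node) (use Node.prems s in auto)
  also have "\<dots> \<le> (real (size1 T1 - 1) + real (size1 T2 - 1) + 1) * ?c"
    using 1 2 by (simp add: distrib_right)
  also have "real (size1 T1 - 1) + real (size1 T2 - 1) + 1 = real (size1 (Node T1 u T2) - 1)"
    using s by simp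
  finally show ?case by simp
qed

end

end

section \<open>Averaging over the rounds\<close>

lemma expectation_bind_finite:
  fixes h :: "'b \<Rightarrow> real"
  assumes "finite (set_pmf p)" "\<And>x. x \<in> set_pmf p \<Longrightarrow> finite (set_pmf (f x))"
  shows "measure_pmf.expectation (bind_pmf p f) h = measure_pmf.expectation p (\<lambda>x. measure_pmf.expectation (f x) h)"
  using assms by (simp add: pmf_expectation_bind[of "set_pmf p"] expectation_finite[of "set_pmf p" p])

lemma expectation_mono_finite:
  fixes f g :: "'b \<Rightarrow> real"
  assumes "finite (set_pmf p)" "\<And>x. x \<in> set_pmf p \<Longrightarrow> f x \<le> g x"
  shows "measure_pmf.expectation p f \<le> measure_pmf.expectation p g"
  using assms by (simp add: expectation_finite[of "set_pmf p" p] sum_mono mult_left_mono)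

context
  fixes X :: "nat set set" and \<mu> :: "nat set pmf" and n k :: nat
  assumes X: "simplicial_complex n X" and \<mu>: "set_pmf \<mu> \<subseteq> faces X k"
begin

lemma finite_top_faces: "finite (set_pmf \<mu>)"
  using finite_subset[OF \<mu> finite_faces[OF X]] .

lemma sum_nonempty_faces:
  "(\<Sum>s\<in>nonempty_faces X k. face_prob \<mu> s * f s) = (\<Sum>i=1..k. \<Sum>s\<in>faces X i. pmf (face_pmf \<mu> i) s * f s)"
proof -
  have "nonempty_faces X k = (\<Union>i\<in>{1..k}. faces X i)" by (auto simp: nonempty_faces_def faces_def)
  hence "(\<Sum>s\<in>nonempty_faces X k. face_prob \<mu> s * f s) = (\<Sum>i=1..k. \<Sum>s\<in>faces X i. face_prob \<mu> s * f s)"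
    by (simp only:) (rule sum.UNION_disjoint, auto simp: finite_faces[OF X], auto simp: faces_def)
  also have "\<dots> = (\<Sum>i=1..k. \<Sum>s\<in>faces X i. pmf (face_pmf \<mu> i) s * f s)"
    by (intro sum.cong refl) (auto simp: face_prob_def faces_def)
  finally show ?thesis .
qed

lemma sum_face_prob_le: "(\<Sum>s\<in>nonempty_faces X k. face_prob \<mu> s) \<le> k"
proof -
  have "(\<Sum>s\<in>nonempty_faces X k. face_prob \<mu> s) = (\<Sum>i=1..k. \<Sum>s\<in>faces X i. pmf (face_pmf \<mu> i) s)"
    using sum_nonempty_faces[of "\<lambda>_. 1"] by simp
  also have "\<dots> \<le> (\<Sum>i=1..k. 1)"
    by (intro sum_mono) (simp add: measure_measure_pmf_finite[symmetric] finite_faces[OF X])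
  finally show ?thesis by simp
qed

lemma finite_replicate: "finite (set_pmf (replicate_pmf m \<mu>))"
  using finite_lists_length_eq[OF finite_top_faces, of m]
  by (simp add: set_replicate_pmf lists_eq_set)

lemma union_replicate:
  assumes "ss \<in> set_pmf (replicate_pmf m \<mu>)"
  shows "\<Union>(set ss) \<subseteq> {1..n}" "card (\<Union>(set ss)) \<le> k * m"
proof -
  have ss: "set ss \<subseteq> set_pmf \<mu>" "length ss = m" using assms by (auto simp: set_replicate_pmf)
  show "\<Union>(set ss) \<subseteq> {1..n}"
    by (intro Union_least face_subset[OF X]) (use ss(1) \<mu> in \<open>auto simp: faces_def\<close>)
  have "card (\<Union>(set ss)) \<le> (\<Sum>A\<in>set ss. card A)" by (rule card_Union_le_sum_card)
  also have "\<dots> = k * card (set ss)" using ss \<mu> by (subst sum.cong[OF refl, of _ _ "\<lambda>_. k"]) (auto simp: faces_def)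
  also have "\<dots> \<le> k * m" using ss(2) card_length[of ss] by simp
  finally show "card (\<Union>(set ss)) \<le> k * m" .
qed

context
  fixes d L :: nat and Y :: ensemble
  assumes loc: "local_ensemble n d L Y"
begin

definition mean_potential :: "nat set \<Rightarrow> real" where
  "mean_potential S = (\<Sum>s\<in>nonempty_faces X k. face_prob \<mu> s * potential d Y S s)"

text \<open>Locality for two further faces: the one that a round reveals and the one whose variance
  is watched.\<close>

lemma room:
  assumes S: "S \<subseteq> {1..n}" "card S + 2 * k \<le> L" and A: "A \<in> X" "card A \<le> k" and s: "s \<in> X" "card s \<le> k"
  shows "S \<union> A \<union> s \<subseteq> {1..n}" "card (S \<union> A \<union> s) \<le> L"
proof -
  show "S \<union> A \<union> s \<subseteq> {1..n}" using S A s face_subset[OF X] by simp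
  show "card (S \<union> A \<union> s) \<le> L"
    using S A s card_Un_le[of "S \<union> A" s] card_Un_le[of S A] by linarith
qed

text \<open>A \<Pi>_i-random face t is a random i-subset of a random top face A, so every size i
  contributes at most the increment obtained by revealing all of A. Summing over the sizes gives the
  factor k.\<close>

lemma expected_total_corr_le:
  assumes S: "S \<subseteq> {1..n}" "card S + 2 * k \<le> L"
  shows "measure_pmf.expectation (Y S) (\<lambda>\<beta>. total_corr X \<mu> k d (condition Y S \<beta>))
    \<le> k * (measure_pmf.expectation \<mu> (\<lambda>A. mean_potential (S \<union> A)) - mean_potential S)"
proof -
  let ?U = "nonempty_faces X k"
  define c where "c s t = measure_pmf.expectation (Y S) (\<lambda>\<beta>. pair_corr d (condition Y S \<beta>) s t)" for s t
  define \<phi> where "\<phi> s t = potential d Y (S \<union> t) s - potential d Y S s" for s t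
  have fp0: "face_prob \<mu> s \<ge> 0" for s by (simp add: face_prob_def)
  have finS: "finite (set_pmf (Y S))"
    using local_support[OF loc S(1)] S finite_subset[OF S(1)]
    by (intro finite_subset[OF _ finite_assignments[of S d]]) auto
  have A: "A \<in> X" "card A = k" if "A \<in> set_pmf \<mu>" for A using \<mu> that by (auto simp: faces_def)
  have U: "s \<in> X" "card s \<le> k" if "s \<in> ?U" for s using that by (auto simp: nonempty_faces_def)
  have c\<phi>: "c s t \<le> \<phi> s t" if "s \<in> ?U" "t \<in> X" "card t \<le> k" for s t
    unfolding c_def \<phi>_def
    using potential_drop[OF loc room[OF S that(2,3) U[OF that(1)]]] by linarith
  have \<phi>_mono: "\<phi> s t \<le> \<phi> s A" if "s \<in> ?U" "A \<in> set_pmf \<mu>" "t \<subseteq> A" for s t A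
  proof -
    have eq: "S \<union> t \<union> A = S \<union> A" using that by auto
    have "potential d Y (S \<union> t) s \<le> potential d Y (S \<union> t \<union> A) s"
      by (rule potential_mono[OF loc]) (use room[OF S _ _ U[OF that(1)], of A] A[OF that(2)] eq in auto)
    thus ?thesis by (simp add: \<phi>_def eq)
  qed
  have face: "(\<Sum>t\<in>faces X i. pmf (face_pmf \<mu> i) t * c s t) \<le> measure_pmf.expectation \<mu> (\<phi> s)"
    if s: "s \<in> ?U" and i: "i \<in> {1..k}" for s i
  proof -
    have "(\<Sum>t\<in>faces X i. pmf (face_pmf \<mu> i) t * c s t) \<le> (\<Sum>t\<in>faces X i. pmf (face_pmf \<mu> i) t * \<phi> s t)"
      using i c\<phi>[OF s] by (intro sum_mono mult_left_mono) (auto simp: faces_def)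
    also have "\<dots> = measure_pmf.expectation (face_pmf \<mu> i) (\<phi> s)"
      using i by (intro expectation_finite[symmetric] finite_faces[OF X] set_face_pmf[OF X \<mu>]) auto
    also have "\<dots> = measure_pmf.expectation \<mu>
        (\<lambda>A. measure_pmf.expectation (pmf_of_set {B. B \<subseteq> A \<and> card B = i}) (\<phi> s))"
      unfolding face_pmf_def
    proof (rule expectation_bind_finite[OF finite_top_faces])
      fix B assume "B \<in> set_pmf \<mu>"
      thus "finite (set_pmf (pmf_of_set {C. C \<subseteq> B \<and> card C = i}))"
        using A face_finite[OF X, of B] subsets_nonempty[of B i] i by (subst set_pmf_of_set) auto
    qed
    also have "\<dots> \<le> measure_pmf.expectation \<mu> (\<phi> s)"
    proof (rule expectation_mono_finite[OF finite_top_faces])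
      fix B assume B: "B \<in> set_pmf \<mu>"
      let ?P = "{C. C \<subseteq> B \<and> card C = i}"
      have P: "finite ?P" "?P \<noteq> {}"
        using A[OF B] face_finite[OF X, of B] subsets_nonempty[of B i] i by auto
      have "measure_pmf.expectation (pmf_of_set ?P) (\<phi> s) \<le> measure_pmf.expectation (pmf_of_set ?P) (\<lambda>_. \<phi> s B)"
        by (rule expectation_mono_finite) (use P \<phi>_mono[OF s B] in auto)
      thus "measure_pmf.expectation (pmf_of_set ?P) (\<phi> s) \<le> \<phi> s B" by simp
    qed
    finally show ?thesis .
  qed
  have "measure_pmf.expectation (Y S) (\<lambda>\<beta>. total_corr X \<mu> k d (condition Y S \<beta>))
      = (\<Sum>s\<in>?U. face_prob \<mu> s * (\<Sum>t\<in>?U. face_prob \<mu> t * c s t))"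
    unfolding total_corr_def c_def sum_distrib_left
    by (simp add: integrable_measure_pmf_finite[OF finS] mult.assoc)
  also have "\<dots> \<le> (\<Sum>s\<in>?U. face_prob \<mu> s * (k * measure_pmf.expectation \<mu> (\<phi> s)))"
  proof (intro sum_mono mult_left_mono fp0)
    fix s assume s: "s \<in> ?U"
    have "(\<Sum>t\<in>?U. face_prob \<mu> t * c s t) = (\<Sum>i=1..k. \<Sum>t\<in>faces X i. pmf (face_pmf \<mu> i) t * c s t)"
      by (rule sum_nonempty_faces)
    also have "\<dots> \<le> (\<Sum>i=1..k. measure_pmf.expectation \<mu> (\<phi> s))"
      by (intro sum_mono face s)
    finally show "(\<Sum>t\<in>?U. face_prob \<mu> t * c s t) \<le> k * measure_pmf.expectation \<mu> (\<phi> s)" by simp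
  qed
  also have "\<dots> = k * measure_pmf.expectation \<mu> (\<lambda>A. \<Sum>s\<in>?U. face_prob \<mu> s * \<phi> s A)"
    by (simp add: integrable_measure_pmf_finite[OF finite_top_faces] sum_distrib_left mult_ac)
  also have "(\<lambda>A. \<Sum>s\<in>?U. face_prob \<mu> s * \<phi> s A) = (\<lambda>A. mean_potential (S \<union> A) - mean_potential S)"
    by (simp add: mean_potential_def \<phi>_def right_diff_distrib sum_subtractf)
  also have "measure_pmf.expectation \<mu> (\<lambda>A. mean_potential (S \<union> A) - mean_potential S)
      = measure_pmf.expectation \<mu> (\<lambda>A. mean_potential (S \<union> A)) - mean_potential S"
    by (simp add: integrable_measure_pmf_finite[OF finite_top_faces])
  finally show ?thesis .
qed

lemma mean_potential_bounds:
  assumes S: "S \<subseteq> {1..n}" "card S + k \<le> L"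
  shows "0 \<le> mean_potential S" "mean_potential S \<le> k"
proof -
  show "0 \<le> mean_potential S"
    unfolding mean_potential_def face_prob_def by (intro sum_nonneg mult_nonneg_nonneg potential_nonneg) auto
  have "mean_potential S \<le> (\<Sum>s\<in>nonempty_faces X k. face_prob \<mu> s * 1)"
    unfolding mean_potential_def
  proof (intro sum_mono mult_left_mono potential_le_1[OF loc])
    fix s assume s: "s \<in> nonempty_faces X k"
    thus "S \<union> s \<subseteq> {1..n}" using S face_subset[OF X] by (simp add: nonempty_faces_def)
    show "card (S \<union> s) \<le> L" using s S card_Un_le[of S s] by (simp add: nonempty_faces_def)
  qed (simp add: face_prob_def)
  thus "mean_potential S \<le> k" using sum_face_prob_le by simp
qed

definition round_potential :: "nat \<Rightarrow> real" where
  "round_potential m = measure_pmf.expectation (replicate_pmf m \<mu>) (\<lambda>ss. mean_potential (\<Union>(set ss)))"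

definition round_corr :: "nat \<Rightarrow> real" where
  "round_corr m = measure_pmf.expectation (replicate_pmf m \<mu>) (\<lambda>ss.
     measure_pmf.expectation (Y (\<Union>(set ss))) (\<lambda>\<beta>. total_corr X \<mu> k d (condition Y (\<Union>(set ss)) \<beta>)))"

text \<open>\<open>replicate_pmf\<close> draws the head first; by independence it may be drawn last
  and become the round added to the other m.\<close>

lemma round_potential_Suc:
  "round_potential (Suc m) = measure_pmf.expectation (replicate_pmf m \<mu>)
     (\<lambda>ss. measure_pmf.expectation \<mu> (\<lambda>A. mean_potential (\<Union>(set ss) \<union> A)))"
proof -
  have "replicate_pmf (Suc m) \<mu> = bind_pmf (replicate_pmf m \<mu>) (\<lambda>ss. map_pmf (\<lambda>A. A # ss) \<mu>)"
    by (simp add: map_pmf_def) (rule bind_commute_pmf)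
  thus ?thesis
    by (simp add: round_potential_def expectation_bind_finite finite_replicate finite_top_faces Un_commute)
qed

lemma round_corr_le:
  assumes "k * m + 2 * k \<le> L"
  shows "round_corr m \<le> k * (round_potential (Suc m) - round_potential m)"
proof -
  have "round_corr m \<le> measure_pmf.expectation (replicate_pmf m \<mu>) (\<lambda>ss.
    k * (measure_pmf.expectation \<mu> (\<lambda>A. mean_potential (\<Union>(set ss) \<union> A)) - mean_potential (\<Union>(set ss))))"
    unfolding round_corr_def
  proof (rule expectation_mono_finite[OF finite_replicate expected_total_corr_le])
    fix ss assume "ss \<in> set_pmf (replicate_pmf m \<mu>)"
    note u = union_replicate[OF this]
    show "\<Union>(set ss) \<subseteq> {1..n}" by (rule u)
    show "card (\<Union>(set ss)) + 2 * k \<le> L" using u(2) assms by linarith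
  qed
  also have "\<dots> = k * (round_potential (Suc m) - round_potential m)"
    unfolding round_potential_Suc unfolding round_potential_def
    by (simp add: integrable_measure_pmf_finite[OF finite_replicate])
  finally show ?thesis .
qed

text \<open>After telescoping, k times one increment of \<open>round_potential\<close> remains, and
  its values lie in [0, k] because the total mass of \<open>face_prob\<close> is at most k. Round M
  involves the potential after M + 1 rounds, with one more face watched: this is the M + 2.\<close>

lemma sum_round_corr_le:
  assumes "k * (M + 2) \<le> L"
  shows "(\<Sum>m=1..M. round_corr m) \<le> real k ^ 2"
proof -
  have bounds: "0 \<le> round_potential m" "round_potential m \<le> k" if "m \<le> M + 1" for m
  proof -
    have b: "0 \<le> mean_potential (\<Union>(set ss))" "mean_potential (\<Union>(set ss)) \<le> k"
      if "ss \<in> set_pmf (replicate_pmf m \<mu>)" for ss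
    proof -
      have "k * (m + 1) \<le> k * (M + 2)" using \<open>m \<le> M + 1\<close> by (intro mult_le_mono) auto
      hence "card (\<Union>(set ss)) + k \<le> L" using union_replicate(2)[OF that] assms by simp
      thus "0 \<le> mean_potential (\<Union>(set ss))" "mean_potential (\<Union>(set ss)) \<le> k"
        using mean_potential_bounds union_replicate(1)[OF that] by blast+
    qed
    show "0 \<le> round_potential m"
      using expectation_mono_finite[OF finite_replicate, of m "\<lambda>_. 0"] b by (simp add: round_potential_def)
    show "round_potential m \<le> k"
      using expectation_mono_finite[OF finite_replicate, of m _ "\<lambda>_. real k"] b by (simp add: round_potential_def)
  qed
  have "(\<Sum>m=1..M. round_corr m) \<le> (\<Sum>m=1..M. k * (round_potential (Suc m) - round_potential m))"
  proof (intro sum_mono round_corr_le)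
    fix m assume "m \<in> {1..M}"
    hence "k * (m + 2) \<le> k * (M + 2)" by (intro mult_le_mono) auto
    also note assms
    finally show "k * m + 2 * k \<le> L" by (simp add: algebra_simps)
  qed
  also have "\<dots> = k * (round_potential (Suc M) - round_potential 1)"
    by (simp add: sum_distrib_left[symmetric] sum_Suc_diff)
  also have "\<dots> \<le> k * (real k - 0)"
    using bounds[of "Suc M"] bounds[of 1] by (intro mult_left_mono) auto
  finally show ?thesis by (simp add: power2_eq_square)
qed

end

end

section \<open>Error of the rounding procedure and choice of the parameters\<close>

lemma product_error_bounds: "0 \<le> product_error \<mu> Z i" "product_error \<mu> Z i \<le> 2"
proof -
  show "0 \<le> product_error \<mu> Z i"
    unfolding product_error_def by (intro Bochner_Integration.integral_nonneg l1_dist_nonneg)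
  have "product_error \<mu> Z i \<le> measure_pmf.expectation (face_pmf \<mu> i) (\<lambda>_. 2)"
    unfolding product_error_def
    by (intro expectation_mono_bounded[where B = 2]) (auto simp: l1_dist_le_2 l1_dist_nonneg)
  thus "product_error \<mu> Z i \<le> 2" by simp
qed

definition round_error :: "nat set pmf \<Rightarrow> ensemble \<Rightarrow> nat \<Rightarrow> nat \<Rightarrow> real" where
  "round_error \<mu> Y k m = measure_pmf.expectation (replicate_pmf m \<mu>) (\<lambda>ss.
     measure_pmf.expectation (Y (\<Union>(set ss))) (\<lambda>\<beta>. product_error \<mu> (condition Y (\<Union>(set ss)) \<beta>) k))"

lemma expectation_bounds:
  fixes f :: "'b \<Rightarrow> real"
  assumes "\<And>x. 0 \<le> f x" "\<And>x. f x \<le> B"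
  shows "0 \<le> measure_pmf.expectation p f" "measure_pmf.expectation p f \<le> B"
proof -
  show "0 \<le> measure_pmf.expectation p f" by (intro Bochner_Integration.integral_nonneg assms)
  have "measure_pmf.expectation p f \<le> measure_pmf.expectation p (\<lambda>_. B)"
    by (rule expectation_mono_bounded[where B = B]) (use assms in \<open>auto intro: order_trans[OF assms(1)] abs_leI\<close>)
  thus "measure_pmf.expectation p f \<le> B" by simp
qed

lemma round_error_bounds: "0 \<le> round_error \<mu> Y k m" "round_error \<mu> Y k m \<le> 2"
  unfolding round_error_def
  by (intro Bochner_Integration.integral_nonneg product_error_bounds)
     (intro expectation_bounds(2) Bochner_Integration.integral_nonneg product_error_bounds)

text \<open>The sampled assignment does not enter the error and integrates out. The expectations are
  exchanged by boundedness, because past the locality the law of the revealed set may have infinite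
  support.\<close>

lemma rounding_error_eq:
  assumes X: "simplicial_complex n X" and \<mu>: "set_pmf \<mu> \<subseteq> faces X k"
  shows "measure_pmf.expectation (pair_pmf \<mu> (propagation_rounding n L Y k \<mu>))
      (\<lambda>(A, Y', \<eta>). l1_dist (Y' A) (product_law Y' A))
    = measure_pmf.expectation (pmf_of_set {1..L div k}) (round_error \<mu> Y k)"
proof -
  let ?PR = "propagation_rounding n L Y k \<mu>"
  let ?f = "\<lambda>(A, Y', \<eta>). l1_dist (Y' A) (product_law Y' A)"
  have b: "\<bar>l1_dist p p'\<bar> \<le> 2" for p p' :: "(nat \<Rightarrow> nat) pmf"
    using l1_dist_nonneg[of p p'] l1_dist_le_2[of p p'] by simp
  have b': "\<bar>?f x\<bar> \<le> 2" for x by (cases x) (simp add: b)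
  have pe: "\<bar>product_error \<mu> Z k\<bar> \<le> 2" for Z using product_error_bounds[of \<mu> Z k] by simp
  have pe': "\<bar>(\<lambda>(Y', \<eta>). product_error \<mu> Y' k) x\<bar> \<le> 2" for x :: "ensemble \<times> (nat \<Rightarrow> nat)"
    using pe by (cases x) simp
  have "pair_pmf \<mu> ?PR = bind_pmf ?PR (\<lambda>y. map_pmf (\<lambda>A. (A, y)) \<mu>)"
    unfolding pair_pmf_def map_pmf_def by (rule bind_commute_pmf)
  hence "measure_pmf.expectation (pair_pmf \<mu> ?PR) ?f
      = measure_pmf.expectation ?PR (\<lambda>y. measure_pmf.expectation (map_pmf (\<lambda>A. (A, y)) \<mu>) ?f)"
    by (simp only: expectation_bind_pmf[where B = 2, OF b'])
  also have "\<dots> = measure_pmf.expectation ?PR (\<lambda>(Y', \<eta>). product_error \<mu> Y' k)"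
    by (intro Bochner_Integration.integral_cong refl)
       (auto simp: product_error_def face_pmf_top[OF X \<mu>])
  also have "\<dots> = measure_pmf.expectation (pmf_of_set {1..L div k}) (round_error \<mu> Y k)"
    unfolding propagation_rounding_def Let_def round_error_def[abs_def]
    by (simp only: expectation_bind_pmf[where B = 2, OF pe'] expectation_return_pmf prod.case
        measure_pmf.prob_space lebesgue_integral_const) simp
  finally show ?thesis .
qed

text \<open>Valid for every m, however large the revealed set: \<open>condition\<close> restricts
  its values to the queried set, so its law on one variable is extensional even where the local
  ensemble prescribes nothing.\<close>

lemma round_error_singletons:
  assumes X: "simplicial_complex n X" and \<mu>: "set_pmf \<mu> \<subseteq> faces X 1"
  shows "round_error \<mu> Y 1 m = 0"
proof -
  have "product_error \<mu> (condition Y S \<beta>) 1 = 0" for S \<beta>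
  proof -
    have "measure_pmf.expectation \<mu> (\<lambda>B. l1_dist (condition Y S \<beta> B) (product_law (condition Y S \<beta>) B))
        = measure_pmf.expectation \<mu> (\<lambda>_. 0)"
    proof (rule integral_cong_AE)
      show "AE B in \<mu>. l1_dist (condition Y S \<beta> B) (product_law (condition Y S \<beta>) B) = 0"
        unfolding AE_measure_pmf_iff
      proof
        fix B assume "B \<in> set_pmf \<mu>"
        hence "card B = 1" using \<mu> by (auto simp: faces_def)
        then obtain j where "B = {j}" by (auto simp: card_1_singleton_iff)
        thus "l1_dist (condition Y S \<beta> B) (product_law (condition Y S \<beta>) B) = 0"
          by (simp add: product_law_singleton condition_extensional)
      qed
    qed auto
    thus ?thesis unfolding product_error_def face_pmf_top[OF X \<mu>] by simp
  qed
  thus ?thesis by (simp add: round_error_def)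
qed

text \<open>Conditioning on at most km variables leaves locality at least 2k: enough for the law of
  a top face and, as positivity is granted for sets of at most half the locality, for the kernel on
  faces of size up to k. The tree bound is affine in \<open>total_corr\<close>, so it passes to
  averages.\<close>

lemma round_error_le:
  fixes T :: "unit tree"
  assumes X: "simplicial_complex n X" and \<mu>: "set_pmf \<mu> \<subseteq> faces X k"
    and Y: "local_PSD_ensemble n d L Y"
    and supp: "\<And>j. j \<in> {1..n} \<Longrightarrow> finite (set_pmf (marginal Y j)) \<and> card (set_pmf (marginal Y j)) \<le> q"
    and q: "q \<ge> 1" and k: "k \<ge> 1" and m: "k * m + 2 * k \<le> L"
    and \<tau>: "\<tau> \<ge> 0" and K: "K > 0" and \<delta>: "\<delta> > 0"
    and T: "size1 T = k"
    and rank: "\<And>T1 T2. Node T1 () T2 \<in> subtrees T \<Longrightarrow>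
      threshold_rank \<tau> (swap_vertices X (size1 T1) (size1 T2)) (swap_weight X \<mu> (size1 T1) (size1 T2)) \<le> r"
  shows "round_error \<mu> Y k m \<le> real k * (real q ^ k * \<delta> / 2 + (4 * \<tau> + r / (2 * K)) / (2 * \<delta>))
    + real k * K / (2 * \<delta>) * round_corr X \<mu> k d Y m"
proof -
  have loc: "local_ensemble n d L Y" using Y by (simp add: local_PSD_ensemble_def)
  let ?a = "real k * (real q ^ k * \<delta> / 2 + (4 * \<tau> + r / (2 * K)) / (2 * \<delta>))"
  let ?b = "real k * K / (2 * \<delta>)"
  have main: "product_error \<mu> (condition Y S \<beta>) k \<le> ?a + ?b * total_corr X \<mu> k d (condition Y S \<beta>)"
    if S: "S \<subseteq> {1..n}" "card S \<le> k * m" and \<beta>: "\<beta> \<in> set_pmf (Y S)" for S \<beta>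
  proof -
    let ?Z = "condition Y S \<beta>"
    have cS: "card S + 2 * k \<le> L" using S m by linarith
    have "product_error \<mu> ?Z (size1 T) \<le> real (size1 T - 1) *
      (real q ^ k * \<delta> / 2 + (4 * \<tau> + r / (2 * K) + K * total_corr X \<mu> k d ?Z) / (2 * \<delta>))"
    proof (rule product_error_tree[OF X \<mu> condition_local[OF loc S(1) \<beta>] _ q _ _ \<tau> K \<delta> _ rank])
      show "card S \<le> L" "k \<le> L - card S" using cS by auto
      show "size1 T \<le> k" using T by simp
      fix j assume j: "j \<in> {1..n}"
      have sub: "set_pmf (marginal ?Z j) \<subseteq> set_pmf (marginal Y j)"
        by (rule condition_marginal_subset[OF loc S(1) \<beta> _ j]) (use cS k in auto)
      show "finite (set_pmf (marginal ?Z j)) \<and> card (set_pmf (marginal ?Z j)) \<le> q"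
        using supp[OF j] sub by (meson card_mono finite_subset le_trans)
    next
      fix a b assume ab: "a + b \<le> k"
      show "psd_on (swap_vertices X a b) (pair_corr d ?Z)"
      proof (rule psd_on_pair_corr[OF Y S(1) \<beta> _ finite_swap_vertices[OF X]])
        show "card S + 2 \<le> L" using cS k by linarith
        fix s assume "s \<in> swap_vertices X a b"
        thus "s \<subseteq> {1..n} \<and> 2 * card s \<le> L - card S"
          using face_subset[OF X, of s] ab cS by (auto simp only: swap_vertices_def faces_def)
      qed
    qed
    also have "\<dots> \<le> real k * (real q ^ k * \<delta> / 2 + (4 * \<tau> + r / (2 * K) + K * total_corr X \<mu> k d ?Z) / (2 * \<delta>))"
      using T \<tau> K \<delta> total_corr_nonneg[of X \<mu> k d ?Z] by (intro mult_right_mono) auto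
    also have "\<dots> = ?a + ?b * total_corr X \<mu> k d ?Z"
      by (simp add: add_divide_distrib distrib_left)
    finally show ?thesis using T by simp
  qed
  have inner: "measure_pmf.expectation (Y S) (\<lambda>\<beta>. product_error \<mu> (condition Y S \<beta>) k)
      \<le> ?a + ?b * measure_pmf.expectation (Y S) (\<lambda>\<beta>. total_corr X \<mu> k d (condition Y S \<beta>))"
    if S: "S \<subseteq> {1..n}" "card S \<le> k * m" for S
  proof -
    have "card S \<le> L" using S m by linarith
    hence fin: "finite (set_pmf (Y S))"
      using local_support[OF loc S(1)] finite_subset[OF S(1)]
      by (intro finite_subset[OF _ finite_assignments[of S d]]) auto
    have "measure_pmf.expectation (Y S) (\<lambda>\<beta>. product_error \<mu> (condition Y S \<beta>) k)
      \<le> measure_pmf.expectation (Y S) (\<lambda>\<beta>. ?a + ?b * total_corr X \<mu> k d (condition Y S \<beta>))"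
      by (rule expectation_mono_finite[OF fin main[OF S]])
    thus ?thesis by (simp add: integrable_measure_pmf_finite[OF fin])
  qed
  note finR = finite_replicate[OF X \<mu>, of m]
  have "round_error \<mu> Y k m \<le> measure_pmf.expectation (replicate_pmf m \<mu>) (\<lambda>ss. ?a + ?b *
      measure_pmf.expectation (Y (\<Union>(set ss))) (\<lambda>\<beta>. total_corr X \<mu> k d (condition Y (\<Union>(set ss)) \<beta>)))"
    unfolding round_error_def
    by (rule expectation_mono_finite[OF finR inner]; rule union_replicate[OF X \<mu>])
  also have "\<dots> = ?a + ?b * round_corr X \<mu> k d Y m"
    by (simp add: round_corr_def[OF X \<mu> loc] integrable_measure_pmf_finite[OF finR])
  finally show ?thesis .
qed

text \<open>All rounds but the last two obey \<open>round_error_le\<close>, and their correlations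
  add up to at most \<open>k\<^sup>2\<close>. The last two contribute at most 2 each, the source of
  the 4.\<close>

lemma rounding_error_le:
  fixes T :: "unit tree"
  assumes X: "simplicial_complex n X" and \<mu>: "set_pmf \<mu> \<subseteq> faces X k"
    and Y: "local_PSD_ensemble n d L Y"
    and supp: "\<And>j. j \<in> {1..n} \<Longrightarrow> finite (set_pmf (marginal Y j)) \<and> card (set_pmf (marginal Y j)) \<le> q"
    and q: "q \<ge> 1" and k: "k \<ge> 1" and M: "L div k \<ge> 2"
    and \<tau>: "\<tau> \<ge> 0" and K: "K > 0" and \<delta>: "\<delta> > 0"
    and T: "size1 T = k"
    and rank: "\<And>T1 T2. Node T1 () T2 \<in> subtrees T \<Longrightarrow>
      threshold_rank \<tau> (swap_vertices X (size1 T1) (size1 T2)) (swap_weight X \<mu> (size1 T1) (size1 T2)) \<le> r"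
  shows "measure_pmf.expectation (pmf_of_set {1..L div k}) (round_error \<mu> Y k)
    \<le> real k * (real q ^ k * \<delta> / 2 + (4 * \<tau> + r / (2 * K)) / (2 * \<delta>))
      + (real k ^ 3 * K / (2 * \<delta>) + 4) / real (L div k)"
proof -
  have loc: "local_ensemble n d L Y" using Y by (simp add: local_PSD_ensemble_def)
  define M where "M = L div k"
  let ?a = "real k * (real q ^ k * \<delta> / 2 + (4 * \<tau> + r / (2 * K)) / (2 * \<delta>))"
  let ?b = "real k * K / (2 * \<delta>)"
  \<comment> \<open>A round m \<le> N satisfies km + 2k \<le> kM \<le> L, the locality that
    \<open>round_error_le\<close> asks for.\<close>
  obtain N where N: "M = N + 2" using M by (metis M_def add.commute le_Suc_ex)
  have kN: "k * (N + 2) \<le> L" using N by (metis M_def times_div_less_eq_dividend)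
  have a0: "?a \<ge> 0" using \<tau> K \<delta> by simp
  have "(\<Sum>m=1..M. round_error \<mu> Y k m) = (\<Sum>m=1..N. round_error \<mu> Y k m)
      + (round_error \<mu> Y k (N + 1) + round_error \<mu> Y k (N + 2))"
    by (simp add: N)
  also have "\<dots> \<le> (\<Sum>m=1..N. ?a + ?b * round_corr X \<mu> k d Y m) + (2 + 2)"
  proof (intro add_mono sum_mono round_error_bounds(2))
    fix m assume "m \<in> {1..N}"
    hence "k * (m + 2) \<le> k * (N + 2)" by (intro mult_le_mono) auto
    also note kN
    finally have "k * m + 2 * k \<le> L" by (simp add: algebra_simps)
    from round_error_le[OF X \<mu> Y supp q k this \<tau> K \<delta> T rank]
    show "round_error \<mu> Y k m \<le> ?a + ?b * round_corr X \<mu> k d Y m" .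
  qed
  also have "\<dots> = N * ?a + ?b * (\<Sum>m=1..N. round_corr X \<mu> k d Y m) + 4"
    by (simp add: sum.distrib sum_distrib_left)
  also have "\<dots> \<le> M * ?a + ?b * real k ^ 2 + 4"
    using sum_round_corr_le[OF X \<mu> loc kN] a0 K \<delta> N
    by (intro add_mono mult_right_mono mult_left_mono) auto
  also have "?b * real k ^ 2 = real k ^ 3 * K / (2 * \<delta>)"
    by (simp add: power2_eq_square power3_eq_cube)
  finally have sum: "(\<Sum>m=1..M. round_error \<mu> Y k m) \<le> M * ?a + real k ^ 3 * K / (2 * \<delta>) + 4" .
  have "measure_pmf.expectation (pmf_of_set {1..M}) (round_error \<mu> Y k) = (\<Sum>m=1..M. round_error \<mu> Y k m) / M"
    using N by (subst integral_pmf_of_set) auto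
  also have "\<dots> \<le> (M * ?a + real k ^ 3 * K / (2 * \<delta>) + 4) / M"
    using sum by (intro divide_right_mono) auto
  also have "\<dots> = ?a + (real k ^ 3 * K / (2 * \<delta>) + 4) / M"
    using N by (simp add: field_simps)
  finally show ?thesis by (simp add: M_def)
qed

text \<open>\<delta> is chosen so that the support term is \<epsilon>/8. Since \<tau> equals
  \<open>\<delta>\<^sup>2 / 4\<close>, its term is \<epsilon>/(8Q), and \<open>K\<close> brings the
  rank term to \<epsilon>/8. What is left, with M = L div k, is
  \<open>16 k^6 Q^2 r / (\<epsilon>^3 M)\<close> and 4/M; the lower bound on \<open>L\<close> makes
  each at most \<epsilon>/8.\<close>

lemma rounding_parameters:
  fixes k L q r :: nat and \<epsilon> :: real
  assumes \<epsilon>: "0 < \<epsilon>" "\<epsilon> \<le> 2" and k: "k \<ge> 1" and q: "q \<ge> 1" and r: "r \<ge> 1"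
    and L: "real L \<ge> 2000 * (real q ^ (4 * k) * real k ^ 7 * real r / \<epsilon> ^ 5)"
  defines "Q \<equiv> real q ^ k"
  defines "\<delta> \<equiv> \<epsilon> / (4 * real k * Q)" and "K \<equiv> 8 * real k ^ 2 * Q * real r / \<epsilon> ^ 2"
    and "\<tau> \<equiv> 1 / 4 * (\<epsilon> / (4 * real k * Q)) ^ 2"
  shows "L div k \<ge> 2"
    and "real k * (Q * \<delta> / 2 + (4 * \<tau> + r / (2 * K)) / (2 * \<delta>))
      + (real k ^ 3 * K / (2 * \<delta>) + 4) / real (L div k) \<le> \<epsilon>"
proof -
  define M where "M = L div k"
  have Q1: "Q \<ge> 1" using q by (simp add: Q_def one_le_power)
  have pos: "real k > 0" "real r > 0" "Q > 0" "\<epsilon> > 0" using k r Q1 \<epsilon> by auto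
  \<comment> \<open>With this abbreviation the assumption reads L \<ge> 2000 R k. The bounds
    \<open>R1\<close> and \<open>R2\<close> adapt it to the two terms with denominator M; both use
    \<epsilon> \<le> 2.\<close>
  define R where "R = Q ^ 4 * real k ^ 6 * real r / \<epsilon> ^ 5"
  have Rp: "R > 0" using pos by (simp add: R_def)
  have R1: "R \<ge> Q ^ 2 * real k ^ 6 * real r / (2 * \<epsilon> ^ 4)"
  proof -
    have "Q ^ 2 * real k ^ 6 * real r / (2 * \<epsilon> ^ 4) \<le> Q ^ 4 * real k ^ 6 * real r / (\<epsilon> * \<epsilon> ^ 4)"
      using pos Q1 \<epsilon> by (intro frac_le mult_right_mono power_increasing) auto
    thus ?thesis by (simp add: R_def power_Suc[symmetric] del: power_Suc)
  qed
  have R2: "R \<ge> 1 / (16 * \<epsilon>)"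
  proof -
    have "\<epsilon> ^ 4 \<le> 2 ^ 4" using \<epsilon> by (intro power_mono) auto
    hence "\<epsilon> * \<epsilon> ^ 4 \<le> \<epsilon> * 16" using \<epsilon> by (intro mult_left_mono) auto
    hence e: "\<epsilon> ^ 5 \<le> 16 * \<epsilon>" by (simp add: power_Suc[symmetric] del: power_Suc)
    have "1 * 1 * 1 \<le> Q ^ 4 * real k ^ 6 * real r"
      using Q1 k r by (intro mult_mono one_le_power) auto
    hence "1 / (16 * \<epsilon>) \<le> Q ^ 4 * real k ^ 6 * real r / \<epsilon> ^ 5"
      using e \<epsilon> by (intro frac_le) auto
    thus ?thesis by (simp add: R_def)
  qed
  have "1 / 32 \<le> 1 / (16 * \<epsilon>)" using \<epsilon> by (simp add: field_simps)
  \<comment> \<open>A constant lower bound absorbs the 1 lost in the integer division when 2000 is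
    halved to 1000.\<close>
  hence R3: "R \<ge> 1 / 32" using R2 by linarith
  have "real L \<ge> 2000 * R * real k"
  proof -
    have "real q ^ (4 * k) = Q ^ 4" by (simp add: Q_def power_mult[symmetric] mult.commute)
    moreover have "real k ^ 7 = real k ^ 6 * real k" by (simp add: power_Suc[symmetric] mult.commute del: power_Suc)
    ultimately show ?thesis using L by (simp add: R_def mult_ac)
  qed
  moreover have "real L < (real M + 1) * real k"
  proof -
    have "L < (M + 1) * k" using k by (simp add: M_def dividend_less_div_times)
    thus ?thesis by (metis of_nat_1 of_nat_add of_nat_less_iff of_nat_mult)
  qed
  ultimately have "2000 * R * real k < (real M + 1) * real k" by linarith
  hence "2000 * R < real M + 1" using pos(1) by (simp add: mult_less_cancel_right)
  hence M: "real M \<ge> 1000 * R" using R3 by linarith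
  hence "real M \<ge> 2" using R3 by linarith
  thus "L div k \<ge> 2" by (simp add: M_def)
  have Mp: "real M > 0" using \<open>real M \<ge> 2\<close> by linarith
  have t1: "real k * (Q * \<delta> / 2) = \<epsilon> / 8"
    using pos by (simp add: \<delta>_def field_simps)
  have t2: "real k * (4 * \<tau> / (2 * \<delta>)) \<le> \<epsilon> / 8"
  proof -
    have "real k * (4 * \<tau> / (2 * \<delta>)) = \<epsilon> / (8 * Q)"
      using pos by (simp add: \<delta>_def \<tau>_def field_simps power2_eq_square)
    also have "\<dots> \<le> \<epsilon> / 8" using pos Q1 by (simp add: field_simps)
    finally show ?thesis .
  qed
  have t3: "real k * (r / (2 * K) / (2 * \<delta>)) = \<epsilon> / 8"
    using pos by (simp add: \<delta>_def K_def field_simps power2_eq_square)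
  have t4: "real k ^ 3 * K / (2 * \<delta>) / real M \<le> \<epsilon> / 8"
  proof -
    have "real k ^ 3 * K / (2 * \<delta>) = 32 * \<epsilon> * (Q ^ 2 * real k ^ 6 * real r / (2 * \<epsilon> ^ 4))"
      using pos by (simp add: \<delta>_def K_def field_simps power2_eq_square eval_nat_numeral)
    also have "\<dots> \<le> 32 * \<epsilon> * (real M / 1000)"
    proof (rule mult_left_mono)
      show "Q ^ 2 * real k ^ 6 * real r / (2 * \<epsilon> ^ 4) \<le> real M / 1000" using R1 M by linarith
    qed (use pos in simp)
    also have "\<dots> \<le> \<epsilon> / 8 * real M" using pos Mp by simp
    finally show ?thesis by (simp only: pos_divide_le_eq[OF Mp])
  qed
  have t5: "4 / real M \<le> \<epsilon> / 8"
  proof -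
    have "32 / \<epsilon> \<le> 1000 * (1 / (16 * \<epsilon>))" using pos by (simp add: field_simps)
    also have "\<dots> \<le> real M" using R2 M by linarith
    finally show ?thesis using pos Mp by (simp add: field_simps)
  qed
  have "real k * (Q * \<delta> / 2 + (4 * \<tau> + r / (2 * K)) / (2 * \<delta>)) + (real k ^ 3 * K / (2 * \<delta>) + 4) / real M
      = real k * (Q * \<delta> / 2) + real k * (4 * \<tau> / (2 * \<delta>)) + real k * (r / (2 * K) / (2 * \<delta>))
        + real k ^ 3 * K / (2 * \<delta>) / real M + 4 / real M"
    by (simp only: add_divide_distrib distrib_left add.assoc)
  also have "\<dots> \<le> \<epsilon> / 8 + \<epsilon> / 8 + \<epsilon> / 8 + \<epsilon> / 8 + \<epsilon> / 8"
    using t1 t2 t3 t4 t5 by (intro add_mono) auto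
  also have "\<dots> \<le> \<epsilon>" using pos by simp
  finally show "real k * (Q * \<delta> / 2 + (4 * \<tau> + r / (2 * K)) / (2 * \<delta>))
      + (real k ^ 3 * K / (2 * \<delta>) + 4) / real (L div k) \<le> \<epsilon>" by (simp add: M_def)
qed

text \<open>For \<epsilon> > 2 the trivial bound 2 suffices, and for k = 1 there is nothing to
  decouple. Otherwise q \<ge> 1 and r \<ge> 1 are established first, since \<delta> divides by a
  power of \<open>q\<close> and \<open>K\<close> must be positive.\<close>

lemma rounding_error_le_epsilon:
  assumes X: "simplicial_complex n X" and \<mu>: "set_pmf \<mu> \<subseteq> faces X k"
    and Y: "local_PSD_ensemble n d L Y"
    and supp: "\<And>j. j \<in> {1..n} \<Longrightarrow> finite (set_pmf (marginal Y j)) \<and> card (set_pmf (marginal Y j)) \<le> q"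
    and \<epsilon>: "\<epsilon> > 0"
    and L: "real L \<ge> 2000 * (real q ^ (4 * k) * real k ^ 7 * real r / \<epsilon> ^ 5)"
    and split: "splittable k X \<mu> (1 / 4 * (\<epsilon> / (4 * real k * real q ^ k)) ^ 2) r"
  shows "measure_pmf.expectation (pair_pmf \<mu> (propagation_rounding n L Y k \<mu>))
    (\<lambda>(A, Y', \<eta>). l1_dist (Y' A) (product_law Y' A)) \<le> \<epsilon>"
proof -
  let ?\<tau> = "1 / 4 * (\<epsilon> / (4 * real k * real q ^ k)) ^ 2"
  obtain T :: "unit tree" where T: "size1 T = k" and rank: "\<And>T1 T2. Node T1 () T2 \<in> subtrees T \<Longrightarrow>
      threshold_rank ?\<tau> (swap_vertices X (size1 T1) (size1 T2)) (swap_weight X \<mu> (size1 T1) (size1 T2)) \<le> r"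
    using split unfolding splittable_def by blast
  have k: "k \<ge> 1" using T by (simp add: size1_size)
  have le2: "measure_pmf.expectation (pmf_of_set {1..L div k}) (round_error \<mu> Y k) \<le> 2"
    by (rule expectation_bounds(2)[OF round_error_bounds])
  consider "\<epsilon> > 2" | "k = 1" | "\<epsilon> \<le> 2" "k \<ge> 2" using k by linarith
  hence "measure_pmf.expectation (pmf_of_set {1..L div k}) (round_error \<mu> Y k) \<le> \<epsilon>"
  proof cases
    case 1
    thus ?thesis using le2 by simp
  next
    case 2
    hence "round_error \<mu> Y k = (\<lambda>_. 0)" using round_error_singletons[OF X, of \<mu> Y] \<mu> by auto
    thus ?thesis using \<epsilon> by simp
  next
    case 3
    have q: "q \<ge> 1"
    proof -
      obtain A where "A \<in> set_pmf \<mu>" using set_pmf_not_empty[of \<mu>] by blast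
      hence A: "A \<in> X" "card A = k" using \<mu> by (auto simp: faces_def)
      hence "A \<noteq> {}" using k by auto
      then obtain j where "j \<in> A" by auto
      hence "j \<in> {1..n}" using face_subset[OF X A(1)] by auto
      from supp[OF this] show ?thesis using set_pmf_not_empty[of "marginal Y j"]
        by (metis One_nat_def Suc_leI card_gt_0_iff le_trans)
    qed
    \<comment> \<open>For k \<ge> 2 the root of \<open>T\<close> is an internal node, and its swap
      graph has positive threshold rank because the threshold is below 1/4.\<close>
    have r: "r \<ge> 1"
    proof -
      obtain T1 T2 where T12: "T = Node T1 () T2" using T 3 by (cases T) auto
      have "real 1 * 1 \<le> real k * real q ^ k" using k q by (intro mult_mono one_le_power) auto
      hence "\<epsilon> / (4 * real k * real q ^ k) \<le> 2 / 4"
        using 3 \<epsilon> by (intro frac_le) auto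
      hence "(\<epsilon> / (4 * real k * real q ^ k)) ^ 2 \<le> (2 / 4) ^ 2"
        using \<epsilon> by (intro power_mono) auto
      also have "\<dots> < (1::real)" by (simp add: power2_eq_square)
      finally have \<tau>: "?\<tau> < 1 / 4" by simp
      have "1 \<le> threshold_rank ?\<tau> (swap_vertices X (size1 T1) (size1 T2)) (swap_weight X \<mu> (size1 T1) (size1 T2))"
        by (rule threshold_rank_pos[OF X \<mu> _ _ \<tau>]) (use T T12 in auto)
      also have "\<dots> \<le> r" by (rule rank) (simp add: T12)
      finally show ?thesis .
    qed
    note par = rounding_parameters[OF \<epsilon> 3(1) k q r L]
    have Qp: "real q ^ k > 0" using q by simp
    show ?thesis
      by (rule order_trans[OF rounding_error_le[OF X \<mu> Y supp q k par(1) _ _ _ T rank] par(2)])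
         (use \<epsilon> k r Qp in auto)
  qed
  thus ?thesis by (simp only: rounding_error_eq[OF X \<mu>])
qed

theorem theorem7p3:
  shows "\<exists>c\<^sub>4 C :: real. c\<^sub>4 \<ge> 0 \<and> C \<ge> 0 \<and>
    (\<forall>(n :: nat) (k :: nat) (L :: nat) (q :: nat) (d :: nat) (r :: nat) (\<epsilon> :: real)
      (X :: nat set set) (\<mu> :: nat set pmf) (Y :: ensemble).
      simplicial_complex n X \<and> pure_complex k X \<and> faces X 1 = (\<lambda>j. {j}) ` {1..n} \<and>
      set_pmf \<mu> \<subseteq> faces X k \<and>
      local_PSD_ensemble n d L Y \<and>
      (\<forall>j\<in>{1..n}. finite (set_pmf (marginal Y j)) \<and> card (set_pmf (marginal Y j)) \<le> q) \<and>
      \<epsilon> > 0 \<and>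
      real L \<ge> C * (real q ^ (4 * k) * real k ^ 7 * real r / \<epsilon> ^ 5) \<and>
      splittable k X \<mu> (c\<^sub>4 * (\<epsilon> / (4 * real k * real q ^ k)) ^ 2) r
      \<longrightarrow>
      measure_pmf.expectation (pair_pmf \<mu> (propagation_rounding n L Y k \<mu>))
        (\<lambda>(A, Y', \<eta>). l1_dist (Y' A) (product_law Y' A)) \<le> \<epsilon>)"
  by (rule exI[of _ "1 / 4"], rule exI[of _ 2000], intro conjI allI impI)
     (simp, simp, (elim conjE, (rule rounding_error_le_epsilon; (assumption | erule (1) bspec))))

end
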